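(* Let $q\ge 1$. For online two-sided selfish scheduling on related machines with the $\ell_q$-norm objective, there exists a randomized polynomial-time mechanism that is two-sided truthful and whose competitive ratio is $O\big(m^{\frac{1}{q}(1-\frac{1}{q})}\cdot(\log m)^{1+\frac{1}{q^2}}\big)$, both in expectation and with high probability.
   Context: Online two-sided selfish scheduling: there are $m$ machines, machine $i$ having a private speed $s_i>0$, and $n$ jobs, job $j$ having a private size $p_j>0$. Initially every machine reports a speed. Then jobs arrive one by one; upon arrival job $j$ reports a size, and the mechanism must immediately and irrevocably assign it (possibly at random) to a machine and charge it a fee $Q_j$. When a job arrives it can observe the reported speeds, the current loads of the machines and the outcomes of previous random assignments. After all jobs are processed, the mechanism pays each machine $i$ an amount $P_i$. If $L_i$ is the total size of jobs assigned to machine $i$, its completion time is $C_i=L_i/s_i$; machine $i$'s utility is $P_i-C_i$. A job's cost is its completion time $F_j$ plus its fee $Q_j$. A mechanism is machine-side truthful if for every machine, reporting its true speed maximizes its expected utility $\mathbb{E}[P_i-C_i]$; it is job-side truthful if for every job, reporting its true size maximizes its expected utility $-\mathbb{E}[F_j+Q_j]$; two-sided truthful if both hold. The objective is the $\ell_q$ norm $\|\mathbf{C}\|_q=(\sum_{i}C_i^q)^{1/q}$ of the vector of machine completion times; the competitive ratio compares the mechanism's objective (under truthful reports) with the optimal offline objective $\mathrm{OPT}$. *)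

theory Defs
  imports "HOL-Probability.Probability" "HOL-Library.Landau_Symbols"
begin

section \<open>Instances, schedules and the \<open>\<ell>\<^sub>q\<close> objective\<close>

text \<open>
  A speed vector is a list of positive reals; its length is the number \<open>m\<close> of machines.
  A history lists, in order of arrival, the (reported) size of each job together with the index of
  the machine the job was assigned to.
\<close>

type_synonym history = "(real \<times> nat) list"

definition valid_speeds :: "real list \<Rightarrow> bool" where
  "valid_speeds s \<longleftrightarrow> s \<noteq> [] \<and> (\<forall>v \<in> set s. v > 0)"

definition valid_sizes :: "real list \<Rightarrow> bool" where
  "valid_sizes ps \<longleftrightarrow> (\<forall>p \<in> set ps. p > 0)"

definition valid_history :: "nat \<Rightarrow> history \<Rightarrow> bool" where
  "valid_history m h \<longleftrightarrow> (\<forall>(p, k) \<in> set h. p > 0 \<and> k < m)"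

definition load :: "history \<Rightarrow> nat \<Rightarrow> real" where
  "load h i = (\<Sum>(p, k)\<leftarrow>h. if k = i then p else 0)"

definition lq_norm :: "real \<Rightarrow> nat \<Rightarrow> (nat \<Rightarrow> real) \<Rightarrow> real" where
  "lq_norm q m C = (\<Sum>i<m. C i powr q) powr (1 / q)"

definition objective :: "real \<Rightarrow> real list \<Rightarrow> history \<Rightarrow> real" where
  "objective q s h = lq_norm q (length s) (\<lambda>i. load h i / s ! i)"

definition opt :: "real \<Rightarrow> real list \<Rightarrow> real list \<Rightarrow> real" where
  "opt q s ps =
     Min {objective q s (zip ps ks) | ks. length ks = length ps \<and> set ks \<subseteq> {..<length s}}"


section \<open>Online randomized mechanisms\<close>

text \<open>
  A seed is an infinite tape of independent uniform samples from the unit interval.  Every arriving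
  job is served with a fresh seed and the final payments use one further fresh seed, so the
  randomness of a step is independent of everything observable before it.
\<close>

type_synonym seed = "nat \<Rightarrow> real"

definition seed_space :: "seed measure" where
  "seed_space = Pi\<^sub>M UNIV (\<lambda>_. uniform_measure lborel {0..1})"

definition run_space :: "(nat \<Rightarrow> seed) measure" where
  "run_space = Pi\<^sub>M UNIV (\<lambda>_. seed_space)"

lemma prob_space_seed_space: "prob_space seed_space"
  unfolding seed_space_def
  by (intro prob_space_PiM prob_space_uniform_measure) auto

lemma prob_space_run_space: "prob_space run_space"
  unfolding run_space_def by (intro prob_space_PiM prob_space_seed_space)

text \<open>
  The arguments of \<open>assign\<close> and \<open>fee\<close> are the reported speeds, the history, the size reported by the
  arriving job and its seed; neither sees future jobs or the number of jobs.  \<open>pay M s h \<xi> i\<close> is the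
  payment to machine \<open>i\<close> after the final history \<open>h\<close>.
\<close>

record mechanism =
  assign :: "real list \<Rightarrow> history \<Rightarrow> real \<Rightarrow> seed \<Rightarrow> nat"
  fee :: "real list \<Rightarrow> history \<Rightarrow> real \<Rightarrow> seed \<Rightarrow> real"
  pay :: "real list \<Rightarrow> history \<Rightarrow> seed \<Rightarrow> nat \<Rightarrow> real"

text \<open>
  The integrability requirements make all the expectations below genuine: the Bochner integral of a
  non-integrable function would be \<open>0\<close>.  Machine indices are in range on every seed, not just almost
  surely, so that runs only pass through finitely many histories, all of them valid.
\<close>

definition wf_mechanism :: "mechanism \<Rightarrow> bool" where
  "wf_mechanism M \<longleftrightarrow>
     (\<forall>s h. valid_speeds s \<and> valid_history (length s) h \<longrightarrow>
        (\<forall>p>0. assign M s h p \<in> measurable seed_space (count_space UNIV) \<and>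
               (\<forall>\<xi>. assign M s h p \<xi> < length s) \<and>
               integrable seed_space (fee M s h p)) \<and>
        (\<forall>i<length s. integrable seed_space (\<lambda>\<xi>. pay M s h \<xi> i)))"

definition run :: "mechanism \<Rightarrow> real list \<Rightarrow> real list \<Rightarrow> (nat \<Rightarrow> seed) \<Rightarrow> history" where
  "run M s ps \<omega> = fold (\<lambda>p h. h @ [(p, assign M s h p (\<omega> (length h)))]) ps []"


section \<open>Truthfulness\<close>

text \<open>
  Expected utility of machine \<open>i\<close> with true speed \<open>v\<close> when the reported speeds are \<open>s\<close>.  The loads
  depend on the reports, the completion time on the true speed.
\<close>

definition machine_utility ::
  "mechanism \<Rightarrow> real list \<Rightarrow> real list \<Rightarrow> nat \<Rightarrow> real \<Rightarrow> real" where
  "machine_utility M s ps i v =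
     (LINT \<omega>|run_space.
        pay M s (run M s ps \<omega>) (\<omega> (length ps)) i - load (run M s ps \<omega>) i / v)"

definition machine_truthful :: "mechanism \<Rightarrow> bool" where
  "machine_truthful M \<longleftrightarrow>
     (\<forall>s ps i v'. valid_speeds s \<and> valid_sizes ps \<and> i < length s \<and> v' > 0 \<longrightarrow>
        machine_utility M s ps i (s ! i) \<ge> machine_utility M (s[i := v']) ps i (s ! i))"

text \<open>
  Expected utility of a job of true size \<open>p\<close> that reports \<open>p'\<close> after having observed the reported
  speeds \<open>s\<close> and the history \<open>h\<close>.  Machines serve their jobs in order of arrival, so the job
  completes when the current load of its machine and the job itself (at its true size) have been
  processed.
\<close>

definition job_utility :: "mechanism \<Rightarrow> real list \<Rightarrow> history \<Rightarrow> real \<Rightarrow> real \<Rightarrow> real" where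
  "job_utility M s h p p' =
     - (LINT \<xi>|seed_space.
          (let i = assign M s h p' \<xi> in (load h i + p) / s ! i) + fee M s h p' \<xi>)"

definition job_truthful :: "mechanism \<Rightarrow> bool" where
  "job_truthful M \<longleftrightarrow>
     (\<forall>s h p p'. valid_speeds s \<and> valid_history (length s) h \<and> p > 0 \<and> p' > 0 \<longrightarrow>
        job_utility M s h p p \<ge> job_utility M s h p p')"

definition two_sided_truthful :: "mechanism \<Rightarrow> bool" where
  "two_sided_truthful M \<longleftrightarrow> machine_truthful M \<and> job_truthful M"


section \<open>Competitive ratio\<close>

definition competitive_in_expectation :: "real \<Rightarrow> mechanism \<Rightarrow> nat \<Rightarrow> real \<Rightarrow> bool" where
  "competitive_in_expectation q M m \<rho> \<longleftrightarrow>
     (\<forall>s ps. valid_speeds s \<and> length s = m \<and> valid_sizes ps \<longrightarrow>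
        (LINT \<omega>|run_space. objective q s (run M s ps \<omega>)) \<le> \<rho> * opt q s ps)"

definition competitive_with_prob :: "real \<Rightarrow> mechanism \<Rightarrow> nat \<Rightarrow> real \<Rightarrow> real \<Rightarrow> bool" where
  "competitive_with_prob q M m \<rho> \<alpha> \<longleftrightarrow>
     (\<forall>s ps. valid_speeds s \<and> length s = m \<and> valid_sizes ps \<longrightarrow>
        \<P>(\<omega> in run_space. objective q s (run M s ps \<omega>) \<le> \<rho> * opt q s ps) \<ge> \<alpha>)"

definition ratio_in_expectation :: "real \<Rightarrow> mechanism \<Rightarrow> (nat \<Rightarrow> real) \<Rightarrow> bool" where
  "ratio_in_expectation q M g \<longleftrightarrow>
     (\<exists>\<rho> \<in> O(g). \<forall>m\<ge>1. competitive_in_expectation q M m (\<rho> m))"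

text \<open>
  With high probability: for every constant \<open>c > 0\<close>, with probability at least \<open>1 - m\<^sup>-\<^sup>c\<close>, where only
  the constant hidden in the \<open>O\<close> may depend on \<open>c\<close>.
\<close>

definition ratio_whp :: "real \<Rightarrow> mechanism \<Rightarrow> (nat \<Rightarrow> real) \<Rightarrow> bool" where
  "ratio_whp q M g \<longleftrightarrow>
     (\<forall>c>0. \<exists>\<rho> \<in> O(g). \<forall>m\<ge>1. competitive_with_prob q M m (\<rho> m) (1 - real m powr (- c)))"


section \<open>Polynomial time on a randomized real RAM\<close>

text \<open>
  Inputs are real numbers, so running time is counted on a real RAM, presented as a structured
  while-language: finitely many named arrays of naturals and of reals, indirect addressing, exact
  real arithmetic and comparisons, powers with a fixed exponent (covering \<open>k\<close>-th roots), and an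
  instruction reading the next uniform sample from a random tape, all at unit cost.  There is no
  rounding operation.  Naturals serve as counters and addresses and have no multiplication.
\<close>

datatype nexp =
    NConst nat
  | NRead string nexp
  | NPlus nexp nexp
  | NMinus nexp nexp

datatype rexp =
    RConst real
  | RRead string nexp
  | ROfNat nexp
  | RPlus rexp rexp
  | RMinus rexp rexp
  | RTimes rexp rexp
  | RDivide rexp rexp
  | RPower rexp real

datatype bexp =
    NLess nexp nexp
  | RLess rexp rexp
  | BNot bexp
  | BAnd bexp bexp

datatype com =
    Skip
  | NAssign string nexp nexp
  | RAssign string nexp rexp
  | Sample string nexp
  | Seq com com
  | Cond bexp com com
  | While bexp com

record state =
  nats :: "string \<Rightarrow> nat \<Rightarrow> nat"
  reals :: "string \<Rightarrow> nat \<Rightarrow> real"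
  tape :: seed

primrec nval :: "nexp \<Rightarrow> state \<Rightarrow> nat" where
  "nval (NConst n) \<sigma> = n"
| "nval (NRead x e) \<sigma> = nats \<sigma> x (nval e \<sigma>)"
| "nval (NPlus a b) \<sigma> = nval a \<sigma> + nval b \<sigma>"
| "nval (NMinus a b) \<sigma> = nval a \<sigma> - nval b \<sigma>"

primrec rval :: "rexp \<Rightarrow> state \<Rightarrow> real" where
  "rval (RConst r) \<sigma> = r"
| "rval (RRead x e) \<sigma> = reals \<sigma> x (nval e \<sigma>)"
| "rval (ROfNat e) \<sigma> = real (nval e \<sigma>)"
| "rval (RPlus a b) \<sigma> = rval a \<sigma> + rval b \<sigma>"
| "rval (RMinus a b) \<sigma> = rval a \<sigma> - rval b \<sigma>"
| "rval (RTimes a b) \<sigma> = rval a \<sigma> * rval b \<sigma>"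
| "rval (RDivide a b) \<sigma> = rval a \<sigma> / rval b \<sigma>"
| "rval (RPower a r) \<sigma> = rval a \<sigma> powr r"

primrec bval :: "bexp \<Rightarrow> state \<Rightarrow> bool" where
  "bval (NLess a b) \<sigma> \<longleftrightarrow> nval a \<sigma> < nval b \<sigma>"
| "bval (RLess a b) \<sigma> \<longleftrightarrow> rval a \<sigma> < rval b \<sigma>"
| "bval (BNot b) \<sigma> \<longleftrightarrow> \<not> bval b \<sigma>"
| "bval (BAnd a b) \<sigma> \<longleftrightarrow> bval a \<sigma> \<and> bval b \<sigma>"

definition set_nat :: "string \<Rightarrow> nat \<Rightarrow> nat \<Rightarrow> state \<Rightarrow> state" where
  "set_nat x k n \<sigma> = \<sigma>\<lparr>nats := (nats \<sigma>)(x := (nats \<sigma> x)(k := n))\<rparr>"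

definition set_real :: "string \<Rightarrow> nat \<Rightarrow> real \<Rightarrow> state \<Rightarrow> state" where
  "set_real x k r \<sigma> = \<sigma>\<lparr>reals := (reals \<sigma>)(x := (reals \<sigma> x)(k := r))\<rparr>"

text \<open>
  \<open>exec c \<sigma> t \<sigma>'\<close>: started in \<open>\<sigma>\<close>, the program \<open>c\<close> halts in \<open>\<sigma>'\<close> after \<open>t\<close> steps.  The expressions in
  a program have bounded size, so charging one unit per command and per test changes the running
  time by at most a constant factor.
\<close>

inductive exec :: "com \<Rightarrow> state \<Rightarrow> nat \<Rightarrow> state \<Rightarrow> bool" where
  exec_Skip: "exec Skip \<sigma> 1 \<sigma>"
| exec_NAssign: "exec (NAssign x e a) \<sigma> 1 (set_nat x (nval e \<sigma>) (nval a \<sigma>) \<sigma>)"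
| exec_RAssign: "exec (RAssign x e a) \<sigma> 1 (set_real x (nval e \<sigma>) (rval a \<sigma>) \<sigma>)"
| exec_Sample:
    "exec (Sample x e) \<sigma> 1
       ((set_real x (nval e \<sigma>) (tape \<sigma> 0) \<sigma>)\<lparr>tape := \<lambda>k. tape \<sigma> (Suc k)\<rparr>)"
| exec_Seq: "exec c \<sigma> t \<sigma>' \<Longrightarrow> exec d \<sigma>' u \<sigma>'' \<Longrightarrow> exec (Seq c d) \<sigma> (t + u) \<sigma>''"
| exec_CondT: "bval b \<sigma> \<Longrightarrow> exec c \<sigma> t \<sigma>' \<Longrightarrow> exec (Cond b c d) \<sigma> (1 + t) \<sigma>'"
| exec_CondF: "\<not> bval b \<sigma> \<Longrightarrow> exec d \<sigma> t \<sigma>' \<Longrightarrow> exec (Cond b c d) \<sigma> (1 + t) \<sigma>'"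
| exec_WhileF: "\<not> bval b \<sigma> \<Longrightarrow> exec (While b c) \<sigma> 1 \<sigma>"
| exec_WhileT:
    "bval b \<sigma> \<Longrightarrow> exec c \<sigma> t \<sigma>' \<Longrightarrow> exec (While b c) \<sigma>' u \<sigma>'' \<Longrightarrow>
       exec (While b c) \<sigma> (1 + t + u) \<sigma>''"

inductive_cases SkipE: "exec Skip \<sigma> t \<sigma>'"
  and NAssignE: "exec (NAssign x e a) \<sigma> t \<sigma>'"
  and RAssignE: "exec (RAssign x e a) \<sigma> t \<sigma>'"
  and SampleE: "exec (Sample x e) \<sigma> t \<sigma>'"
  and SeqE: "exec (Seq c d) \<sigma> t \<sigma>'"
  and CondE: "exec (Cond b c d) \<sigma> t \<sigma>'"
  and WhileE: "exec (While b c) \<sigma> t \<sigma>'"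

lemma exec_deterministic:
  "exec c \<sigma> t \<sigma>' \<Longrightarrow> exec c \<sigma> u \<sigma>'' \<Longrightarrow> t = u \<and> \<sigma>' = \<sigma>''"
proof (induction arbitrary: u \<sigma>'' rule: exec.induct)
  case exec_Skip
  then show ?case by (auto elim: SkipE)
next
  case exec_NAssign
  then show ?case by (auto elim: NAssignE)
next
  case exec_RAssign
  then show ?case by (auto elim: RAssignE)
next
  case exec_Sample
  then show ?case by (auto elim: SampleE)
next
  case exec_Seq
  from exec_Seq.prems show ?case
    by (rule SeqE) (use exec_Seq.IH in fastforce)+
next
  case exec_CondT
  from exec_CondT.prems show ?case
    by (rule CondE) (use exec_CondT.IH exec_CondT.hyps in fastforce)+
next
  case exec_CondF
  from exec_CondF.prems show ?case
    by (rule CondE) (use exec_CondF.IH exec_CondF.hyps in fastforce)+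
next
  case exec_WhileF
  from exec_WhileF.prems show ?case
    by (rule WhileE) (use exec_WhileF.hyps in fastforce)+
next
  case exec_WhileT
  from exec_WhileT.prems show ?case
    by (rule WhileE) (use exec_WhileT.IH exec_WhileT.hyps in fastforce)+
qed

text \<open>All memory cells that do not hold input are initially \<open>0\<close>.\<close>

definition input_state :: "real list \<Rightarrow> history \<Rightarrow> real \<Rightarrow> seed \<Rightarrow> state" where
  "input_state s h p \<xi> =
     \<lparr>nats = (\<lambda>x k.
        if x = ''m'' \<and> k = 0 then length s
        else if x = ''n'' \<and> k = 0 then length h
        else if x = ''machine'' \<and> k < length h then snd (h ! k)
        else 0),
      reals = (\<lambda>x k.
        if x = ''speed'' \<and> k < length s then s ! k
        else if x = ''size'' \<and> k < length h then fst (h ! k)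
        else if x = ''report'' \<and> k = 0 then p
        else 0),
      tape = \<xi>\<rparr>"

text \<open>
  Two fixed programs, for all numbers of machines and jobs: one serves an arriving job, the other
  computes all final payments (it has no report as input, whence the dummy \<open>0\<close>).  The time bound is
  for the worst case over inputs and random tapes.
\<close>

definition polynomial_time :: "mechanism \<Rightarrow> bool" where
  "polynomial_time M \<longleftrightarrow>
     (\<exists>serve settle k. \<forall>s h \<xi>.
        valid_speeds s \<and> valid_history (length s) h \<and> (\<forall>j. \<xi> j \<in> {0..1}) \<longrightarrow>
        (\<forall>p>0. \<exists>t \<sigma>. exec serve (input_state s h p \<xi>) t \<sigma> \<and>
            t \<le> k * (length s + length h + 1) ^ k \<and>
            nats \<sigma> ''assign'' 0 = assign M s h p \<xi> \<and>
            reals \<sigma> ''fee'' 0 = fee M s h p \<xi>) \<and>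
        (\<exists>t \<sigma>. exec settle (input_state s h 0 \<xi>) t \<sigma> \<and>
            t \<le> k * (length s + length h + 1) ^ k \<and>
            (\<forall>i<length s. reals \<sigma> ''pay'' i = pay M s h \<xi> i)))"

end

theory Submission
  imports Defs "HOL-Analysis.Harmonic_Numbers"
begin

text \<open>
  A job of size \<open>p\<close> may only go to machines \<open>i\<close> with \<open>p \<cdot> N\<^sub>>\<^sub>i \<le> s\<^sub>i \<cdot> T\<close>, where \<open>T\<close> is \<open>p\<close> plus the total size of
  the earlier jobs of size at least \<open>p/2\<close>, \<open>N\<^sub>>\<^sub>i\<close> is the \<open>\<ell>\<^sub>a\<close> norm of the speeds exceeding \<open>s\<^sub>i\<close>, and
  \<open>1/a + 1/q = 1\<close>; among these it picks one with probability proportional to \<open>s\<^sub>i\<^sup>a\<close>. The rule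
  ignores where earlier jobs went, so the assignments are independent. A faster machine gets a larger
  expected load, and a larger job is eligible on fewer and faster machines, so Myerson payments make
  both sides truthful; the integrals in these payments are replaced by evaluations at a uniform sample.

  Let \<open>\<Lambda>\<close> be the optimum. An eligible job takes time at most \<open>2\<Lambda>\<close> on its machine, while the jobs
  for which machine \<open>i\<close> is ineligible have total size \<open>O(\<Lambda> N\<^sub>>\<^sub>i)\<close>. Hence the vector \<open>\<mu>\<close> of expected
  completion times satisfies \<open>\<parallel>\<mu>\<parallel>\<^sub>q = O(\<Lambda> (log m)\<^bsup>1/q\<^esup>)\<close>. The noise \<open>\<Sum>\<^sub>j (p\<^sub>j/s\<^sub>i\<^sub>(\<^sub>j\<^sub>))\<^sup>q\<close> of the random
  assignment has mean at most \<open>(2\<Lambda>)\<^bsup>q-1\<^esup> \<parallel>\<mu>\<parallel>\<^sub>1\<close>, and \<open>\<parallel>\<mu>\<parallel>\<^sub>1 \<le> m\<^bsup>1/a\<^esup> \<parallel>\<mu>\<parallel>\<^sub>q\<close>; its \<open>q\<close>-th root is the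
  dominant term, and a Chernoff bound contributes one more factor \<open>log m\<close>.
\<close>

section \<open>The mechanism\<close>

text \<open>The threshold \<open>p/2\<close> in \<open>mass\<close> serves two needs. It rises with
  \<open>p\<close>, so \<open>mass qs p / p\<close> decreases in \<open>p\<close>, as truthfulness
  of the jobs requires. Its slack below \<open>p\<close> lets the last job within a factor two of
  the largest count that whole group, so the ineligible jobs split into groups of halving sizes;
  counting only jobs at least as large as \<open>p\<close> would fail when sizes grow slowly over
  time. The price is the factor 2 in the bound \<open>2\<Lambda>\<close> on the time of an eligible
  job.

  In the concentration step, a Chernoff bound at the common scale \<open>2\<Lambda>\<close> would
  leave an error of order \<open>\<Lambda> log m\<close> on every machine, hence
  \<open>m^(1/q) \<Lambda> log m\<close> in the norm. Each machine is therefore measured at the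
  dyadic scale of the largest job it received. Its error is then at most the deviation times the
  q-th root of its own noise, and the q-th powers of these roots add up to the total noise, whose
  mean carries only \<open>m^(1 - 1/q)\<close>. Its q-th root gives the exponent
  \<open>(1/q)(1 - 1/q)\<close>; the norm of the means contributes \<open>1/q\<^sup>2\<close> to the
  exponent of the logarithm and the deviation contributes 1.\<close>

definition mass :: "real list \<Rightarrow> real \<Rightarrow> real" where
  "mass qs p = p + (\<Sum>k<length qs. if qs ! k < p / 2 then 0 else qs ! k)"

text \<open>This is the \<open>a\<close>-th power of the norm \<open>N\<close> in the eligibility
  rule; comparing \<open>a\<close>-th powers avoids taking roots.\<close>

definition faster_weight :: "real \<Rightarrow> (nat \<Rightarrow> real) \<Rightarrow> nat \<Rightarrow> nat \<Rightarrow> real" where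
  "faster_weight a sp m i = (\<Sum>l<m. if sp i < sp l then sp l powr a else 0)"

text \<open>
  The mechanism uses \<open>c = 1\<close> for \<open>q > 1\<close>. With \<open>c = 0\<close> only the fastest machines keep a positive
  weight; this is the limit \<open>a \<rightarrow> \<infinity>\<close> needed for \<open>q = 1\<close>.
\<close>

definition weight ::
  "real \<Rightarrow> real \<Rightarrow> (nat \<Rightarrow> real) \<Rightarrow> nat \<Rightarrow> real list \<Rightarrow> real \<Rightarrow> nat \<Rightarrow> real" where
  "weight a c sp m qs p i =
     (if c * (mass qs p * sp i / p) powr a < faster_weight a sp m i then 0 else sp i powr a)"

definition total_weight ::
  "real \<Rightarrow> real \<Rightarrow> (nat \<Rightarrow> real) \<Rightarrow> nat \<Rightarrow> real list \<Rightarrow> real \<Rightarrow> real" where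
  "total_weight a c sp m qs p = (\<Sum>i<m. weight a c sp m qs p i)"

definition share ::
  "real \<Rightarrow> real \<Rightarrow> (nat \<Rightarrow> real) \<Rightarrow> nat \<Rightarrow> real list \<Rightarrow> real \<Rightarrow> nat \<Rightarrow> real" where
  "share a c sp m qs p i = weight a c sp m qs p i / total_weight a c sp m qs p"

text \<open>The mean of the inverse speed of the chosen machine, that is, the expected processing
  time per unit of size. It is the allocation curve of a job in Myerson's sense.\<close>

definition slowness ::
  "real \<Rightarrow> real \<Rightarrow> (nat \<Rightarrow> real) \<Rightarrow> nat \<Rightarrow> real list \<Rightarrow> real \<Rightarrow> real" where
  "slowness a c sp m qs p =
     (\<Sum>i<m. weight a c sp m qs p i / sp i) / total_weight a c sp m qs p"

text \<open>Earlier jobs enter only through their sizes, so this can be evaluated for hypothetical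
  speeds without replaying the random choices. The payments rely on that.\<close>

definition expected_load ::
  "real \<Rightarrow> real \<Rightarrow> (nat \<Rightarrow> real) \<Rightarrow> nat \<Rightarrow> real list \<Rightarrow> nat \<Rightarrow> real" where
  "expected_load a c sp m qs i =
     (\<Sum>j<length qs. qs ! j * share a c sp m (take j qs) (qs ! j) i)"

text \<open>
  Inversion of the distribution function: the last index with positive weight whose preceding weights
  sum up to at most \<open>x\<close>. The test \<open>0 < (\<Sum>l<i. w l)\<close> makes the chosen weight positive even when \<open>x < 0\<close>,
  so that seeds outside the unit interval need no special treatment.
\<close>

primrec pick :: "(nat \<Rightarrow> real) \<Rightarrow> real \<Rightarrow> nat \<Rightarrow> nat" where
  "pick w x 0 = 0"
| "pick w x (Suc i) =
     (if 0 < w i \<and> \<not> (0 < (\<Sum>l<i. w l) \<and> x < (\<Sum>l<i. w l)) then i else pick w x i)"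

definition choose_machine ::
  "real \<Rightarrow> real \<Rightarrow> (nat \<Rightarrow> real) \<Rightarrow> nat \<Rightarrow> real list \<Rightarrow> real \<Rightarrow> real \<Rightarrow> nat" where
  "choose_machine a c sp m qs p u =
     pick (weight a c sp m qs p) (u * total_weight a c sp m qs p) m"

text \<open>The fee refunds the completion time computed from the reported size, so a job bears only
  the sampled average plus the effect of its misreport. It uses the sample \<open>\<xi> 0\<close> of
  \<open>assign\<close> again in order to refer to the machine really chosen; \<open>\<xi> 1\<close>
  samples the integral. A payment likewise refunds the completion time at the reported speed and
  subtracts the expected load at a speed sampled above the reported one.\<close>

definition mech :: "real \<Rightarrow> real \<Rightarrow> mechanism" where
  "mech a c =
     \<lparr>assign = (\<lambda>s h p \<xi>. choose_machine a c ((!) s) (length s) (map fst h) p (\<xi> 0)),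
      fee = (\<lambda>s h p \<xi>.
        let i = choose_machine a c ((!) s) (length s) (map fst h) p (\<xi> 0)
        in p * slowness a c ((!) s) (length s) (map fst h) (p * \<xi> 1) - (load h i + p) / s ! i),
      pay = (\<lambda>s h \<xi> i.
        (load h i - expected_load a c ((!) (s[i := s ! i / \<xi> 0])) (length s) (map fst h) i) / s ! i)\<rparr>"

text \<open>Speeds are total functions, so that lists, updated lists and memory arrays can all be
  plugged in; their values from \<open>m\<close> on must not matter.\<close>

lemma weight_cong:
  assumes "\<And>l. l < m \<Longrightarrow> sp l = sp' l" "i < m"
  shows "weight a c sp m qs p i = weight a c sp' m qs p i"
proof -
  have "faster_weight a sp m i = faster_weight a sp' m i"
    unfolding faster_weight_def using assms by (intro sum.cong) auto
  then show ?thesis using assms by (simp add: weight_def)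
qed

lemma total_weight_cong:
  assumes "\<And>l. l < m \<Longrightarrow> sp l = sp' l"
  shows "total_weight a c sp m qs p = total_weight a c sp' m qs p"
  unfolding total_weight_def using weight_cong[OF assms, where i=i for i] by (intro sum.cong) auto

lemma pick_less: "0 < m \<Longrightarrow> pick w x n < m" if "n \<le> m"
  using that by (induction n) auto

section \<open>A program logic for the real RAM\<close>

definition runs :: "com \<Rightarrow> state \<Rightarrow> nat \<Rightarrow> (state \<Rightarrow> bool) \<Rightarrow> bool" where
  "runs c \<sigma> t Q \<longleftrightarrow> (\<exists>t' \<sigma>'. exec c \<sigma> t' \<sigma>' \<and> t' \<le> t \<and> Q \<sigma>')"

primrec written_nats :: "com \<Rightarrow> string set" where
  "written_nats Skip = {}"
| "written_nats (NAssign x e a) = {x}"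
| "written_nats (RAssign x e a) = {}"
| "written_nats (Sample x e) = {}"
| "written_nats (Seq c d) = written_nats c \<union> written_nats d"
| "written_nats (Cond b c d) = written_nats c \<union> written_nats d"
| "written_nats (While b c) = written_nats c"

primrec written_reals :: "com \<Rightarrow> string set" where
  "written_reals Skip = {}"
| "written_reals (NAssign x e a) = {}"
| "written_reals (RAssign x e a) = {x}"
| "written_reals (Sample x e) = {x}"
| "written_reals (Seq c d) = written_reals c \<union> written_reals d"
| "written_reals (Cond b c d) = written_reals c \<union> written_reals d"
| "written_reals (While b c) = written_reals c"

primrec samples :: "com \<Rightarrow> bool" where
  "samples Skip = False"
| "samples (NAssign x e a) = False"
| "samples (RAssign x e a) = False"
| "samples (Sample x e) = True"
| "samples (Seq c d) = (samples c \<or> samples d)"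
| "samples (Cond b c d) = (samples c \<or> samples d)"
| "samples (While b c) = samples c"

text \<open>Tracked per array name only. This is enough to carry every array not mentioned in a
  postcondition across a subprogram for free.\<close>

definition frame :: "com \<Rightarrow> state \<Rightarrow> state \<Rightarrow> bool" where
  "frame c \<sigma> \<sigma>' \<longleftrightarrow>
     (\<forall>x. x \<notin> written_nats c \<longrightarrow> nats \<sigma>' x = nats \<sigma> x) \<and>
     (\<forall>x. x \<notin> written_reals c \<longrightarrow> reals \<sigma>' x = reals \<sigma> x) \<and>
     (\<not> samples c \<longrightarrow> tape \<sigma>' = tape \<sigma>)"

lemma exec_frame: "exec c \<sigma> t \<sigma>' \<Longrightarrow> frame c \<sigma> \<sigma>'"
  by (induction rule: exec.induct) (auto simp: frame_def set_nat_def set_real_def)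

lemma runs_mono:
  assumes "runs c \<sigma> t Q" "t \<le> u" "\<And>\<sigma>'. frame c \<sigma> \<sigma>' \<Longrightarrow> Q \<sigma>' \<Longrightarrow> R \<sigma>'"
  shows "runs c \<sigma> u R"
  using assms exec_frame unfolding runs_def by (meson order_trans)

lemma runs_Seq:
  assumes "runs c \<sigma> t R" "\<And>\<sigma>'. frame c \<sigma> \<sigma>' \<Longrightarrow> R \<sigma>' \<Longrightarrow> runs d \<sigma>' u Q"
  shows "runs (Seq c d) \<sigma> (t + u) Q"
proof -
  from assms(1) obtain t' \<sigma>' where 1: "exec c \<sigma> t' \<sigma>'" "t' \<le> t" "R \<sigma>'"
    unfolding runs_def by blast
  from assms(2)[OF exec_frame[OF 1(1)] 1(3)] obtain u' \<sigma>'' where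
    2: "exec d \<sigma>' u' \<sigma>''" "u' \<le> u" "Q \<sigma>''"
    unfolding runs_def by blast
  show ?thesis unfolding runs_def using exec_Seq[OF 1(1) 2(1)] 1 2 add_mono by blast
qed

text \<open>A symbolic evaluator that lets the simplifier discharge straight-line code. The clause
  for loops is a dummy, excluded by \<open>loop_free\<close>.\<close>

primrec result :: "com \<Rightarrow> state \<Rightarrow> state" where
  "result Skip \<sigma> = \<sigma>"
| "result (NAssign x e a) \<sigma> = set_nat x (nval e \<sigma>) (nval a \<sigma>) \<sigma>"
| "result (RAssign x e a) \<sigma> = set_real x (nval e \<sigma>) (rval a \<sigma>) \<sigma>"
| "result (Sample x e) \<sigma> =
     (set_real x (nval e \<sigma>) (tape \<sigma> 0) \<sigma>)\<lparr>tape := \<lambda>k. tape \<sigma> (Suc k)\<rparr>"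
| "result (Seq c d) \<sigma> = result d (result c \<sigma>)"
| "result (Cond b c d) \<sigma> = (if bval b \<sigma> then result c \<sigma> else result d \<sigma>)"
| "result (While b c) \<sigma> = \<sigma>"

primrec loop_free :: "com \<Rightarrow> bool" where
  "loop_free Skip = True"
| "loop_free (NAssign x e a) = True"
| "loop_free (RAssign x e a) = True"
| "loop_free (Sample x e) = True"
| "loop_free (Seq c d) = (loop_free c \<and> loop_free d)"
| "loop_free (Cond b c d) = (loop_free c \<and> loop_free d)"
| "loop_free (While b c) = False"

text \<open>Both branches of a conditional are charged, which makes the bound independent of the
  state.\<close>

primrec cost :: "com \<Rightarrow> nat" where
  "cost Skip = 1"
| "cost (NAssign x e a) = 1"
| "cost (RAssign x e a) = 1"
| "cost (Sample x e) = 1"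
| "cost (Seq c d) = cost c + cost d"
| "cost (Cond b c d) = 1 + cost c + cost d"
| "cost (While b c) = 0"

lemma loop_free_exec: "loop_free c \<Longrightarrow> \<exists>t. t \<le> cost c \<and> exec c \<sigma> t (result c \<sigma>)"
proof (induction c arbitrary: \<sigma>)
  case (Seq c d)
  obtain t u where "t \<le> cost c" "exec c \<sigma> t (result c \<sigma>)"
    "u \<le> cost d" "exec d (result c \<sigma>) u (result d (result c \<sigma>))"
    using Seq by (metis loop_free.simps(5))
  then show ?case by (intro exI[of _ "t + u"]) (auto intro: exec_Seq)
next
  case (Cond b c d)
  obtain t u where t: "t \<le> cost c" "exec c \<sigma> t (result c \<sigma>)"
    and u: "u \<le> cost d" "exec d \<sigma> u (result d \<sigma>)"
    using Cond by (metis loop_free.simps(6))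
  show ?case
  proof (cases "bval b \<sigma>")
    case True
    then show ?thesis
      using t exec_CondT[OF True t(2), of d] by (intro exI[of _ "1 + t"]) simp
  next
    case False
    then show ?thesis
      using u exec_CondF[OF False u(2), of c] by (intro exI[of _ "1 + u"]) simp
  qed
qed (auto intro: exec.intros(1-4) exI[of _ 1])

lemma runs_loop_free:
  assumes "loop_free c" "cost c \<le> t" "Q (result c \<sigma>)"
  shows "runs c \<sigma> t Q"
  unfolding runs_def using loop_free_exec[OF assms(1)] assms(2,3) by (meson order_trans)

abbreviation zero_index :: nexp where "zero_index \<equiv> NConst 0"
abbreviation nvar :: "string \<Rightarrow> nexp" where "nvar x \<equiv> NRead x zero_index"
abbreviation rvar :: "string \<Rightarrow> rexp" where "rvar x \<equiv> RRead x zero_index"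

definition For :: "string \<Rightarrow> string \<Rightarrow> com \<Rightarrow> com" where
  "For x y c = Seq (NAssign x zero_index (NConst 0))
     (While (NLess (nvar x) (nvar y)) (Seq c (NAssign x zero_index (NPlus (nvar x) (NConst 1)))))"

lemma written_For [simp]:
  "written_nats (For x y c) = insert x (written_nats c)"
  "written_reals (For x y c) = written_reals c"
  "samples (For x y c) = samples c"
  by (auto simp: For_def)

text \<open>Test and increment cost 2 per round, initialisation and final test 2 in total, at most
  \<open>4 * N\<close> altogether; this is the 4 in the bound. The invariant carries the round
  number as an argument and must survive writes to the counter cell, since the increment happens
  after the body has re-established it.\<close>

lemma runs_For:
  assumes y: "x \<noteq> y" "x \<notin> written_nats c" "y \<notin> written_nats c" "nats \<sigma> y 0 = n"
    and n: "n \<le> N" "1 \<le> N"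
    and I0: "I 0 \<sigma>" and Ix: "\<And>k \<sigma>' r. I k \<sigma>' \<Longrightarrow> I k (set_nat x 0 r \<sigma>')"
    and step: "\<And>k \<sigma>'. k < n \<Longrightarrow> frame (For x y c) \<sigma> \<sigma>' \<Longrightarrow> nats \<sigma>' x 0 = k \<Longrightarrow> I k \<sigma>' \<Longrightarrow>
                 runs c \<sigma>' (C * N ^ d) (I (Suc k))"
  shows "runs (For x y c) \<sigma> ((C + 4) * N ^ Suc d) (I n)"
proof -
  let ?b = "NLess (nvar x) (nvar y)"
  let ?c = "Seq c (NAssign x zero_index (NPlus (nvar x) (NConst 1)))"
  \<comment> \<open>Induction on the number \<open>i\<close> of remaining rounds, so the counter
    holds \<open>n - i\<close>.\<close>
  have loop: "runs (While ?b ?c) \<sigma>' (i * (C * N ^ d + 2) + 1) (I n)"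
    if "i \<le> n" "frame (For x y c) \<sigma> \<sigma>'" "nats \<sigma>' x 0 = n - i" "I (n - i) \<sigma>'" for i \<sigma>'
    using that
  proof (induction i arbitrary: \<sigma>')
    case 0
    have "nats \<sigma>' y 0 = n" using 0 y by (simp add: frame_def)
    then have "exec (While ?b ?c) \<sigma>' 1 \<sigma>'" using 0 by (intro exec_WhileF) auto
    then show ?case using 0 by (auto simp: runs_def)
  next
    case (Suc i)
    let ?k = "n - Suc i"
    have k: "?k < n" "Suc ?k = n - i" using Suc.prems(1) by auto
    obtain t \<tau> where t: "exec c \<sigma>' t \<tau>" "t \<le> C * N ^ d" "I (Suc ?k) \<tau>"
      using step[OF k(1) Suc.prems(2,3,4)] unfolding runs_def by blast
    have \<tau>: "frame c \<sigma>' \<tau>" using exec_frame[OF t(1)] .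
    let ?\<tau> = "set_nat x 0 (Suc ?k) \<tau>"
    have e: "exec ?c \<sigma>' (t + 1) ?\<tau>"
    proof (rule exec_Seq[OF t(1)])
      have "nats \<tau> x 0 = ?k" using \<tau> y(2) Suc.prems(3) by (simp add: frame_def)
      then show "exec (NAssign x zero_index (NPlus (nvar x) (NConst 1))) \<tau> 1 ?\<tau>"
        using exec_NAssign[of x zero_index "NPlus (nvar x) (NConst 1)" \<tau>] by simp
    qed
    have "frame (For x y c) \<sigma> ?\<tau>"
      using \<tau> Suc.prems(2) by (auto simp: frame_def set_nat_def)
    moreover have "nats ?\<tau> x 0 = n - i" using k by (simp add: set_nat_def)
    moreover have "I (n - i) ?\<tau>" using Ix[OF t(3)] k by simp
    ultimately have "runs (While ?b ?c) ?\<tau> (i * (C * N ^ d + 2) + 1) (I n)"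
      using Suc.IH Suc.prems(1) by simp
    then obtain u \<sigma>'' where u: "exec (While ?b ?c) ?\<tau> u \<sigma>''"
      "u \<le> i * (C * N ^ d + 2) + 1" "I n \<sigma>''"
      unfolding runs_def by blast
    have "nats \<sigma>' y 0 = n" using Suc.prems y by (simp add: frame_def)
    then have "bval ?b \<sigma>'" using Suc.prems k by simp
    from exec_WhileT[OF this e u(1)] u(3) show ?case unfolding runs_def
    proof (intro exI conjI)
      show "1 + (t + 1) + u \<le> Suc i * (C * N ^ d + 2) + 1" using t(2) u(2) by simp
    qed
  qed
  have "runs (While ?b ?c) (set_nat x 0 0 \<sigma>) (n * (C * N ^ d + 2) + 1) (I n)"
    using I0 Ix by (intro loop) (auto simp: frame_def set_nat_def)
  then have r: "runs (For x y c) \<sigma> (1 + (n * (C * N ^ d + 2) + 1)) (I n)"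
    unfolding For_def by (intro runs_Seq[where R="\<lambda>\<sigma>'. \<sigma>' = set_nat x 0 0 \<sigma>"])
      (auto intro: runs_loop_free)
  have "1 + (n * (C * N ^ d + 2) + 1) \<le> N * (C * N ^ d + 2) + 2 * N"
    using n by (intro order.trans[OF _ add_mono[OF mult_right_mono[OF n(1)] order.refl]]) auto
  also have "\<dots> = C * N ^ Suc d + 4 * N" by (simp add: algebra_simps)
  also have "\<dots> \<le> C * N ^ Suc d + 4 * N ^ Suc d" using n by simp
  finally show ?thesis using runs_mono[OF r] by (simp add: algebra_simps)
qed

text \<open>Coefficients add and exponents take a common upper bound, so the explicit constants
  below are plain sums over the stages.\<close>

lemma runs_Seq_poly:
  assumes "runs c \<sigma> (C * N ^ d) R" "\<And>\<sigma>'. frame c \<sigma> \<sigma>' \<Longrightarrow> R \<sigma>' \<Longrightarrow> runs e \<sigma>' (D * N ^ f) Q"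
    and "d \<le> g" "f \<le> g" "1 \<le> N" "B = C + D"
  shows "runs (Seq c e) \<sigma> (B * N ^ g) Q"
proof -
  have "N ^ d \<le> N ^ g" "N ^ f \<le> N ^ g" using assms by (auto intro: power_increasing)
  then have "C * N ^ d + D * N ^ f \<le> B * N ^ g"
    using assms(6) by (simp add: add_mono distrib_right)
  then show ?thesis using runs_Seq[OF assms(1,2)] runs_mono by blast
qed

section \<open>The mechanism runs in polynomial time\<close>

text \<open>The number of earlier jobs is read from \<open>lim\<close> rather than from
  \<open>n\<close>; settling can then evaluate any prefix of the job sequence on the same input
  array.\<close>

definition mass_prog :: com where
  "mass_prog = Seq (RAssign ''T'' zero_index (rvar ''p''))
     (For ''k'' ''lim''
       (Cond (RLess (RRead ''size'' (nvar ''k'')) (RDivide (rvar ''p'') (RConst 2))) Skip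
         (RAssign ''T'' zero_index (RPlus (rvar ''T'') (RRead ''size'' (nvar ''k''))))))"

definition faster_prog :: "real \<Rightarrow> com" where
  "faster_prog a = Seq (RAssign ''acc'' zero_index (RConst 0))
     (For ''l'' ''m''
       (Cond (RLess (RRead ''speed'' (nvar ''i'')) (RRead ''speed'' (nvar ''l'')))
         (RAssign ''acc'' zero_index (RPlus (rvar ''acc'') (RPower (RRead ''speed'' (nvar ''l'')) a)))
         Skip))"

definition weigh_prog :: "real \<Rightarrow> real \<Rightarrow> com" where
  "weigh_prog a c = Seq
     (Cond (RLess (RTimes (RConst c)
              (RPower (RDivide (RTimes (rvar ''T'') (RRead ''speed'' (nvar ''i''))) (rvar ''p'')) a))
              (rvar ''acc''))
       (RAssign ''w'' (nvar ''i'') (RConst 0))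
       (RAssign ''w'' (nvar ''i'') (RPower (RRead ''speed'' (nvar ''i'')) a)))
     (Seq (RAssign ''tot'' zero_index (RPlus (rvar ''tot'') (RRead ''w'' (nvar ''i''))))
       (RAssign ''slow'' zero_index
         (RPlus (rvar ''slow'') (RDivide (RRead ''w'' (nvar ''i'')) (RRead ''speed'' (nvar ''i''))))))"

definition weights_prog :: "real \<Rightarrow> real \<Rightarrow> com" where
  "weights_prog a c = Seq mass_prog
     (Seq (Seq (RAssign ''tot'' zero_index (RConst 0)) (RAssign ''slow'' zero_index (RConst 0)))
       (For ''i'' ''m'' (Seq (faster_prog a) (weigh_prog a c))))"

lemma written_weights [simp]:
  "written_nats (weights_prog a c) = {''k'', ''i'', ''l''}"
  "written_reals (weights_prog a c) = {''T'', ''tot'', ''slow'', ''acc'', ''w''}"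
  "\<not> samples (weights_prog a c)"
  by (auto simp: weights_prog_def mass_prog_def faster_prog_def weigh_prog_def)

lemma runs_mass_prog:
  assumes "nats \<sigma> ''lim'' 0 = length qs" "length qs \<le> N" "1 \<le> N"
    and "\<And>k. k < length qs \<Longrightarrow> reals \<sigma> ''size'' k = qs ! k" "reals \<sigma> ''p'' 0 = p"
  shows "runs mass_prog \<sigma> (8 * N ^ 1) (\<lambda>\<sigma>'. reals \<sigma>' ''T'' 0 = mass qs p)"
  unfolding mass_prog_def
proof (rule runs_Seq_poly[where C=1 and d=0 and D=7 and f=1 and R="\<lambda>\<sigma>'. reals \<sigma>' ''T'' 0 = p"])
  show "runs (RAssign ''T'' zero_index (rvar ''p'')) \<sigma> (1 * N ^ 0) (\<lambda>\<sigma>'. reals \<sigma>' ''T'' 0 = p)"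
    using assms by (intro runs_loop_free) (auto simp: set_real_def)
next
  fix \<sigma>1 assume fr: "frame (RAssign ''T'' zero_index (rvar ''p'')) \<sigma> \<sigma>1" and T: "reals \<sigma>1 ''T'' 0 = p"
  let ?I = "\<lambda>k \<sigma>'. reals \<sigma>' ''T'' 0 = p + (\<Sum>j<k. if qs ! j < p / 2 then 0 else qs ! j)"
  let ?c = "Cond (RLess (RRead ''size'' (nvar ''k'')) (RDivide (rvar ''p'') (RConst 2))) Skip
         (RAssign ''T'' zero_index (RPlus (rvar ''T'') (RRead ''size'' (nvar ''k''))))"
  have "runs (For ''k'' ''lim'' ?c) \<sigma>1 ((3 + 4) * N ^ Suc 0) (?I (length qs))"
  proof (rule runs_For[where I="?I"])
    fix k \<sigma>'
    assume "k < length qs" "frame (For ''k'' ''lim'' ?c) \<sigma>1 \<sigma>'" "nats \<sigma>' ''k'' 0 = k" "?I k \<sigma>'"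
    then show "runs ?c \<sigma>' (3 * N ^ 0) (?I (Suc k))"
      using assms fr by (intro runs_loop_free) (auto simp: set_real_def frame_def)
  qed (use assms fr T in \<open>auto simp: frame_def set_nat_def\<close>)
  then show "runs (For ''k'' ''lim'' ?c) \<sigma>1 (7 * N ^ 1) (\<lambda>\<sigma>'. reals \<sigma>' ''T'' 0 = mass qs p)"
    by (simp add: mass_def)
qed (use assms in auto)

lemma runs_faster_prog:
  assumes "nats \<sigma> ''m'' 0 = m" "m \<le> N" "1 \<le> N" "nats \<sigma> ''i'' 0 = i"
  shows "runs (faster_prog a) \<sigma> (8 * N ^ 1)
           (\<lambda>\<sigma>'. reals \<sigma>' ''acc'' 0 = faster_weight a (reals \<sigma> ''speed'') m i)"
  unfolding faster_prog_def
proof (rule runs_Seq_poly[where C=1 and d=0 and D=7 and f=1 and R="\<lambda>\<sigma>'. reals \<sigma>' ''acc'' 0 = 0"])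
  show "runs (RAssign ''acc'' zero_index (RConst 0)) \<sigma> (1 * N ^ 0) (\<lambda>\<sigma>'. reals \<sigma>' ''acc'' 0 = 0)"
    using assms by (intro runs_loop_free) (auto simp: set_real_def)
next
  fix \<sigma>1 assume fr: "frame (RAssign ''acc'' zero_index (RConst 0)) \<sigma> \<sigma>1"
    and T: "reals \<sigma>1 ''acc'' 0 = 0"
  let ?s = "reals \<sigma> ''speed''"
  let ?I = "\<lambda>k \<sigma>'. reals \<sigma>' ''acc'' 0 = (\<Sum>l<k. if ?s i < ?s l then ?s l powr a else 0)"
  let ?c = "Cond (RLess (RRead ''speed'' (nvar ''i'')) (RRead ''speed'' (nvar ''l'')))
         (RAssign ''acc'' zero_index (RPlus (rvar ''acc'') (RPower (RRead ''speed'' (nvar ''l'')) a)))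
         Skip"
  have "runs (For ''l'' ''m'' ?c) \<sigma>1 ((3 + 4) * N ^ Suc 0) (?I m)"
  proof (rule runs_For[where I="?I"])
    fix k \<sigma>'
    assume "k < m" "frame (For ''l'' ''m'' ?c) \<sigma>1 \<sigma>'" "nats \<sigma>' ''l'' 0 = k" "?I k \<sigma>'"
    then show "runs ?c \<sigma>' (3 * N ^ 0) (?I (Suc k))"
      using assms fr by (intro runs_loop_free) (auto simp: set_real_def frame_def)
  qed (use assms fr T in \<open>auto simp: frame_def set_nat_def\<close>)
  then show "runs (For ''l'' ''m'' ?c) \<sigma>1 (7 * N ^ 1)
      (\<lambda>\<sigma>'. reals \<sigma>' ''acc'' 0 = faster_weight a ?s m i)"
    by (simp add: faster_weight_def)
qed (use assms in auto)

text \<open>The constant is 8 for the mass, 2 for the initialisation and 18 for the quadratic double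
  loop. The loop computes with the array \<open>speed\<close>; the passage to \<open>sp\<close>,
  which agrees with it only below \<open>m\<close>, is made at the end.\<close>

lemma runs_weights_prog:
  assumes qs: "nats \<sigma> ''lim'' 0 = length qs" "length qs \<le> N" "1 \<le> N"
    and sz: "\<And>k. k < length qs \<Longrightarrow> reals \<sigma> ''size'' k = qs ! k" and p: "reals \<sigma> ''p'' 0 = p"
    and m: "nats \<sigma> ''m'' 0 = m" "m \<le> N"
    and sp: "\<And>l. l < m \<Longrightarrow> reals \<sigma> ''speed'' l = sp l"
  shows "runs (weights_prog a c) \<sigma> (28 * N ^ 2)
     (\<lambda>\<sigma>'. (\<forall>i<m. reals \<sigma>' ''w'' i = weight a c sp m qs p i) \<and>
            reals \<sigma>' ''tot'' 0 = total_weight a c sp m qs p \<and>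
            reals \<sigma>' ''slow'' 0 = (\<Sum>i<m. weight a c sp m qs p i / sp i))"
    (is "runs _ _ _ ?Q")
proof -
  let ?s = "reals \<sigma> ''speed''"
  let ?T = "\<lambda>\<sigma>'. reals \<sigma>' ''T'' 0 = mass qs p"
  let ?w = "weight a c ?s m qs p"
  let ?I = "\<lambda>k \<sigma>'. ?T \<sigma>' \<and> (\<forall>i<k. reals \<sigma>' ''w'' i = ?w i) \<and>
     reals \<sigma>' ''tot'' 0 = (\<Sum>i<k. ?w i) \<and> reals \<sigma>' ''slow'' 0 = (\<Sum>i<k. ?w i / ?s i)"
  let ?i = "Seq (RAssign ''tot'' zero_index (RConst 0)) (RAssign ''slow'' zero_index (RConst 0))"
  let ?c = "Seq (faster_prog a) (weigh_prog a c)"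
  let ?d = "Seq ?i (For ''i'' ''m'' ?c)"
  have "runs (weights_prog a c) \<sigma> (28 * N ^ 2) (?I m)"
    unfolding weights_prog_def
  proof (rule runs_Seq_poly[where C=8 and d=1 and D=20 and f=2 and N=N and R="?T"])
    show "runs mass_prog \<sigma> (8 * N ^ 1) ?T"
      by (rule runs_mass_prog) (use assms in auto)
  next
    fix \<sigma>1 assume f1: "frame mass_prog \<sigma> \<sigma>1" and T1: "?T \<sigma>1"
    show "runs ?d \<sigma>1 (20 * N ^ 2) (?I m)"
    proof (rule runs_Seq_poly[where C=2 and d=0 and D=18 and f=2 and R="?I 0"])
      show "runs ?i \<sigma>1 (2 * N ^ 0) (?I 0)"
        using T1 by (intro runs_loop_free) (auto simp: set_real_def)
    next
      fix \<sigma>2 assume f2: "frame ?i \<sigma>1 \<sigma>2" and I2: "?I 0 \<sigma>2"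
      have "runs (For ''i'' ''m'' ?c) \<sigma>2 ((13 + 4) * N ^ Suc 1) (?I m)"
      proof (rule runs_For[where I="?I"])
        fix k \<sigma>' assume k: "k < m" and f3: "frame (For ''i'' ''m'' ?c) \<sigma>2 \<sigma>'"
          and ik: "nats \<sigma>' ''i'' 0 = k" and Ik: "?I k \<sigma>'"
        have eq: "reals \<sigma>' ''speed'' = ?s" "nats \<sigma>' ''m'' 0 = m" "reals \<sigma>' ''p'' 0 = p"
          using f1 f2 f3 m p
          by (auto simp: frame_def mass_prog_def faster_prog_def weigh_prog_def)
        show "runs ?c \<sigma>' (13 * N ^ 1) (?I (Suc k))"
        proof (rule runs_Seq_poly[where C=8 and d=1 and D=5 and f=0 and
              R="\<lambda>\<sigma>'. reals \<sigma>' ''acc'' 0 = faster_weight a ?s m k"])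
          show "runs (faster_prog a) \<sigma>' (8 * N ^ 1)
              (\<lambda>\<sigma>'. reals \<sigma>' ''acc'' 0 = faster_weight a ?s m k)"
            using runs_faster_prog[OF eq(2) m(2) qs(3) ik] eq(1) by simp
        next
          fix \<sigma>4 assume f4: "frame (faster_prog a) \<sigma>' \<sigma>4"
            and acc: "reals \<sigma>4 ''acc'' 0 = faster_weight a ?s m k"
          have "reals \<sigma>4 ''speed'' = ?s" "reals \<sigma>4 ''p'' 0 = p" "nats \<sigma>4 ''i'' 0 = k" "?I k \<sigma>4"
            using f4 eq ik Ik by (auto simp: frame_def faster_prog_def)
          then show "runs (weigh_prog a c) \<sigma>4 (5 * N ^ 0) (?I (Suc k))"
            using acc unfolding weigh_prog_def
            by (intro runs_loop_free) (auto simp: set_real_def weight_def less_Suc_eq)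
        qed (use qs in auto)
      qed (use m f1 f2 I2 qs in
          \<open>auto simp: frame_def mass_prog_def faster_prog_def weigh_prog_def set_nat_def\<close>)
      then show "runs (For ''i'' ''m'' ?c) \<sigma>2 (18 * N ^ 2) (?I m)"
        by (rule runs_mono) (auto simp: power2_eq_square)
    qed (use qs in auto)
  qed (use qs in auto)
  then show ?thesis
  proof (rule runs_mono)
    fix \<sigma>' :: state assume I: "?I m \<sigma>'"
    have w: "?w i = weight a c sp m qs p i" if "i < m" for i
      using weight_cong[of m ?s sp i a c qs p] sp that by simp
    have t: "total_weight a c ?s m qs p = total_weight a c sp m qs p"
      using total_weight_cong[of m ?s sp a c qs p] sp by simp
    have "(\<Sum>i<m. ?w i / ?s i) = (\<Sum>i<m. weight a c sp m qs p i / sp i)"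
      using w sp by (intro sum.cong) auto
    then show "?Q \<sigma>'" using I w t by (simp add: total_weight_def)
  qed simp
qed

section \<open>Drawing a machine and computing its load\<close>

definition pick_prog :: com where
  "pick_prog = For ''i'' ''m'' (Seq
     (Cond (BAnd (RLess (RConst 0) (RRead ''w'' (nvar ''i'')))
             (BNot (BAnd (RLess (RConst 0) (rvar ''cum'')) (RLess (rvar ''x'') (rvar ''cum'')))))
       (NAssign ''assign'' zero_index (nvar ''i'')) Skip)
     (RAssign ''cum'' zero_index (RPlus (rvar ''cum'') (RRead ''w'' (nvar ''i'')))))"

definition load_prog :: com where
  "load_prog = For ''k'' ''n''
     (Cond (BAnd (BNot (NLess (NRead ''machine'' (nvar ''k'')) (nvar ''assign'')))
                 (BNot (NLess (nvar ''assign'') (NRead ''machine'' (nvar ''k'')))))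
       (RAssign ''ld'' zero_index (RPlus (rvar ''ld'') (RRead ''size'' (nvar ''k'')))) Skip)"

lemma written_pick_load [simp]:
  "written_nats pick_prog = {''i'', ''assign''}" "written_reals pick_prog = {''cum''}"
  "\<not> samples pick_prog"
  "written_nats load_prog = {''k''}" "written_reals load_prog = {''ld''}" "\<not> samples load_prog"
  by (auto simp: pick_prog_def load_prog_def)

lemma load_eq_sum: "load h i = (\<Sum>k<length h. if snd (h ! k) = i then fst (h ! k) else 0)"
  by (simp add: load_def sum_list_sum_nth atLeast0LessThan case_prod_unfold)

text \<open>The loop ascends and overwrites \<open>assign\<close>, so the last admissible index
  wins, exactly as in the recursion of \<open>pick\<close>; the initial value 0 matches its base
  case.\<close>

lemma runs_pick_prog:
  assumes m: "nats \<sigma> ''m'' 0 = m" "m \<le> N" "1 \<le> N" and w: "\<And>i. i < m \<Longrightarrow> reals \<sigma> ''w'' i = w i"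
    and z: "nats \<sigma> ''assign'' 0 = 0" "reals \<sigma> ''cum'' 0 = 0" and x: "reals \<sigma> ''x'' 0 = x"
  shows "runs pick_prog \<sigma> (8 * N ^ 1) (\<lambda>\<sigma>'. nats \<sigma>' ''assign'' 0 = pick w x m)"
proof -
  let ?I = "\<lambda>k \<sigma>'. nats \<sigma>' ''assign'' 0 = pick w x k \<and> reals \<sigma>' ''cum'' 0 = (\<Sum>l<k. w l)"
  have "runs pick_prog \<sigma> ((4 + 4) * N ^ Suc 0) (?I m)"
    unfolding pick_prog_def
  proof (rule runs_For[where I="?I"])
    fix k \<sigma>'
    let ?c = "Seq
     (Cond (BAnd (RLess (RConst 0) (RRead ''w'' (nvar ''i'')))
             (BNot (BAnd (RLess (RConst 0) (rvar ''cum'')) (RLess (rvar ''x'') (rvar ''cum'')))))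
       (NAssign ''assign'' zero_index (nvar ''i'')) Skip)
     (RAssign ''cum'' zero_index (RPlus (rvar ''cum'') (RRead ''w'' (nvar ''i''))))"
    assume "k < m" "frame (For ''i'' ''m'' ?c) \<sigma> \<sigma>'" "nats \<sigma>' ''i'' 0 = k" "?I k \<sigma>'"
    then show "runs ?c \<sigma>' (4 * N ^ 0) (?I (Suc k))"
      using assms by (intro runs_loop_free) (auto simp: set_real_def set_nat_def frame_def)
  qed (use assms in \<open>auto simp: set_nat_def\<close>)
  then show ?thesis by (rule runs_mono) auto
qed

lemma runs_load_prog:
  assumes n: "nats \<sigma> ''n'' 0 = length h" "length h \<le> N" "1 \<le> N"
    and h: "\<And>k. k < length h \<Longrightarrow> reals \<sigma> ''size'' k = fst (h ! k)"
      "\<And>k. k < length h \<Longrightarrow> nats \<sigma> ''machine'' k = snd (h ! k)"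
    and i: "nats \<sigma> ''assign'' 0 = i" and z: "reals \<sigma> ''ld'' 0 = 0"
  shows "runs load_prog \<sigma> (7 * N ^ 1) (\<lambda>\<sigma>'. reals \<sigma>' ''ld'' 0 = load h i)"
proof -
  let ?I = "\<lambda>k \<sigma>'. reals \<sigma>' ''ld'' 0 = (\<Sum>k<k. if snd (h ! k) = i then fst (h ! k) else 0)"
  have "runs load_prog \<sigma> ((3 + 4) * N ^ Suc 0) (?I (length h))"
    unfolding load_prog_def
  proof (rule runs_For[where I="?I"])
    fix k \<sigma>'
    let ?c = "Cond (BAnd (BNot (NLess (NRead ''machine'' (nvar ''k'')) (nvar ''assign'')))
                 (BNot (NLess (nvar ''assign'') (NRead ''machine'' (nvar ''k'')))))
       (RAssign ''ld'' zero_index (RPlus (rvar ''ld'') (RRead ''size'' (nvar ''k'')))) Skip"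
    assume "k < length h" "frame (For ''k'' ''n'' ?c) \<sigma> \<sigma>'" "nats \<sigma>' ''k'' 0 = k" "?I k \<sigma>'"
    then show "runs ?c \<sigma>' (3 * N ^ 0) (?I (Suc k))"
      using assms by (intro runs_loop_free) (auto simp: set_real_def frame_def)
  qed (use assms in \<open>auto simp: set_nat_def\<close>)
  then show ?thesis by (rule runs_mono) (auto simp: load_eq_sum)
qed

section \<open>Serving an arriving job\<close>

definition serve_init :: com where
  "serve_init = Seq (RAssign ''p'' zero_index (rvar ''report'')) (NAssign ''lim'' zero_index (nvar ''n''))"

definition serve_draw :: com where
  "serve_draw = Seq (Sample ''u'' zero_index)
     (Seq (RAssign ''x'' zero_index (RTimes (rvar ''u'') (rvar ''tot'')))
          (RAssign ''cum'' zero_index (RConst 0)))"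

definition serve_redraw :: com where
  "serve_redraw = Seq (Sample ''u'' zero_index)
     (Seq (RAssign ''p'' zero_index (RTimes (rvar ''report'') (rvar ''u'')))
          (RAssign ''ld'' zero_index (RConst 0)))"

definition serve_fee :: com where
  "serve_fee = RAssign ''fee'' zero_index
     (RMinus (RTimes (rvar ''report'') (RDivide (rvar ''slow'') (rvar ''tot'')))
       (RDivide (RPlus (rvar ''ld'') (rvar ''report'')) (RRead ''speed'' (nvar ''assign''))))"

text \<open>The weights are computed twice: for the reported size to draw the machine, and for the
  report scaled by the second sample to obtain the slowness in the fee.\<close>

definition serve :: "real \<Rightarrow> real \<Rightarrow> com" where
  "serve a c = Seq serve_init (Seq (weights_prog a c) (Seq serve_draw (Seq pick_prog
     (Seq serve_redraw (Seq load_prog (Seq (weights_prog a c) serve_fee))))))"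

lemma runs_serve:
  fixes s :: "real list" and h :: history and p a c :: real and \<xi> :: seed
  defines "N \<equiv> length s + length h + 1" and "M \<equiv> mech a c"
  assumes "s \<noteq> []"
  shows "runs (serve a c) (input_state s h p \<xi>) (80 * N ^ 2)
    (\<lambda>\<sigma>. nats \<sigma> ''assign'' 0 = assign M s h p \<xi> \<and> reals \<sigma> ''fee'' 0 = fee M s h p \<xi>)"
proof -
  let ?qs = "map fst h" and ?sp = "(!) s" and ?m = "length s"
  let ?w = "\<lambda>p. weight a c ?sp ?m ?qs p" and ?tot = "\<lambda>p. total_weight a c ?sp ?m ?qs p"
  let ?i = "choose_machine a c ?sp ?m ?qs p (\<xi> 0)"
  let ?F = "p * ((\<Sum>i<?m. ?w (p * \<xi> 1) i / ?sp i) / ?tot (p * \<xi> 1)) - (load h ?i + p) / s ! ?i"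
  \<comment> \<open>The part of the input that all stages read and none overwrites.\<close>
  define base :: "state \<Rightarrow> bool" where "base \<sigma> \<longleftrightarrow> nats \<sigma> ''m'' 0 = ?m \<and> nats \<sigma> ''n'' 0 = length h \<and>
     (\<forall>k<length h. reals \<sigma> ''size'' k = fst (h ! k) \<and> nats \<sigma> ''machine'' k = snd (h ! k)) \<and>
     (\<forall>l<?m. reals \<sigma> ''speed'' l = s ! l) \<and> reals \<sigma> ''report'' 0 = p" for \<sigma>
  have base_frame: "base \<sigma>'" if "frame c \<sigma> \<sigma>'" "base \<sigma>"
    "written_nats c \<inter> {''m'', ''n'', ''machine''} = {}"
    "written_reals c \<inter> {''size'', ''speed'', ''report''} = {}" for c \<sigma> \<sigma>'
    using that by (auto simp: base_def frame_def)
  have N: "?m \<le> N" "length h \<le> N" "1 \<le> N" by (auto simp: N_def)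
  have W: "runs (weights_prog a c) \<sigma> (28 * N ^ 2)
     (\<lambda>\<sigma>'. base \<sigma>' \<and> (\<forall>i<?m. reals \<sigma>' ''w'' i = ?w p' i) \<and> reals \<sigma>' ''tot'' 0 = ?tot p' \<and>
            reals \<sigma>' ''slow'' 0 = (\<Sum>i<?m. ?w p' i / ?sp i))"
    if "base \<sigma>" "nats \<sigma> ''lim'' 0 = length h" "reals \<sigma> ''p'' 0 = p'" for \<sigma> p'
    by (rule runs_mono[OF runs_weights_prog[where qs="?qs" and N=N and p=p' and m="?m" and sp="?sp"]])
      (use that N in \<open>auto simp: base_def frame_def\<close>)
  have "runs (serve a c) (input_state s h p \<xi>) (80 * N ^ 2)
    (\<lambda>\<sigma>. nats \<sigma> ''assign'' 0 = ?i \<and> reals \<sigma> ''fee'' 0 = ?F)"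
    unfolding serve_def
  proof (rule runs_Seq_poly[where C=2 and d=0 and D=78 and f=2 and
      R="\<lambda>\<sigma>. base \<sigma> \<and> nats \<sigma> ''lim'' 0 = length h \<and> reals \<sigma> ''p'' 0 = p \<and>
              nats \<sigma> ''assign'' 0 = 0 \<and> tape \<sigma> = \<xi>"])
    fix \<sigma> assume \<sigma>: "base \<sigma> \<and> nats \<sigma> ''lim'' 0 = length h \<and> reals \<sigma> ''p'' 0 = p \<and>
              nats \<sigma> ''assign'' 0 = 0 \<and> tape \<sigma> = \<xi>"
    show "runs (Seq (weights_prog a c) (Seq serve_draw (Seq pick_prog
     (Seq serve_redraw (Seq load_prog (Seq (weights_prog a c) serve_fee)))))) \<sigma> (78 * N ^ 2)
      (\<lambda>\<sigma>. nats \<sigma> ''assign'' 0 = ?i \<and> reals \<sigma> ''fee'' 0 = ?F)"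
    proof (rule runs_Seq_poly[where C=28 and d=2 and D=50 and f=2],
        rule W)
      fix \<sigma>1 assume f1: "frame (weights_prog a c) \<sigma> \<sigma>1"
        and \<sigma>1: "base \<sigma>1 \<and> (\<forall>i<?m. reals \<sigma>1 ''w'' i = ?w p i) \<and> reals \<sigma>1 ''tot'' 0 = ?tot p \<and>
            reals \<sigma>1 ''slow'' 0 = (\<Sum>i<?m. ?w p i / ?sp i)"
      have t1: "tape \<sigma>1 = \<xi>" "nats \<sigma>1 ''lim'' 0 = length h" "nats \<sigma>1 ''assign'' 0 = 0"
        using f1 \<sigma> by (auto simp: frame_def)
      show "runs (Seq serve_draw (Seq pick_prog (Seq serve_redraw (Seq load_prog
          (Seq (weights_prog a c) serve_fee))))) \<sigma>1 (50 * N ^ 2)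
        (\<lambda>\<sigma>. nats \<sigma> ''assign'' 0 = ?i \<and> reals \<sigma> ''fee'' 0 = ?F)"
      proof (rule runs_Seq_poly[where C=3 and d=0 and D=47 and f=2 and
            R="\<lambda>\<sigma>. base \<sigma> \<and> (\<forall>i<?m. reals \<sigma> ''w'' i = ?w p i) \<and> reals \<sigma> ''x'' 0 = \<xi> 0 * ?tot p \<and>
               reals \<sigma> ''cum'' 0 = 0 \<and> tape \<sigma> = (\<lambda>k. \<xi> (Suc k)) \<and> nats \<sigma> = nats \<sigma>1"])
        show "runs serve_draw \<sigma>1 (3 * N ^ 0) (\<lambda>\<sigma>. base \<sigma> \<and> (\<forall>i<?m. reals \<sigma> ''w'' i = ?w p i) \<and>
           reals \<sigma> ''x'' 0 = \<xi> 0 * ?tot p \<and>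
               reals \<sigma> ''cum'' 0 = 0 \<and> tape \<sigma> = (\<lambda>k. \<xi> (Suc k)) \<and> nats \<sigma> = nats \<sigma>1)"
          unfolding serve_draw_def using \<sigma>1 t1
          by (intro runs_loop_free) (auto simp: set_real_def base_def)
      next
        fix \<sigma>2 assume \<sigma>2: "base \<sigma>2 \<and> (\<forall>i<?m. reals \<sigma>2 ''w'' i = ?w p i) \<and>
               reals \<sigma>2 ''x'' 0 = \<xi> 0 * ?tot p \<and>
               reals \<sigma>2 ''cum'' 0 = 0 \<and> tape \<sigma>2 = (\<lambda>k. \<xi> (Suc k)) \<and> nats \<sigma>2 = nats \<sigma>1"
        show "runs (Seq pick_prog (Seq serve_redraw (Seq load_prog
          (Seq (weights_prog a c) serve_fee)))) \<sigma>2 (47 * N ^ 2)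
        (\<lambda>\<sigma>. nats \<sigma> ''assign'' 0 = ?i \<and> reals \<sigma> ''fee'' 0 = ?F)"
        proof (rule runs_Seq_poly[where C=8 and d=1 and D=39 and f=2],
            rule runs_pick_prog[where m="?m" and w="?w p" and x="\<xi> 0 * ?tot p"])
          fix \<sigma>3 assume f3: "frame pick_prog \<sigma>2 \<sigma>3"
            and \<sigma>3: "nats \<sigma>3 ''assign'' 0 = pick (?w p) (\<xi> 0 * ?tot p) ?m"
          have "base \<sigma>3" by (rule base_frame[OF f3]) (use \<sigma>2 in auto)
          moreover have "tape \<sigma>3 = (\<lambda>k. \<xi> (Suc k))" "nats \<sigma>3 ''lim'' 0 = length h"
            using f3 \<sigma>2 t1 by (simp_all add: frame_def)
          moreover have "nats \<sigma>3 ''assign'' 0 = ?i"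
            using \<sigma>3 by (simp add: choose_machine_def)
          ultimately have t3: "base \<sigma>3" "tape \<sigma>3 = (\<lambda>k. \<xi> (Suc k))"
            "nats \<sigma>3 ''lim'' 0 = length h" "nats \<sigma>3 ''assign'' 0 = ?i" by blast+
          show "runs (Seq serve_redraw (Seq load_prog (Seq (weights_prog a c) serve_fee))) \<sigma>3
            (39 * N ^ 2) (\<lambda>\<sigma>. nats \<sigma> ''assign'' 0 = ?i \<and> reals \<sigma> ''fee'' 0 = ?F)"
          proof (rule runs_Seq_poly[where C=3 and d=0 and D=36 and f=2 and
              R="\<lambda>\<sigma>. base \<sigma> \<and> reals \<sigma> ''p'' 0 = p * \<xi> 1 \<and> reals \<sigma> ''ld'' 0 = 0 \<and>
                  nats \<sigma> = nats \<sigma>3"])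
            show "runs serve_redraw \<sigma>3 (3 * N ^ 0) (\<lambda>\<sigma>. base \<sigma> \<and> reals \<sigma> ''p'' 0 = p * \<xi> 1 \<and>
                reals \<sigma> ''ld'' 0 = 0 \<and> nats \<sigma> = nats \<sigma>3)"
              unfolding serve_redraw_def using t3
              by (intro runs_loop_free) (auto simp: set_real_def base_def)
          next
            fix \<sigma>4 assume \<sigma>4: "base \<sigma>4 \<and> reals \<sigma>4 ''p'' 0 = p * \<xi> 1 \<and> reals \<sigma>4 ''ld'' 0 = 0 \<and>
                  nats \<sigma>4 = nats \<sigma>3"
            show "runs (Seq load_prog (Seq (weights_prog a c) serve_fee)) \<sigma>4
              (36 * N ^ 2) (\<lambda>\<sigma>. nats \<sigma> ''assign'' 0 = ?i \<and> reals \<sigma> ''fee'' 0 = ?F)"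
            proof (rule runs_Seq_poly[where C=7 and d=1 and D=29 and f=2],
                rule runs_load_prog[where h=h and i="?i"])
              fix \<sigma>5 assume f5: "frame load_prog \<sigma>4 \<sigma>5" and \<sigma>5: "reals \<sigma>5 ''ld'' 0 = load h ?i"
              have "base \<sigma>5" by (rule base_frame[OF f5]) (use \<sigma>4 in auto)
              moreover have "reals \<sigma>5 ''p'' 0 = p * \<xi> 1" "nats \<sigma>5 ''lim'' 0 = length h"
                "nats \<sigma>5 ''assign'' 0 = ?i"
                using f5 \<sigma>4 t3 by (simp_all add: frame_def)
              ultimately have t5: "base \<sigma>5" "reals \<sigma>5 ''p'' 0 = p * \<xi> 1"
                "nats \<sigma>5 ''lim'' 0 = length h" "nats \<sigma>5 ''assign'' 0 = ?i" by blast+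
              show "runs (Seq (weights_prog a c) serve_fee) \<sigma>5 (29 * N ^ 2)
                (\<lambda>\<sigma>. nats \<sigma> ''assign'' 0 = ?i \<and> reals \<sigma> ''fee'' 0 = ?F)"
              proof (rule runs_Seq_poly[where C=28 and d=2 and D=1 and f=0],
                  rule W[OF t5(1,3,2)])
                fix \<sigma>6 assume f6: "frame (weights_prog a c) \<sigma>5 \<sigma>6"
                  and \<sigma>6: "base \<sigma>6 \<and> (\<forall>i<?m. reals \<sigma>6 ''w'' i = ?w (p * \<xi> 1) i) \<and>
                    reals \<sigma>6 ''tot'' 0 = ?tot (p * \<xi> 1) \<and>
                    reals \<sigma>6 ''slow'' 0 = (\<Sum>i<?m. ?w (p * \<xi> 1) i / ?sp i)"
                have "?i < ?m" using pick_less[of ?m ?m] assms by (simp add: choose_machine_def)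
                show "runs serve_fee \<sigma>6 (1 * N ^ 0) (\<lambda>\<sigma>. nats \<sigma> ''assign'' 0 = ?i \<and> reals \<sigma> ''fee'' 0 = ?F)"
                  unfolding serve_fee_def using f6 \<sigma>6 t5 \<sigma>5 \<open>?i < ?m\<close>
                  by (intro runs_loop_free) (auto simp: set_real_def frame_def base_def)
              qed (use N in auto)
            qed (use \<sigma>4 t3 N in \<open>auto simp: base_def\<close>)
          qed (use N in auto)
        qed (use \<sigma>2 t1 N in \<open>auto simp: base_def\<close>)
      qed (use N in auto)
    qed (use \<sigma> N in auto)
  next
    show "runs serve_init (input_state s h p \<xi>) (2 * N ^ 0) (\<lambda>\<sigma>. base \<sigma> \<and> nats \<sigma> ''lim'' 0 = length h \<and>
       reals \<sigma> ''p'' 0 = p \<and> nats \<sigma> ''assign'' 0 = 0 \<and> tape \<sigma> = \<xi>)"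
      unfolding serve_init_def
      by (intro runs_loop_free) (auto simp: set_real_def set_nat_def input_state_def base_def)
  qed (use N in auto)
  then show ?thesis by (simp add: M_def mech_def Let_def slowness_def)
qed

section \<open>Settling the payments of the machines\<close>

definition settle_enter :: com where
  "settle_enter = Seq (NAssign ''assign'' zero_index (nvar ''r''))
     (Seq (RAssign ''sav'' zero_index (RRead ''speed'' (nvar ''r'')))
     (Seq (RAssign ''speed'' (nvar ''r'') (RDivide (rvar ''sav'') (rvar ''u'')))
     (Seq (RAssign ''ld'' zero_index (RConst 0)) (RAssign ''ex'' zero_index (RConst 0)))))"

definition settle_job :: com where
  "settle_job = Seq (RAssign ''p'' zero_index (RRead ''size'' (nvar ''j'')))
     (NAssign ''lim'' zero_index (nvar ''j''))"

definition settle_share :: com where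
  "settle_share = RAssign ''ex'' zero_index (RPlus (rvar ''ex'')
     (RTimes (rvar ''p'') (RDivide (RRead ''w'' (nvar ''r'')) (rvar ''tot''))))"

definition settle_jobs :: "real \<Rightarrow> real \<Rightarrow> com" where
  "settle_jobs a c = For ''j'' ''n'' (Seq settle_job (Seq (weights_prog a c) settle_share))"

definition settle_leave :: com where
  "settle_leave = Seq (RAssign ''speed'' (nvar ''r'') (rvar ''sav''))
     (RAssign ''pay'' (nvar ''r'') (RDivide (RMinus (rvar ''ld'') (rvar ''ex'')) (rvar ''sav'')))"

text \<open>One sample serves all machines, since truthfulness concerns the expected payment of each
  machine separately. In round \<open>r\<close> the speed of machine \<open>r\<close> is overwritten
  by its sampled value and restored from \<open>sav\<close> afterwards; the cell
  \<open>assign\<close> passes the index \<open>r\<close> to \<open>load_prog\<close>.\<close>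

definition settle :: "real \<Rightarrow> real \<Rightarrow> com" where
  "settle a c = Seq (Sample ''u'' zero_index)
     (For ''r'' ''m'' (Seq settle_enter (Seq load_prog (Seq (settle_jobs a c) settle_leave))))"

lemma written_settle [simp]:
  "written_nats (settle_jobs a c) = {''j'', ''lim'', ''k'', ''i'', ''l''}"
  "written_reals (settle_jobs a c) = {''p'', ''T'', ''tot'', ''slow'', ''acc'', ''w'', ''ex''}"
  "\<not> samples (settle_jobs a c)"
  by (auto simp: settle_jobs_def settle_job_def settle_share_def)

lemma runs_settle_jobs:
  assumes n: "nats \<sigma> ''n'' 0 = length qs" "length qs \<le> N" "1 \<le> N"
    and sz: "\<And>k. k < length qs \<Longrightarrow> reals \<sigma> ''size'' k = qs ! k"
    and m: "nats \<sigma> ''m'' 0 = m" "m \<le> N"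
    and sp: "\<And>l. l < m \<Longrightarrow> reals \<sigma> ''speed'' l = sp l"
    and r: "nats \<sigma> ''r'' 0 = r" "r < m" and ex: "reals \<sigma> ''ex'' 0 = 0"
  shows "runs (settle_jobs a c) \<sigma> (35 * N ^ 3) (\<lambda>\<sigma>'. reals \<sigma>' ''ex'' 0 = expected_load a c sp m qs r)"
proof -
  let ?I = "\<lambda>k \<sigma>'. reals \<sigma>' ''ex'' 0 = (\<Sum>j<k. qs ! j * share a c sp m (take j qs) (qs ! j) r)"
  let ?c = "Seq settle_job (Seq (weights_prog a c) settle_share)"
  have "runs (settle_jobs a c) \<sigma> ((31 + 4) * N ^ Suc 2) (?I (length qs))"
    unfolding settle_jobs_def
  proof (rule runs_For[where I="?I"])
    fix k \<sigma>1
    assume k: "k < length qs" and f1: "frame (For ''j'' ''n'' ?c) \<sigma> \<sigma>1"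
      and j: "nats \<sigma>1 ''j'' 0 = k" and I: "?I k \<sigma>1"
    have f: "reals \<sigma>1 ''size'' = reals \<sigma> ''size''" "reals \<sigma>1 ''speed'' = reals \<sigma> ''speed''"
      "nats \<sigma>1 ''m'' 0 = m" "nats \<sigma>1 ''r'' 0 = r"
      using f1 m r by (simp_all add: frame_def settle_job_def settle_share_def)
    let ?R = "\<lambda>\<sigma>'. reals \<sigma>' ''size'' = reals \<sigma> ''size'' \<and> reals \<sigma>' ''speed'' = reals \<sigma> ''speed'' \<and>
      nats \<sigma>' ''m'' 0 = m \<and> nats \<sigma>' ''r'' 0 = r \<and> ?I k \<sigma>' \<and> reals \<sigma>' ''p'' 0 = qs ! k"
    show "runs ?c \<sigma>1 (31 * N ^ 2) (?I (Suc k))"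
    proof (rule runs_Seq_poly[where C=2 and d=0 and D=29 and f=2 and
          R="\<lambda>\<sigma>'. ?R \<sigma>' \<and> nats \<sigma>' ''lim'' 0 = k"])
      show "runs settle_job \<sigma>1 (2 * N ^ 0) (\<lambda>\<sigma>'. ?R \<sigma>' \<and> nats \<sigma>' ''lim'' 0 = k)"
        unfolding settle_job_def using f j I k sz
        by (intro runs_loop_free) (simp_all add: set_real_def set_nat_def)
    next
      fix \<sigma>2 :: state assume R2: "?R \<sigma>2 \<and> nats \<sigma>2 ''lim'' 0 = k"
      show "runs (Seq (weights_prog a c) settle_share) \<sigma>2 (29 * N ^ 2) (?I (Suc k))"
      proof (rule runs_Seq_poly[where C=28 and d=2 and D=1 and f=0],
          rule runs_weights_prog[where qs="take k qs" and N=N and p="qs ! k" and m=m and sp=sp])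
        fix \<sigma>3 :: state assume f3: "frame (weights_prog a c) \<sigma>2 \<sigma>3"
          and w: "(\<forall>i<m. reals \<sigma>3 ''w'' i = weight a c sp m (take k qs) (qs ! k) i) \<and>
            reals \<sigma>3 ''tot'' 0 = total_weight a c sp m (take k qs) (qs ! k) \<and>
            reals \<sigma>3 ''slow'' 0 = (\<Sum>i<m. weight a c sp m (take k qs) (qs ! k) i / sp i)"
        have "?R \<sigma>3" using f3 R2 by (simp add: frame_def)
        then show "runs settle_share \<sigma>3 (1 * N ^ 0) (?I (Suc k))"
          unfolding settle_share_def using w r
          by (intro runs_loop_free) (simp_all add: set_real_def share_def)
      qed (use R2 k n sz sp m in auto)
    qed (use n in auto)
  qed (use n ex in \<open>auto simp: set_nat_def settle_job_def settle_share_def\<close>)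
  then show ?thesis by (rule runs_mono) (auto simp: expected_load_def power_numeral_reduce)
qed

lemma runs_settle:
  fixes s :: "real list" and h :: history and a c :: real and \<xi> :: seed
  defines "N \<equiv> length s + length h + 1" and "M \<equiv> mech a c"
  shows "runs (settle a c) (input_state s h 0 \<xi>) (54 * N ^ 4)
    (\<lambda>\<sigma>. \<forall>i<length s. reals \<sigma> ''pay'' i = pay M s h \<xi> i)"
proof -
  let ?qs = "map fst h" and ?m = "length s"
  have N: "?m \<le> N" "length h \<le> N" "1 \<le> N" by (auto simp: N_def)
  let ?sp = "\<lambda>r. (!) (s[r := s ! r / \<xi> 0])"
  let ?pay = "\<lambda>r. (load h r - expected_load a c (?sp r) ?m ?qs r) / s ! r"
  define base :: "state \<Rightarrow> bool" where "base \<sigma> \<longleftrightarrow> nats \<sigma> ''m'' 0 = ?m \<and> nats \<sigma> ''n'' 0 = length h \<and>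
     (\<forall>k<length h. reals \<sigma> ''size'' k = fst (h ! k) \<and> nats \<sigma> ''machine'' k = snd (h ! k)) \<and>
     reals \<sigma> ''u'' 0 = \<xi> 0" for \<sigma>
  have base_frame: "base \<sigma>'" if "frame c \<sigma> \<sigma>'" "base \<sigma>"
    "written_nats c \<inter> {''m'', ''n'', ''machine''} = {}"
    "written_reals c \<inter> {''size'', ''u''} = {}" for c \<sigma> \<sigma>'
    using that by (auto simp: base_def frame_def)
  let ?I = "\<lambda>k \<sigma>. base \<sigma> \<and> (\<forall>l<?m. reals \<sigma> ''speed'' l = s ! l) \<and> (\<forall>i<k. reals \<sigma> ''pay'' i = ?pay i)"
  let ?c = "Seq settle_enter (Seq load_prog (Seq (settle_jobs a c) settle_leave))"
  have "runs (settle a c) (input_state s h 0 \<xi>) (54 * N ^ 4) (?I ?m)"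
    unfolding settle_def
  proof (rule runs_Seq_poly[where C=1 and d=0 and D=53 and f=4 and R="?I 0"])
    show "runs (Sample ''u'' zero_index) (input_state s h 0 \<xi>) (1 * N ^ 0) (?I 0)"
      by (intro runs_loop_free) (simp_all add: base_def input_state_def set_real_def)
  next
    fix \<sigma>1 assume I1: "?I 0 \<sigma>1"
    have "runs (For ''r'' ''m'' ?c) \<sigma>1 ((49 + 4) * N ^ Suc 3) (?I ?m)"
    proof (rule runs_For[where I="?I"])
      fix k \<sigma>2 assume k: "k < ?m" and r: "nats \<sigma>2 ''r'' 0 = k" and I: "?I k \<sigma>2"
      let ?J = "\<lambda>\<sigma>. base \<sigma> \<and> nats \<sigma> ''r'' 0 = k \<and> nats \<sigma> ''assign'' 0 = k \<and>
        reals \<sigma> ''sav'' 0 = s ! k \<and>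
        (\<forall>l<?m. reals \<sigma> ''speed'' l = ?sp k l) \<and> (\<forall>i<k. reals \<sigma> ''pay'' i = ?pay i)"
      have J_frame: "?J \<sigma>'" if "frame c \<sigma> \<sigma>'" "?J \<sigma>"
        "written_nats c \<inter> {''m'', ''n'', ''machine'', ''r'', ''assign''} = {}"
        "written_reals c \<inter> {''size'', ''u'', ''sav'', ''speed'', ''pay''} = {}" for c \<sigma> \<sigma>'
      proof -
        have "base \<sigma>'" by (rule base_frame[OF that(1)]) (use that in auto)
        then show ?thesis using that by (simp add: frame_def)
      qed
      show "runs ?c \<sigma>2 (49 * N ^ 3) (?I (Suc k))"
      proof (rule runs_Seq_poly[where C=5 and d=0 and D=44 and f=3 and
            R="\<lambda>\<sigma>. ?J \<sigma> \<and> reals \<sigma> ''ld'' 0 = 0 \<and> reals \<sigma> ''ex'' 0 = 0"])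
        show "runs settle_enter \<sigma>2 (5 * N ^ 0)
          (\<lambda>\<sigma>. ?J \<sigma> \<and> reals \<sigma> ''ld'' 0 = 0 \<and> reals \<sigma> ''ex'' 0 = 0)"
          unfolding settle_enter_def using I r k
          by (intro runs_loop_free)
            (simp_all add: set_real_def set_nat_def base_def nth_list_update)
      next
        fix \<sigma>3 :: state assume J3: "?J \<sigma>3 \<and> reals \<sigma>3 ''ld'' 0 = 0 \<and> reals \<sigma>3 ''ex'' 0 = 0"
        show "runs (Seq load_prog (Seq (settle_jobs a c) settle_leave)) \<sigma>3 (44 * N ^ 3) (?I (Suc k))"
        proof (rule runs_Seq_poly[where C=7 and d=1 and D=37 and f=3],
            rule runs_load_prog[where h=h and i=k])
          fix \<sigma>4 :: state assume f4: "frame load_prog \<sigma>3 \<sigma>4" and ld: "reals \<sigma>4 ''ld'' 0 = load h k"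
          have J4: "?J \<sigma>4" by (rule J_frame[OF f4]) (use J3 in auto)
          have ex: "reals \<sigma>4 ''ex'' 0 = 0" using f4 J3 by (simp add: frame_def)
          show "runs (Seq (settle_jobs a c) settle_leave) \<sigma>4 (37 * N ^ 3) (?I (Suc k))"
          proof (rule runs_Seq_poly[where C=35 and d=3 and D=2 and f=0],
              rule runs_settle_jobs[where qs="?qs" and sp="?sp k" and m="?m" and r=k])
            fix \<sigma>5 :: state assume f5: "frame (settle_jobs a c) \<sigma>4 \<sigma>5"
              and ex: "reals \<sigma>5 ''ex'' 0 = expected_load a c (?sp k) ?m ?qs k"
            have J5: "?J \<sigma>5" by (rule J_frame[OF f5]) (use J4 in auto)
            have ld5: "reals \<sigma>5 ''ld'' 0 = load h k" using f5 ld by (simp add: frame_def)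
            show "runs settle_leave \<sigma>5 (2 * N ^ 0) (?I (Suc k))"
              unfolding settle_leave_def using J5 ex ld5 k
              by (intro runs_loop_free)
                (auto simp: set_real_def base_def nth_list_update less_Suc_eq)
          qed (use J4 ex N k in \<open>auto simp: base_def\<close>)
        qed (use J3 N in \<open>auto simp: base_def\<close>)
      qed (use N in auto)
    qed (use I1 N in \<open>auto simp: set_nat_def base_def settle_enter_def settle_leave_def\<close>)
    then show "runs (For ''r'' ''m'' ?c) \<sigma>1 (53 * N ^ 4) (?I ?m)"
      by (rule runs_mono) (auto simp: power_numeral_reduce)
  qed (use N in auto)
  then show ?thesis by (rule runs_mono) (auto simp: M_def mech_def)
qed

lemma polynomial_time_mech: "polynomial_time (mech a c)"
  unfolding polynomial_time_def
proof (rule exI[of _ "serve a c"], rule exI[of _ "settle a c"], rule exI[of _ 80], intro allI impI conjI)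
  fix s :: "real list" and h :: history and \<xi> :: seed
  assume *: "valid_speeds s \<and> valid_history (length s) h \<and> (\<forall>j. \<xi> j \<in> {0..1})"
  let ?N = "length s + length h + 1"
  \<comment> \<open>\<open>polynomial_time\<close> uses a single number as factor and exponent, so
    the larger constant 80 plays both roles.\<close>
  have le: "80 * ?N ^ 2 \<le> 80 * ?N ^ 80" "54 * ?N ^ 4 \<le> 80 * ?N ^ 80"
    by (intro mult_le_mono power_increasing; simp)+
  show "\<exists>t \<sigma>. exec (serve a c) (input_state s h p \<xi>) t \<sigma> \<and> t \<le> 80 * ?N ^ 80 \<and>
      nats \<sigma> ''assign'' 0 = assign (mech a c) s h p \<xi> \<and> reals \<sigma> ''fee'' 0 = fee (mech a c) s h p \<xi>" for p
    using runs_serve[of s a c h p \<xi>] * le(1) unfolding runs_def valid_speeds_def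
    by (meson order_trans)
  show "\<exists>t \<sigma>. exec (settle a c) (input_state s h 0 \<xi>) t \<sigma> \<and> t \<le> 80 * ?N ^ 80 \<and>
      (\<forall>i<length s. reals \<sigma> ''pay'' i = pay (mech a c) s h \<xi> i)"
    using runs_settle[of a c s h \<xi>] le(2) unfolding runs_def by (meson order_trans)
qed

section \<open>Monotonicity of the assignment probabilities\<close>

lemma faster_weight_nonneg: "0 \<le> faster_weight a sp m i"
  by (auto simp: faster_weight_def intro!: sum_nonneg)

lemma weight_nonneg: "0 \<le> weight a c sp m qs p i"
  by (simp add: weight_def)

lemma total_weight_nonneg: "0 \<le> total_weight a c sp m qs p"
  by (simp add: total_weight_def sum_nonneg weight_nonneg)

lemma share_nonneg: "0 \<le> share a c sp m qs p i"
  by (simp add: share_def weight_nonneg total_weight_nonneg)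

lemma share_le_1: "i < m \<Longrightarrow> share a c sp m qs p i \<le> 1"
  using member_le_sum[of i "{..<m}" "weight a c sp m qs p"]
  by (auto simp: share_def total_weight_def weight_nonneg divide_le_eq_1 sum_nonneg
      intro: order.not_eq_order_implies_strict)

lemma mass_ge: "(\<And>k. k < length qs \<Longrightarrow> 0 \<le> qs ! k) \<Longrightarrow> p \<le> mass qs p"
  by (auto simp: mass_def intro!: sum_nonneg)

text \<open>Raising \<open>p\<close> raises the threshold, hence shrinks the sum over the other
  jobs, while the denominator grows; the summand \<open>p\<close> itself contributes the constant
  1.\<close>

lemma mass_div_antimono:
  assumes "\<And>k. k < length qs \<Longrightarrow> 0 \<le> qs ! k" "0 < p" "p \<le> p'"
  shows "mass qs p' / p' \<le> mass qs p / p"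
proof -
  let ?S = "\<lambda>p. \<Sum>k<length qs. if qs ! k < p / 2 then 0 else qs ! k"
  have "?S p' \<le> ?S p" using assms by (intro sum_mono) auto
  moreover have "0 \<le> ?S p'" using assms by (intro sum_nonneg) auto
  ultimately have "?S p' / p' \<le> ?S p / p" using assms by (intro frac_le) auto
  then show ?thesis using assms by (simp add: mass_def add_divide_distrib)
qed

text \<open>No machine is faster than the fastest one, so its threshold is 0 and it passes the test
  for every size, even when \<open>c = 0\<close>.\<close>

lemma fastest_weight:
  assumes "0 < m" "\<And>l. l < m \<Longrightarrow> 0 < sp l" "0 \<le> c"
  shows "\<exists>i<m. 0 < weight a c sp m qs p i"
proof -
  have "finite (sp ` {..<m})" "sp ` {..<m} \<noteq> {}" using assms by auto
  then have "Max (sp ` {..<m}) \<in> sp ` {..<m}" by (rule Max_in)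
  then obtain i where i: "i < m" "sp i = Max (sp ` {..<m})" by auto
  have "\<not> sp i < sp l" if "l < m" for l
    using that i \<open>finite (sp ` {..<m})\<close> by (simp add: not_less)
  then have "faster_weight a sp m i = 0" by (auto simp: faster_weight_def intro!: sum.neutral)
  moreover have "0 \<le> c * (mass qs p * sp i / p) powr a" using assms by simp
  ultimately show ?thesis using i assms(2)[of i] by (auto simp: weight_def intro!: exI[of _ i])
qed

lemma total_weight_pos:
  assumes "0 < m" "\<And>l. l < m \<Longrightarrow> 0 < sp l" "0 \<le> c"
  shows "0 < total_weight a c sp m qs p"
proof -
  obtain i where "i < m" "0 < weight a c sp m qs p i" using fastest_weight[of m sp c] assms by blast
  then show ?thesis unfolding total_weight_def
    by (intro sum_pos2[where i=i]) (auto simp: weight_nonneg)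
qed

lemma sum_share:
  assumes "0 < m" "\<And>l. l < m \<Longrightarrow> 0 < sp l" "0 \<le> c"
  shows "(\<Sum>i<m. share a c sp m qs p i) = 1"
proof -
  have "0 < total_weight a c sp m qs p" by (rule total_weight_pos) (use assms in auto)
  then show ?thesis by (simp add: share_def total_weight_def flip: sum_divide_distrib)
qed

lemma fraction_mono:
  fixes w w' R R' :: real
  assumes "0 \<le> w" "w \<le> w'" "0 \<le> R'" "R' \<le> R"
  shows "w / (w + R) \<le> w' / (w' + R')"
proof (cases "w = 0")
  case False
  then have "0 < w" "0 < w'" using assms by auto
  then have "w * (w' + R') \<le> w' * (w + R)"
    using assms mult_mono[of w w' R' R] by (simp add: algebra_simps)
  then show ?thesis using \<open>0 < w\<close> \<open>0 < w'\<close> assms by (simp add: divide_simps)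
qed (use assms in auto)

text \<open>Speeding up machine \<open>i\<close> helps it three times: fewer machines are faster
  than it, its side of the eligibility test grows, and so does its weight. For every other machine
  the weight of the faster ones can only grow, so it may drop out but never enter.\<close>

lemma share_mono:
  assumes m: "i < m" and sp: "\<And>l. l < m \<Longrightarrow> 0 < sp l" and v: "sp i \<le> v"
    and a: "0 < a" "0 \<le> c" and p: "0 \<le> p" "0 \<le> mass qs p"
  shows "share a c sp m qs p i \<le> share a c (sp(i := v)) m qs p i"
proof -
  let ?sp = "sp(i := v)"
  let ?w = "weight a c sp m qs p" and ?w' = "weight a c ?sp m qs p"
  have tot: "total_weight a c sp m qs p = ?w i + sum ?w ({..<m} - {i})"
    "total_weight a c ?sp m qs p = ?w' i + sum ?w' ({..<m} - {i})"
    unfolding total_weight_def using m by (simp_all add: sum.remove[of _ i])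
  have "faster_weight a ?sp m i \<le> faster_weight a sp m i"
    unfolding faster_weight_def using v by (intro sum_mono) auto
  moreover have "c * (mass qs p * sp i / p) powr a \<le> c * (mass qs p * v / p) powr a"
    using p a v sp[OF m] by (intro mult_left_mono powr_mono2 divide_right_mono) auto
  moreover have "sp i powr a \<le> v powr a" using a v sp[OF m] by (intro powr_mono2) auto
  ultimately have "?w i \<le> ?w' i" by (auto simp: weight_def)
  moreover have "?w' l \<le> ?w l" if l: "l \<in> {..<m} - {i}" for l
  proof -
    have "sp k powr a \<le> ?sp k powr a" if "k < m" for k
      using a v sp[OF that] by (intro powr_mono2) auto
    moreover have "sp l < ?sp k" if "sp l < sp k" for k using v that by auto
    ultimately have "faster_weight a sp m l \<le> faster_weight a ?sp m l"
      unfolding faster_weight_def using l by (intro sum_mono) auto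
    then show ?thesis using l by (auto simp: weight_def)
  qed
  ultimately show ?thesis unfolding share_def tot
    by (intro fraction_mono sum_nonneg sum_mono) (auto simp: weight_nonneg)
qed

text \<open>A larger size only removes machines, and the removed ones are never faster than those
  that stay. Dropping the slow part of a weighted mean of inverse speeds lowers the mean.\<close>

lemma slowness_antimono:
  assumes m: "0 < m" and sp: "\<And>l. l < m \<Longrightarrow> 0 < sp l" and a: "0 < a" "0 \<le> c"
    and qs: "\<And>k. k < length qs \<Longrightarrow> 0 \<le> qs ! k" and p: "0 < p" "p \<le> p'"
  shows "slowness a c sp m qs p' \<le> slowness a c sp m qs p"
proof -
  let ?w = "weight a c sp m qs p" and ?w' = "weight a c sp m qs p'"
  \<comment> \<open>The weight lost in passing from \<open>p\<close> to \<open>p'\<close>.\<close>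
  define f where "f i = ?w i - ?w' i" for i
  have elig: "c * (mass qs p' * sp i / p') powr a \<le> c * (mass qs p * sp i / p) powr a"
    if "i < m" for i
  proof -
    have "mass qs p' / p' * sp i \<le> mass qs p / p * sp i"
      using mass_div_antimono[OF qs p] sp[OF that] by (intro mult_right_mono) auto
    moreover have "0 \<le> mass qs p'" using mass_ge[OF qs, of p'] p by simp
    ultimately show ?thesis using a sp[OF that] p by (intro mult_left_mono powr_mono2) auto
  qed
  have f0: "0 \<le> f i" if "i < m" for i
    using elig[OF that] by (auto simp: f_def weight_def)
  \<comment> \<open>If a lost machine were faster than a surviving one, ineligibility for
    \<open>p'\<close> would pass down to the slower machine.\<close>
  have upper: "sp k \<le> sp l" if kl: "k < m" "l < m" "f k \<noteq> 0" "?w' l \<noteq> 0" for k l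
  proof (rule ccontr)
    assume "\<not> sp k \<le> sp l"
    then have less: "sp l < sp k" by simp
    have "?w' k = 0" using kl elig[OF kl(1)] by (auto simp: f_def weight_def split: if_splits)
    then have "c * (mass qs p' * sp k / p') powr a < faster_weight a sp m k"
      using sp[OF kl(1)] by (auto simp: weight_def split: if_splits)
    moreover have "faster_weight a sp m k \<le> faster_weight a sp m l"
      unfolding faster_weight_def using less by (intro sum_mono) auto
    moreover have "c * (mass qs p' * sp l / p') powr a \<le> c * (mass qs p' * sp k / p') powr a"
      using a less sp[OF kl(2)] p mass_ge[OF qs, of p']
      by (intro mult_left_mono powr_mono2 divide_right_mono) auto
    ultimately have "?w' l = 0" by (simp add: weight_def)
    then show False using kl by simp
  qed
  let ?B = "\<lambda>w. \<Sum>i<m. w i / sp i" and ?T = "\<lambda>w. \<Sum>i<m. w i"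
  have "f k * ?w' l / sp l \<le> f k * ?w' l / sp k" if "k < m" "l < m" for k l
  proof (cases "f k = 0 \<or> ?w' l = 0")
    case False
    then show ?thesis using upper[OF that] sp[OF that(1)] f0[OF that(1)]
      by (intro divide_left_mono mult_nonneg_nonneg) (auto simp: weight_nonneg sp that)
  qed auto
  then have "(\<Sum>k<m. \<Sum>l<m. f k * ?w' l / sp l) \<le> (\<Sum>k<m. \<Sum>l<m. f k * ?w' l / sp k)"
    by (intro sum_mono) auto
  \<comment> \<open>The comparison of the two means in cross-multiplied form: the mean inverse speed
    of the lost part is at least that of the surviving part.\<close>
  then have ineq: "?T f * ?B ?w' \<le> ?B f * ?T ?w'"
    by (simp add: sum_product)
  have w: "?T ?w = ?T ?w' + ?T f" "?B ?w = ?B ?w' + ?B f"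
    by (simp_all add: f_def sum_subtractf diff_divide_distrib)
  have "?B ?w' * ?T ?w \<le> ?B ?w * ?T ?w'"
    unfolding w using ineq by (simp add: algebra_simps)
  moreover have "0 < ?T ?w" "0 < ?T ?w'"
    using total_weight_pos[of m sp c a qs] m sp a by (simp_all add: total_weight_def)
  ultimately show ?thesis
    by (simp add: slowness_def total_weight_def divide_simps)
qed

lemma expected_load_mono:
  assumes m: "i < m" and sp: "\<And>l. l < m \<Longrightarrow> 0 < sp l" and v: "sp i \<le> v"
    and a: "0 < a" "0 \<le> c" and qs: "\<And>k. k < length qs \<Longrightarrow> 0 < qs ! k"
  shows "expected_load a c sp m qs i \<le> expected_load a c (sp(i := v)) m qs i"
  unfolding expected_load_def
proof (intro sum_mono mult_left_mono share_mono[where sp=sp, OF m sp v a])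
  fix j assume j: "j \<in> {..<length qs}"
  then have "0 < qs ! j" using qs by simp
  moreover have "qs ! j \<le> mass (take j qs) (qs ! j)"
    using j qs by (intro mass_ge) (auto intro: less_imp_le)
  ultimately show "0 \<le> qs ! j" "0 \<le> qs ! j" "0 \<le> mass (take j qs) (qs ! j)" by auto
qed

lemma expected_load_cong:
  assumes "\<And>l. l < m \<Longrightarrow> sp l = sp' l" "i < m"
  shows "expected_load a c sp m qs i = expected_load a c sp' m qs i"
  unfolding expected_load_def share_def
  using weight_cong[OF assms] total_weight_cong[OF assms(1)] by simp

lemma expected_load_bounds:
  assumes "i < m" "\<And>k. k < length qs \<Longrightarrow> 0 < qs ! k"
  shows "0 \<le> expected_load a c sp m qs i" "expected_load a c sp m qs i \<le> (\<Sum>k<length qs. qs ! k)"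
  using assms share_le_1[of i m] mult_left_mono[of "share a c sp m _ _ i" 1]
  by (auto simp: expected_load_def share_nonneg less_imp_le intro!: sum_nonneg sum_mono)

text \<open>Nothing is assumed about \<open>p\<close>: the fee evaluates the slowness at
  \<open>p * \<xi> 1\<close> for arbitrary real seeds, including 0 and negative ones.\<close>

lemma slowness_bounds:
  assumes "\<And>l. l < m \<Longrightarrow> 0 < sp l"
  shows "0 \<le> slowness a c sp m qs p" "slowness a c sp m qs p \<le> (\<Sum>i<m. 1 / sp i)"
proof -
  have e: "slowness a c sp m qs p = (\<Sum>i<m. share a c sp m qs p i / sp i)"
    by (simp add: slowness_def share_def sum_divide_distrib field_simps)
  show "0 \<le> slowness a c sp m qs p" using assms
    unfolding e by (intro sum_nonneg divide_nonneg_pos) (auto simp: share_nonneg)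
  show "slowness a c sp m qs p \<le> (\<Sum>i<m. 1 / sp i)"
    using assms unfolding e by (intro sum_mono divide_right_mono) (auto simp: share_le_1 less_imp_le)
qed

section \<open>Truthfulness\<close>

definition unif :: "real measure" where
  "unif = uniform_measure lborel {0..1}"

lemma sets_unif [measurable_cong, simp]: "sets unif = sets borel"
  by (simp add: unif_def)

lemma space_unif [simp]: "space unif = UNIV"
  by (simp add: unif_def)

lemma prob_space_unif: "prob_space unif"
  unfolding unif_def by (intro prob_space_uniform_measure) auto

lemma unif_density: "unif = density lborel (\<lambda>u. ennreal (indicator {0..1} u))"
  by (simp add: unif_def uniform_measure_def ennreal_indicator[symmetric] divide_ennreal_def)

lemma integral_unif:
  fixes f :: "real \<Rightarrow> real"
  assumes [measurable]: "f \<in> borel_measurable borel"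
  shows "(LINT u|unif. f u) = (LINT u|lborel. indicator {0..1} u * f u)"
  unfolding unif_density by (subst integral_density) auto

lemma AE_unif: "AE u in unif. 0 \<le> u \<and> u < 1"
proof -
  have "AE u in lborel. u \<noteq> (1::real)" by (rule AE_lborel_singleton)
  then show ?thesis unfolding unif_def
    by (subst AE_uniform_measure) (auto elim!: eventually_mono)
qed

lemma measure_unif_interval:
  assumes "0 \<le> x" "x \<le> y" "y \<le> 1"
  shows "measure unif {x..<y} = y - x"
proof -
  have "{0..1} \<inter> {x..<y} = {x..<y}" using assms by auto
  then show ?thesis using assms by (simp add: unif_def)
qed

lemma distr_seed: "distr seed_space unif (\<lambda>\<xi>. \<xi> j) = unif"
  unfolding seed_space_def unif_def
  by (rule distr_PiM_component) (auto intro!: prob_space_uniform_measure)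

lemma measurable_seed: "(\<lambda>\<xi>. \<xi> j) \<in> measurable seed_space unif"
  unfolding seed_space_def unif_def by measurable

lemma measurable_seed_compose:
  assumes "f \<in> measurable borel N"
  shows "(\<lambda>\<xi>. f (\<xi> j)) \<in> measurable seed_space N"
proof -
  have "(\<lambda>\<xi>. \<xi> j) \<in> borel_measurable seed_space"
    using measurable_seed[of j] by (simp cong: measurable_cong_sets)
  from measurable_compose[OF this assms] show ?thesis .
qed

lemma integral_seed:
  fixes f :: "real \<Rightarrow> real"
  assumes "f \<in> borel_measurable borel"
  shows "(LINT \<xi>|seed_space. f (\<xi> j)) = (LINT u|unif. f u)"
  using integral_distr[OF measurable_seed, of f j] assms
  by (simp add: distr_seed cong: measurable_cong_sets)

lemma distr_run: "distr run_space seed_space (\<lambda>\<omega>. \<omega> j) = seed_space"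
  unfolding run_space_def by (rule distr_PiM_component) (auto intro!: prob_space_seed_space)

lemma measurable_run: "(\<lambda>\<omega>. \<omega> j) \<in> measurable run_space seed_space"
  unfolding run_space_def by measurable

lemma measurable_run_compose:
  "f \<in> measurable borel N \<Longrightarrow> (\<lambda>\<omega>. f (\<omega> i j)) \<in> measurable run_space N"
  by (rule measurable_compose[OF measurable_run measurable_seed_compose])

lemma integral_run:
  fixes f :: "seed \<Rightarrow> real"
  assumes "f \<in> borel_measurable seed_space"
  shows "(LINT \<omega>|run_space. f (\<omega> j)) = (LINT \<xi>|seed_space. f \<xi>)"
  using integral_distr[OF measurable_run, of f j] assms by (simp add: distr_run)

text \<open>
  The scaled average is \<open>\<integral>\<^sub>0\<^sup>x G\<close>, which is concave in \<open>x\<close> with supergradient \<open>G\<close>; this is Myerson's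
  argument, and the average over a uniform sample replaces the integral in the payments.
\<close>

lemma scaled_average_supergradient:
  fixes G :: "real \<Rightarrow> real"
  assumes [measurable]: "G \<in> borel_measurable borel"
    and anti: "\<And>u v. 0 < u \<Longrightarrow> u \<le> v \<Longrightarrow> G v \<le> G u" and b: "\<And>u. \<bar>G u\<bar> \<le> B"
    and x: "0 < x" and y: "0 < y"
  shows "x * (LINT u|unif. G (x * u)) \<le> y * (LINT u|unif. G (y * u)) + (x - y) * G y"
proof -
  \<comment> \<open>Substitution \<open>t = z * u\<close> turns the scaled average into an integral
    over \<open>{0..z}\<close>.\<close>
  have J: "z * (LINT u|unif. G (z * u)) = (LINT t|lborel. indicator {0..z} t * G t)" if "0 < z" for z
  proof -
    have "(LINT t|lborel. indicator {0..z} t * G t) =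
        z * (LINT u|lborel. indicator {0..z} (0 + z * u) * G (0 + z * u))"
      using that by (subst lborel_integral_real_affine[where c=z and t=0]) auto
    also have "(\<lambda>u. indicator {0..z} (0 + z * u) * G (0 + z * u)) =
        (\<lambda>u. indicator {0..1} u * G (z * u))"
      using that by (auto simp: indicator_def zero_le_mult_iff)
    finally show ?thesis using that by (subst integral_unif) auto
  qed
  have int: "integrable lborel (\<lambda>t. indicator {0..z} t * G t)" for z
  proof (rule Bochner_Integration.integrable_bound[where f="\<lambda>t. indicator {0..z} t * B"])
    show "integrable lborel (\<lambda>t. indicator {0..z} t * B)"
      by (intro integrable_mult_left integrable_real_indicator)
        (auto simp: emeasure_lborel_Icc_eq)
    show "AE t in lborel. norm (indicator {0..z} t * G t) \<le> norm (indicator {0..z} t * B)"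
      by (auto simp: indicator_def intro!: AE_I2 order_trans[OF b abs_ge_self])
  qed measurable
  have ind: "integrable lborel (indicator {0..z} :: real \<Rightarrow> real)" for z :: real
    by (intro integrable_real_indicator) (auto simp: emeasure_lborel_Icc_eq)
  \<comment> \<open>The integrand lives between \<open>x\<close> and \<open>y\<close>, where
    antitonicity compares \<open>G t\<close> with \<open>G y\<close> in the direction fixed by the
    sign. At \<open>t = 0\<close>, where antitonicity is not assumed, both indicators are 1 and
    cancel.\<close>
  have "(LINT t|lborel. indicator {0..x} t * G t - indicator {0..y} t * G t) \<le>
      (LINT t|lborel. (indicator {0..x} t - indicator {0..y} t) * G y)"
  proof (rule integral_mono)
    show "indicator {0..x} t * G t - indicator {0..y} t * G t
        \<le> (indicator {0..x} t - indicator {0..y} t) * G y" for t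
      using anti[of y t] anti[of t y] x y by (auto simp: indicator_def)
  qed (intro integrable_mult_left Bochner_Integration.integrable_diff int ind)+
  also have "\<dots> = (x - y) * G y" using x y ind by (simp add: Bochner_Integration.integral_diff)
  finally show ?thesis using J[OF x] J[OF y] int by (simp add: Bochner_Integration.integral_diff)
qed

section \<open>Sampling a machine by inversion\<close>

lemma pick_bounds:
  assumes w: "\<And>l. l < n \<Longrightarrow> 0 \<le> w l" and x: "0 \<le> x" and pos: "0 < (\<Sum>l<n. w l)"
  defines "i \<equiv> pick w x n"
  shows "i < n \<and> 0 < w i \<and> (\<Sum>l<i. w l) \<le> x \<and>
    (x < (\<Sum>l<Suc i. w l) \<or> (\<Sum>l<Suc i. w l) = (\<Sum>l<n. w l))"
  using w pos unfolding i_def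
proof (induction n)
  case (Suc n)
  let ?c = "\<Sum>l<n. w l"
  show ?case
  proof (cases "0 < w n \<and> \<not> (0 < ?c \<and> x < ?c)")
    case True
    then show ?thesis using x by auto
  next
    case False
    \<comment> \<open>A vanishing prefix sum would force \<open>w n\<close> to be positive, which is
      the case just treated.\<close>
    have "0 < ?c" using False Suc.prems(1)[of n] Suc.prems(2) by (cases "w n = 0") auto
    moreover have "pick w x (Suc n) = pick w x n" using False by auto
    moreover have "w n = 0 \<or> x < ?c" using False Suc.prems(1)[of n] by auto
    ultimately show ?thesis using Suc by (auto simp: less_Suc_eq)
  qed
qed simp

lemma pick_eq_iff:
  assumes w: "\<And>l. l < n \<Longrightarrow> 0 \<le> w l" and x: "0 \<le> x" "x < (\<Sum>l<n. w l)" and i: "i < n"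
  shows "pick w x n = i \<longleftrightarrow> (\<Sum>l<i. w l) \<le> x \<and> x < (\<Sum>l<Suc i. w l)"
proof -
  let ?i = "pick w x n" and ?S = "\<lambda>k. \<Sum>l<k. w l"
  have p: "?i < n" "?S ?i \<le> x" "x < ?S (Suc ?i)"
    using pick_bounds[of n w x] w x by fastforce+
  have mono: "?S k \<le> ?S l" if "k \<le> l" "l \<le> n" for k l
    using that w by (intro sum_mono2) auto
  have "?i = i" if "?S i \<le> x" "x < ?S (Suc i)"
    using p that i mono[of "Suc i" ?i] mono[of "Suc ?i" i]
    by (meson Suc_leI less_le_not_le linorder_neqE_nat order_trans less_imp_le)
  then show ?thesis using p by auto
qed

lemma measurable_pick [measurable]:
  "(\<lambda>u. pick w (u * W) n) \<in> measurable borel (count_space UNIV)"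
proof (induction n)
  case (Suc n)
  note Suc[measurable]
  show ?case by simp
qed simp

lemma measurable_choose_machine [measurable]:
  "choose_machine a c sp m qs p \<in> measurable borel (count_space UNIV)"
  unfolding choose_machine_def by measurable

lemma choose_machine_less: "0 < m \<Longrightarrow> choose_machine a c sp m qs p u < m"
  by (simp add: choose_machine_def pick_less)

text \<open>Up to the null set outside the half-open unit interval, the samples choosing
  \<open>i\<close> form an interval between consecutive normalised prefix sums.\<close>

lemma prob_choose_machine:
  assumes m: "i < m" and sp: "\<And>l. l < m \<Longrightarrow> 0 < sp l" and c: "0 \<le> c"
  shows "measure unif {u. choose_machine a c sp m qs p u = i} = share a c sp m qs p i"
proof -
  let ?w = "weight a c sp m qs p" and ?W = "total_weight a c sp m qs p"
  have W: "0 < ?W" using m sp c by (intro total_weight_pos) auto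
  let ?S = "\<lambda>k. \<Sum>l<k. ?w l"
  have S: "0 \<le> ?S i" "?S i \<le> ?S (Suc i)" "?S (Suc i) \<le> ?W"
    unfolding total_weight_def using m
    by (auto intro!: sum_nonneg sum_mono2 simp: weight_nonneg simp del: sum.lessThan_Suc)
  have "(choose_machine a c sp m qs p u = i) \<longleftrightarrow> u \<in> {?S i / ?W ..< ?S (Suc i) / ?W}"
    if u: "0 \<le> u" "u < 1" for u
  proof -
    have "pick ?w (u * ?W) m = i \<longleftrightarrow> ?S i \<le> u * ?W \<and> u * ?W < ?S (Suc i)"
      using m u W by (intro pick_eq_iff) (auto simp: weight_nonneg total_weight_def[symmetric])
    then show ?thesis using W by (simp add: choose_machine_def field_simps)
  qed
  then have "AE u in unif. (u \<in> {u. choose_machine a c sp m qs p u = i}) =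
      (u \<in> {?S i / ?W ..< ?S (Suc i) / ?W})"
    by (intro eventually_mono[OF AE_unif]) simp
  then have "measure unif {u. choose_machine a c sp m qs p u = i} =
      measure unif {?S i / ?W ..< ?S (Suc i) / ?W}"
    by (intro measure_eq_AE) measurable
  also have "\<dots> = ?S (Suc i) / ?W - ?S i / ?W"
    using S W by (intro measure_unif_interval) (auto simp: divide_simps)
  also have "\<dots> = share a c sp m qs p i" by (simp add: share_def add_divide_distrib)
  finally show ?thesis .
qed

lemma sum_indicator_fibres:
  fixes f :: "nat \<Rightarrow> real"
  assumes "g u < m"
  shows "(\<Sum>i<m. f i * indicator {u. g u = i} u) = f (g u)"
proof -
  have "(\<Sum>i<m. f i * indicator {u. g u = i} u) = (\<Sum>i<m. if i = g u then f i else 0)"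
    by (intro sum.cong) auto
  then show ?thesis using assms by simp
qed

lemma integral_choose_machine:
  fixes f :: "nat \<Rightarrow> real"
  assumes m: "0 < m" and sp: "\<And>l. l < m \<Longrightarrow> 0 < sp l" and c: "0 \<le> c"
  shows "integrable unif (\<lambda>u. f (choose_machine a c sp m qs p u))"
    "(LINT u|unif. f (choose_machine a c sp m qs p u)) = (\<Sum>i<m. share a c sp m qs p i * f i)"
proof -
  let ?ch = "choose_machine a c sp m qs p"
  interpret prob_space unif by (rule prob_space_unif)
  have [measurable]: "{u. ?ch u = i} \<in> sets borel" for i
    using measurable_choose_machine[of a c sp m qs p] by measurable
  have e: "f (?ch u) = (\<Sum>i<m. f i * indicator {u. ?ch u = i} u)" for u
    by (rule sum_indicator_fibres[symmetric]) (rule choose_machine_less[OF m])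
  have int: "integrable unif (\<lambda>u. f i * indicator {u. ?ch u = i} u)" for i
    by (intro integrable_mult_right integrable_real_indicator) (auto simp: emeasure_eq_measure)
  show "integrable unif (\<lambda>u. f (?ch u))" 
    unfolding e using int by (intro Bochner_Integration.integrable_sum)
  have "(LINT u|unif. f (?ch u)) = (\<Sum>i<m. f i * measure unif {u. ?ch u = i})"
    unfolding e using int by (subst Bochner_Integration.integral_sum) (auto simp del: sum_mult_indicator)
  also have "\<dots> = (\<Sum>i<m. share a c sp m qs p i * f i)"
    by (intro sum.cong) (auto simp: prob_choose_machine sp c)
  finally show "(LINT u|unif. f (?ch u)) = (\<Sum>i<m. share a c sp m qs p i * f i)" .
qed

text \<open>Because the rule sees only the sizes in the history, the recursion over histories
  unfolds: job \<open>j\<close> is placed by its own seed and the fixed prefix of sizes.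
  Independence of the assignments is read off from this form.\<close>

lemma run_mech:
  "run (mech a c) s ps \<omega> =
     map (\<lambda>j. (ps ! j, choose_machine a c ((!) s) (length s) (take j ps) (ps ! j) (\<omega> j 0))) [0..<length ps]"
proof (induction ps rule: rev_induct)
  case (snoc p ps)
  let ?r = "run (mech a c) s ps \<omega>"
  have "map fst ?r = ps" "length ?r = length ps"
    using snoc by (auto intro: nth_equalityI)
  then have "run (mech a c) s (ps @ [p]) \<omega> =
      ?r @ [(p, choose_machine a c ((!) s) (length s) ps p (\<omega> (length ps) 0))]"
    by (simp add: run_def mech_def)
  then show ?case using snoc by (simp add: nth_append)
qed (simp add: run_def)

lemma load_run_mech:
  "load (run (mech a c) s ps \<omega>) i =
     (\<Sum>j<length ps. if choose_machine a c ((!) s) (length s) (take j ps) (ps ! j) (\<omega> j 0) = i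
        then ps ! j else 0)"
  by (simp add: run_mech load_def sum_list_sum_nth atLeast0LessThan)

lemma fst_run_mech: "map fst (run (mech a c) s ps \<omega>) = ps"
  by (auto simp: run_mech intro: nth_equalityI)

lemma pay_mech:
  "pay (mech a c) s h \<xi> i =
     (load h i - expected_load a c ((!) (s[i := s ! i / \<xi> 0])) (length s) (map fst h) i) / s ! i"
  by (simp add: mech_def)

lemma valid_speedsD:
  assumes "valid_speeds s"
  shows "0 < length s" "\<And>l. l < length s \<Longrightarrow> 0 < s ! l"
  using assms by (auto simp: valid_speeds_def)

lemma valid_sizesD: "valid_sizes ps \<Longrightarrow> k < length ps \<Longrightarrow> 0 < ps ! k"
  by (auto simp: valid_sizes_def)

lemma valid_history_sizes: "valid_history m h \<Longrightarrow> valid_sizes (map fst h)"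
  by (auto simp: valid_history_def valid_sizes_def)

lemma measurable_expected_load [measurable]:
  "(\<lambda>v. expected_load a c (sp(i := v)) m qs r) \<in> borel_measurable borel"
  unfolding expected_load_def share_def total_weight_def weight_def faster_weight_def fun_upd_apply
  by measurable

lemma measurable_slowness [measurable]:
  "(\<lambda>p. slowness a c sp m qs p) \<in> borel_measurable borel"
  unfolding slowness_def total_weight_def weight_def mass_def by measurable

lemma expected_load_list_update:
  assumes "i < length s" "r < length s"
  shows "expected_load a c ((!) (s[i := v])) (length s) qs r = expected_load a c (((!) s)(i := v)) (length s) qs r"
  using assms by (intro expected_load_cong) (auto simp: nth_list_update)

lemma measurable_expected_load_update [measurable]:
  assumes "i < length s"
  shows "(\<lambda>u. expected_load a c ((!) (s[i := s ! i / u])) (length s) qs i) \<in> borel_measurable borel"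
proof -
  have "(\<lambda>u. expected_load a c (((!) s)(i := s ! i / u)) (length s) qs i) \<in> borel_measurable borel"
    by measurable
  then show ?thesis using assms by (simp add: expected_load_list_update)
qed

text \<open>Linearity of expectation, one job at a time; this identifies
  \<open>expected_load\<close> as a genuine mean.\<close>

lemma integrable_run_load:
  assumes s: "valid_speeds s" and i: "i < length s" and c: "0 \<le> c"
  shows "integrable run_space (\<lambda>\<omega>. load (run (mech a c) s ps \<omega>) i)"
    "(LINT \<omega>|run_space. load (run (mech a c) s ps \<omega>) i) = expected_load a c ((!) s) (length s) ps i"
proof -
  interpret R: prob_space run_space by (rule prob_space_run_space)
  let ?f = "\<lambda>j u. if choose_machine a c ((!) s) (length s) (take j ps) (ps ! j) u = i then ps ! j else 0"
  have [measurable]: "?f j \<in> borel_measurable borel" for j by measurable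
  have int: "integrable run_space (\<lambda>\<omega>. ?f j (\<omega> j 0))" for j
    by (rule R.integrable_const_bound[where B="\<bar>ps ! j\<bar>"])
      (auto intro!: measurable_run_compose[where f="?f j"])
  have "(LINT \<omega>|run_space. ?f j (\<omega> j 0)) = ps ! j * share a c ((!) s) (length s) (take j ps) (ps ! j) i" for j
  proof -
    have "(LINT \<omega>|run_space. ?f j (\<omega> j 0)) = (LINT u|unif. ?f j u)"
      using integral_run[of "\<lambda>\<xi>. ?f j (\<xi> 0)" j] integral_seed[of "?f j" 0]
      by (simp add: measurable_seed_compose[where f="?f j"])
    also have "\<dots> = (\<Sum>k<length s. share a c ((!) s) (length s) (take j ps) (ps ! j) k * (if k = i then ps ! j else 0))"
      using valid_speedsD[OF s] c by (intro integral_choose_machine(2)[where f="\<lambda>k. if k = i then ps ! j else 0"]) auto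
    also have "\<dots> = ps ! j * share a c ((!) s) (length s) (take j ps) (ps ! j) i"
      using i by (simp add: if_distrib cong: if_cong)
    finally show ?thesis .
  qed
  then show "(LINT \<omega>|run_space. load (run (mech a c) s ps \<omega>) i) = expected_load a c ((!) s) (length s) ps i"
    unfolding load_run_mech expected_load_def using int by (subst Bochner_Integration.integral_sum) auto
  show "integrable run_space (\<lambda>\<omega>. load (run (mech a c) s ps \<omega>) i)"
    unfolding load_run_mech using int by (intro Bochner_Integration.integrable_sum) auto
qed

section \<open>Integrability, and truthfulness of both sides\<close>

lemma integrable_unif_bounded:
  fixes f :: "real \<Rightarrow> real"
  assumes "f \<in> borel_measurable borel" "\<And>u. \<bar>f u\<bar> \<le> B"
  shows "integrable unif f"
proof -
  interpret prob_space unif by (rule prob_space_unif)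
  show ?thesis using assms by (intro integrable_const_bound[where B=B]) (auto cong: measurable_cong_sets)
qed

lemma integrable_seed:
  fixes f :: "real \<Rightarrow> real"
  assumes "integrable unif f"
  shows "integrable seed_space (\<lambda>\<xi>. f (\<xi> j))"
  using integrable_distr[OF measurable_seed, of j f] assms by (simp add: distr_seed)

lemma integrable_run:
  fixes f :: "seed \<Rightarrow> real"
  assumes "integrable seed_space f"
  shows "integrable run_space (\<lambda>\<omega>. f (\<omega> j))"
  using integrable_distr[OF measurable_run, of j f] assms by (simp add: distr_run)

lemma integrable_expected_load:
  assumes "i < length s" "valid_sizes qs"
  shows "integrable seed_space (\<lambda>\<xi>. expected_load a c ((!) (s[i := s ! i / \<xi> 0])) (length s) qs i)"
  using assms expected_load_bounds[OF assms(1) valid_sizesD[OF assms(2)]]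
  by (intro integrable_seed[where f="\<lambda>u. expected_load a c ((!) (s[i := s ! i / u])) (length s) qs i"]
      integrable_unif_bounded[where B="\<Sum>k<length qs. qs ! k"]) (auto simp: abs_of_nonneg)

lemma wf_mechanism_mech:
  assumes c: "0 \<le> c"
  shows "wf_mechanism (mech a c)"
  unfolding wf_mechanism_def
proof (intro allI impI conjI)
  fix s h assume sh: "valid_speeds s \<and> valid_history (length s) h"
  note s = valid_speedsD[OF conjunct1[OF sh]]
  interpret S: prob_space seed_space by (rule prob_space_seed_space)
  let ?qs = "map fst h"
  have qs: "valid_sizes ?qs" using sh valid_history_sizes by blast
  {
    fix p :: real assume p: "0 < p"
    let ?ch = "choose_machine a c ((!) s) (length s) ?qs p"
    show "assign (mech a c) s h p \<in> measurable seed_space (count_space UNIV)"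
      by (simp add: mech_def measurable_seed_compose)
    show "assign (mech a c) s h p \<xi> < length s" for \<xi>
      using s by (simp add: mech_def choose_machine_less)
    have "integrable seed_space (\<lambda>\<xi>. (load h (?ch (\<xi> 0)) + p) / s ! ?ch (\<xi> 0))"
      by (intro integrable_seed[where f="\<lambda>u. (load h (?ch u) + p) / s ! ?ch u"]
          integral_choose_machine(1)[where f="\<lambda>i. (load h i + p) / s ! i"] s c)
    moreover have "integrable seed_space (\<lambda>\<xi>. slowness a c ((!) s) (length s) ?qs (p * \<xi> 1))"
      using slowness_bounds[of "length s" "(!) s"] s
      by (intro integrable_seed[where f="\<lambda>u. slowness a c ((!) s) (length s) ?qs (p * u)"]
          integrable_unif_bounded[where B="\<Sum>i<length s. 1 / s ! i"]) (auto simp: abs_of_nonneg)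
    ultimately show "integrable seed_space (fee (mech a c) s h p)"
      by (simp add: mech_def Let_def)
  }
  fix i assume i: "i < length s"
  show "integrable seed_space (\<lambda>\<xi>. pay (mech a c) s h \<xi> i)"
    using integrable_expected_load[OF i qs] by (simp add: mech_def)
qed

text \<open>The private parameter is taken to be the inverse speed, the cost per unit of work. With
  report \<open>x\<close> the expected utility is \<open>x * H x\<close> minus the integral of
  \<open>H\<close> over \<open>{0..x}\<close> minus the true cost times \<open>H x\<close>, where
  \<open>H\<close> decreases; the supergradient inequality says that the true value is the best
  report.\<close>

lemma machine_truthful_mech:
  assumes a: "0 < a" "0 \<le> c"
  shows "machine_truthful (mech a c)"
  unfolding machine_truthful_def
proof (intro allI impI)
  fix s ps i and v' :: real assume asm: "valid_speeds s \<and> valid_sizes ps \<and> i < length s \<and> 0 < v'"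
  then have i: "i < length s" and ps: "\<And>k. k < length ps \<Longrightarrow> 0 < ps ! k" and v': "0 < v'"
    by (auto intro: valid_sizesD)
  note s = valid_speedsD[OF conjunct1[OF asm]]
  let ?m = "length s"
  \<comment> \<open>Parametrised by the inverse \<open>u\<close> of the reported speed, so that
    scaling a speed by \<open>1 / \<xi> 0\<close> becomes multiplication of the argument by the
    sample.\<close>
  define H where "H u = expected_load a c (((!) s)(i := 1 / u)) ?m ps i" for u
  have [measurable]: "H \<in> borel_measurable borel" unfolding H_def by measurable
  have util: "machine_utility (mech a c) (s[i := r]) ps i v =
      1 / r * H (1 / r) - 1 / r * (LINT u|unif. H (1 / r * u)) - 1 / v * H (1 / r)" if r: "0 < r" for r v
  proof -
    let ?s = "s[i := r]"
    have vs: "valid_speeds ?s" using asm r set_update_subset_insert[of s i r]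
      by (auto simp: valid_speeds_def)
    let ?load = "\<lambda>\<omega>. load (run (mech a c) ?s ps \<omega>) i"
    let ?E = "\<lambda>u. expected_load a c ((!) (?s[i := ?s ! i / u])) (length ?s) ps i"
    have E: "?E u = H (1 / r * u)" for u
      using i by (simp add: H_def expected_load_list_update)
    have L: "integrable run_space ?load" "(LINT \<omega>|run_space. ?load \<omega>) = H (1 / r)"
      using integrable_run_load[OF vs, of i c a ps] i a by (simp_all add: H_def expected_load_list_update)
    have "integrable seed_space (\<lambda>\<xi>. ?E (\<xi> 0))"
      using integrable_expected_load[of i ?s ps] i asm by simp
    from integrable_run[OF this, of "length ps"]
    have I: "integrable run_space (\<lambda>\<omega>. H (1 / r * \<omega> (length ps) 0))" by (simp only: E)
    have "(LINT \<omega>|run_space. H (1 / r * \<omega> (length ps) 0)) = (LINT u|unif. H (1 / r * u))"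
    proof -
      have [measurable]: "(\<lambda>u. H (1 / r * u)) \<in> borel_measurable borel" by measurable
      have "(LINT \<omega>|run_space. H (1 / r * \<omega> (length ps) 0)) = (LINT \<xi>|seed_space. H (1 / r * \<xi> 0))"
        by (rule integral_run[where f="\<lambda>\<xi>. H (1 / r * \<xi> 0)"],
            rule measurable_seed_compose[where f="\<lambda>u. H (1 / r * u)"]) measurable
      also have "\<dots> = (LINT u|unif. H (1 / r * u))"
        by (rule integral_seed[where f="\<lambda>u. H (1 / r * u)"]) measurable
      finally show ?thesis .
    qed
    moreover have "machine_utility (mech a c) ?s ps i v =
        (LINT \<omega>|run_space. (1 / r * ?load \<omega> - 1 / r * H (1 / r * \<omega> (length ps) 0)) - 1 / v * ?load \<omega>)"
      unfolding machine_utility_def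
    proof (intro Bochner_Integration.integral_cong refl)
      fix \<omega>
      have "pay (mech a c) ?s (run (mech a c) ?s ps \<omega>) (\<omega> (length ps)) i =
          (?load \<omega> - ?E (\<omega> (length ps) 0)) / ?s ! i"
        by (simp only: pay_mech fst_run_mech)
      then show "pay (mech a c) ?s (run (mech a c) ?s ps \<omega>) (\<omega> (length ps)) i - ?load \<omega> / v =
          (1 / r * ?load \<omega> - 1 / r * H (1 / r * \<omega> (length ps) 0)) - 1 / v * ?load \<omega>"
        using E i by (simp add: diff_divide_distrib)
    qed
    ultimately show ?thesis using L I
      by (simp add: Bochner_Integration.integral_diff)
  qed
  have anti: "H v \<le> H u" if "0 < u" "u \<le> v" for u v
  proof -
    have "H v \<le> expected_load a c ((((!) s)(i := 1 / v))(i := 1 / u)) ?m ps i"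
      unfolding H_def using that s i a ps
      by (intro expected_load_mono) (auto simp: frac_le)
    then show ?thesis by (simp add: H_def)
  qed
  have bd: "\<bar>H u\<bar> \<le> (\<Sum>k<length ps. ps ! k)" for u
    unfolding H_def
    using expected_load_bounds[OF i ps, where a=a and c=c and sp="((!) s)(i := 1 / u)"]
    by (simp add: abs_of_nonneg)
  have "1 / s ! i * (LINT u|unif. H (1 / s ! i * u)) \<le>
      1 / v' * (LINT u|unif. H (1 / v' * u)) + (1 / s ! i - 1 / v') * H (1 / v')"
    by (rule scaled_average_supergradient[OF _ anti bd]) (use s(2)[OF i] v' in auto)
  then have "machine_utility (mech a c) (s[i := s ! i]) ps i (s ! i) \<ge>
      machine_utility (mech a c) (s[i := v']) ps i (s ! i)"
    unfolding util[OF s(2)[OF i]] util[OF v'] by (simp add: algebra_simps)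
  then show "machine_utility (mech a c) s ps i (s ! i) \<ge>
      machine_utility (mech a c) (s[i := v']) ps i (s ! i)" by simp
qed

text \<open>After the refund in the fee, the observed load cancels on every outcome and a job of
  size \<open>p\<close> reporting \<open>r\<close> pays \<open>(p - r) / s\<close> for the chosen
  machine plus \<open>r\<close> times the sampled slowness. In expectation this is the supergradient
  of the integral of \<open>G\<close> taken at \<open>r\<close>, evaluated at
  \<open>p\<close>.\<close>

lemma job_truthful_mech:
  assumes a: "0 < a" "0 \<le> c"
  shows "job_truthful (mech a c)"
  unfolding job_truthful_def
proof (intro allI impI)
  fix s h and p p' :: real assume asm: "valid_speeds s \<and> valid_history (length s) h \<and> 0 < p \<and> (0 :: real) < p'"
  note s = valid_speedsD[OF conjunct1[OF asm]]
  have p: "0 < p" "0 < p'" using asm by auto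
  let ?m = "length s" and ?qs = "map fst h"
  have qs: "0 < ?qs ! k" if "k < length ?qs" for k
    using valid_sizesD[OF valid_history_sizes that] asm by blast
  define G where "G = slowness a c ((!) s) ?m ?qs"
  have [measurable]: "G \<in> borel_measurable borel" unfolding G_def by measurable
  have bd: "\<bar>G u\<bar> \<le> (\<Sum>i<?m. 1 / s ! i)" for u
    using slowness_bounds[of ?m "(!) s"] s by (simp add: G_def abs_of_nonneg)
  have anti: "G v \<le> G u" if "0 < u" "u \<le> v" for u v
    unfolding G_def using s a that qs by (intro slowness_antimono) (auto intro: less_imp_le)
  have util: "job_utility (mech a c) s h p r = - ((p - r) * G r + r * (LINT u|unif. G (r * u)))"
    if r: "0 < r" for r
  proof -
    let ?ch = "choose_machine a c ((!) s) ?m ?qs r"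
    let ?X = "\<lambda>u. 1 / s ! ?ch u"
    define X where "X \<xi> = ?X (\<xi> 0)" for \<xi> :: seed
    define Y where "Y \<xi> = G (r * \<xi> 1)" for \<xi> :: seed
    have "integrable seed_space X" unfolding X_def
      by (intro integrable_seed[where f="?X"] integral_choose_machine(1)[where f="\<lambda>i. 1 / s ! i"] s a)
    moreover have "integral\<^sup>L seed_space X = G r"
    proof -
      have "integral\<^sup>L seed_space X = (LINT u|unif. ?X u)"
        unfolding X_def by (rule integral_seed[where f="?X"]) measurable
      also have "\<dots> = (\<Sum>i<?m. share a c ((!) s) ?m ?qs r i * (1 / s ! i))"
        by (intro integral_choose_machine(2)[where f="\<lambda>i. 1 / s ! i"] s a)
      also have "\<dots> = G r"
        by (simp add: G_def slowness_def share_def sum_divide_distrib field_simps)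
      finally show ?thesis .
    qed
    moreover have "integrable seed_space Y"
      using bd unfolding Y_def
      by (intro integrable_seed[where f="\<lambda>u. G (r * u)"] integrable_unif_bounded) auto
    moreover have "integral\<^sup>L seed_space Y = (LINT u|unif. G (r * u))"
      unfolding Y_def by (rule integral_seed[where f="\<lambda>u. G (r * u)"]) measurable
    moreover have "job_utility (mech a c) s h p r = - (LINT \<xi>|seed_space. (p - r) * X \<xi> + r * Y \<xi>)"
      unfolding job_utility_def mech_def X_def Y_def
      by (simp add: Let_def G_def add_divide_distrib diff_divide_distrib left_diff_distrib algebra_simps)
    ultimately show ?thesis by simp
  qed
  have "p * (LINT u|unif. G (p * u)) \<le> p' * (LINT u|unif. G (p' * u)) + (p - p') * G p'"
    by (rule scaled_average_supergradient[OF _ anti bd p]) measurable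
  then show "job_utility (mech a c) s h p p \<ge> job_utility (mech a c) s h p p'"
    unfolding util[OF p(1)] util[OF p(2)] by simp
qed

section \<open>Bounds through the optimum and elementary sums\<close>

lemma Holder_sum:
  fixes x y :: "'a \<Rightarrow> real"
  assumes q: "1 < q" "1 < a" "1 / q + 1 / a = 1"
    and x: "\<And>i. i \<in> I \<Longrightarrow> 0 \<le> x i" and y: "\<And>i. i \<in> I \<Longrightarrow> 0 \<le> y i"
  shows "(\<Sum>i\<in>I. x i * y i) \<le> (\<Sum>i\<in>I. x i powr q) powr (1 / q) * (\<Sum>i\<in>I. y i powr a) powr (1 / a)"
proof (cases "finite I")
  case True
  let ?X = "\<Sum>i\<in>I. x i powr q" and ?Y = "\<Sum>i\<in>I. y i powr a"
  show ?thesis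
  proof (cases "?X = 0 \<or> ?Y = 0")
    case True
    then have "\<forall>i\<in>I. x i * y i = 0"
      using \<open>finite I\<close> by (auto simp: sum_nonneg_eq_0_iff)
    then show ?thesis by (simp add: sum.neutral)
  next
    case False
    then have XY: "0 < ?X" "0 < ?Y" by (simp_all add: sum_nonneg order.not_eq_order_implies_strict)
    let ?A = "?X powr (1 / q)" and ?B = "?Y powr (1 / a)"
    have AB: "0 < ?A" "0 < ?B" "?A powr q = ?X" "?B powr a = ?Y"
      using XY q by (simp_all add: powr_powr)
    have "(\<Sum>i\<in>I. (x i / ?A) * (y i / ?B)) \<le> (\<Sum>i\<in>I. (x i / ?A) powr q / q + (y i / ?B) powr a / a)"
      using q x y AB(1,2) by (intro sum_mono Youngs_inequality) auto
    also have "\<dots> = (\<Sum>i\<in>I. x i powr q / ?X / q + y i powr a / ?Y / a)"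
      using x y AB by (intro sum.cong refl) (simp add: powr_divide)
    also have "\<dots> = 1 / q + 1 / a"
      using XY by (simp add: sum.distrib flip: sum_divide_distrib)
    finally have "(\<Sum>i\<in>I. (x i / ?A) * (y i / ?B)) \<le> 1" using q by simp
    moreover have "(\<Sum>i\<in>I. (x i / ?A) * (y i / ?B)) = (\<Sum>i\<in>I. x i * y i) / (?A * ?B)"
      by (simp add: sum_divide_distrib)
    ultimately show ?thesis using AB by (simp add: divide_le_eq)
  qed
qed simp

lemma load_zip:
  assumes "length ks = length ps"
  shows "load (zip ps ks) i = (\<Sum>j<length ps. if ks ! j = i then ps ! j else 0)"
  using assms by (simp add: load_def sum_list_sum_nth atLeast0LessThan)

lemma opt_attained:
  assumes "s \<noteq> []"
  obtains ks where "length ks = length ps" "set ks \<subseteq> {..<length s}"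
    "opt q s ps = objective q s (zip ps ks)"
proof -
  let ?K = "{ks. set ks \<subseteq> {..<length s} \<and> length ks = length ps}"
  have fin: "finite ?K" by (rule finite_lists_length_eq) simp
  have "replicate (length ps) 0 \<in> ?K" using assms by auto
  then have ne: "(\<lambda>ks. objective q s (zip ps ks)) ` ?K \<noteq> {}" by blast
  have "opt q s ps = Min ((\<lambda>ks. objective q s (zip ps ks)) ` ?K)"
    unfolding opt_def by (rule arg_cong[where f=Min]) auto
  also have "\<dots> \<in> (\<lambda>ks. objective q s (zip ps ks)) ` ?K" using fin ne by (intro Min_in) auto
  finally show thesis using that by blast
qed

lemma le_lq_norm:
  assumes "i < m" "\<And>i. i < m \<Longrightarrow> 0 \<le> C i" "0 < q"
  shows "C i \<le> lq_norm q m C"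
proof -
  have "C i powr q \<le> (\<Sum>i<m. C i powr q)"
    using assms by (intro member_le_sum[where f="\<lambda>i. C i powr q"]) auto
  then have "(C i powr q) powr (1 / q) \<le> lq_norm q m C"
    unfolding lq_norm_def using assms by (intro powr_mono2) auto
  then show ?thesis using assms by (simp add: powr_powr)
qed

text \<open>\<open>\<kappa>\<close> is the assignment of an optimal schedule. A single job is no
  longer than the load of its machine, whose completion time is at most the norm. For a set of
  machines, the work done is the inner product of completion times and speeds, to which Hoelder
  applies.\<close>

lemma opt_bounds:
  assumes s: "valid_speeds s" and ps: "valid_sizes ps" and q: "1 < q" "1 < a" "1 / q + 1 / a = 1"
  obtains \<kappa> where "\<And>j. j < length ps \<Longrightarrow> \<kappa> j < length s"
    "\<And>j. j < length ps \<Longrightarrow> ps ! j \<le> opt q s ps * s ! \<kappa> j"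
    "\<And>J A. J \<subseteq> {..<length ps} \<Longrightarrow> A \<subseteq> {..<length s} \<Longrightarrow> \<kappa> ` J \<subseteq> A \<Longrightarrow>
       (\<Sum>j\<in>J. ps ! j) \<le> opt q s ps * (\<Sum>l\<in>A. s ! l powr a) powr (1 / a)"
proof -
  let ?n = "length ps" and ?m = "length s"
  have sp: "0 < s ! l" if "l < ?m" for l using s that by (auto simp: valid_speeds_def)
  have pp: "0 < ps ! j" if "j < ?n" for j using ps that by (auto simp: valid_sizes_def)
  have "s \<noteq> []" using s by (simp add: valid_speeds_def)
  then obtain ks where ks: "length ks = ?n" "set ks \<subseteq> {..<?m}"
    and opt: "opt q s ps = objective q s (zip ps ks)" by (rule opt_attained)
  define L where "L i = (\<Sum>j<?n. if ks ! j = i then ps ! j else 0)" for i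
  define C where "C i = L i / s ! i" for i
  have \<Lambda>: "opt q s ps = lq_norm q ?m C"
    by (simp add: opt objective_def C_def[abs_def] L_def[abs_def] load_zip[OF ks(1)])
  have L0: "0 \<le> L i" for i unfolding L_def using pp
    by (intro sum_nonneg) (simp add: less_imp_le)
  then have C0: "0 \<le> C i" if "i < ?m" for i using sp[OF that] by (simp add: C_def)
  have km: "ks ! j < ?m" if "j < ?n" for j
    using ks that nth_mem[of j ks] by (metis lessThan_iff subsetD)
  show thesis
  proof (rule that)
    show "ks ! j < ?m" if "j < ?n" for j using km[OF that] .
    show "ps ! j \<le> opt q s ps * s ! (ks ! j)" if j: "j < ?n" for j
    proof -
      have "ps ! j \<le> L (ks ! j)" unfolding L_def
        using j pp member_le_sum[of j "{..<?n}" "\<lambda>k. if ks ! k = ks ! j then ps ! k else 0"]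
        by (force intro: less_imp_le)
      also have "\<dots> = C (ks ! j) * s ! (ks ! j)" using sp[OF km[OF j]] by (simp add: C_def)
      also have "\<dots> \<le> opt q s ps * s ! (ks ! j)"
        unfolding \<Lambda> using C0 q km[OF j] sp[OF km[OF j]]
        by (intro mult_right_mono le_lq_norm) (auto intro: less_imp_le)
      finally show ?thesis .
    qed
    show "(\<Sum>j\<in>J. ps ! j) \<le> opt q s ps * (\<Sum>l\<in>A. s ! l powr a) powr (1 / a)"
      if J: "J \<subseteq> {..<?n}" and A: "A \<subseteq> {..<?m}" and JA: "(\<lambda>j. ks ! j) ` J \<subseteq> A" for J A
    proof -
      have fin: "finite A" "finite J" using A J finite_subset by blast+
      have "(\<Sum>j\<in>J. ps ! j) = (\<Sum>j\<in>J. \<Sum>i\<in>A. if ks ! j = i then ps ! j else 0)"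
        using JA fin by (intro sum.cong) auto
      also have "\<dots> = (\<Sum>i\<in>A. \<Sum>j\<in>J. if ks ! j = i then ps ! j else 0)" by (rule sum.swap)
      also have "\<dots> \<le> (\<Sum>i\<in>A. L i)"
        unfolding L_def using J pp by (intro sum_mono sum_mono2) (auto intro: less_imp_le)
      also have "\<dots> = (\<Sum>i\<in>A. C i * s ! i)"
        using A sp by (intro sum.cong) (fastforce simp: C_def)+
      also have "\<dots> \<le> (\<Sum>i\<in>A. C i powr q) powr (1 / q) * (\<Sum>i\<in>A. s ! i powr a) powr (1 / a)"
        using A C0 sp q by (intro Holder_sum) (auto intro: less_imp_le)
      also have "\<dots> \<le> opt q s ps * (\<Sum>i\<in>A. s ! i powr a) powr (1 / a)"
        unfolding \<Lambda> lq_norm_def using A q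
        by (intro mult_right_mono powr_mono2 sum_mono2 sum_nonneg) auto
      finally show ?thesis .
    qed
  qed
qed

text \<open>Let \<open>y\<close> be the largest size. The last job larger than \<open>y/2\<close>
  counts all jobs larger than \<open>y/2\<close>, so these total at most \<open>K * y\<close>; the
  rest has sizes at most \<open>y/2\<close> and by induction contributes another
  \<open>K * y\<close>.\<close>

lemma halving_sum:
  fixes p :: "nat \<Rightarrow> real"
  assumes "finite J" "0 \<le> K" "0 \<le> x" "\<And>j. j \<in> J \<Longrightarrow> 0 < p j" "\<And>j. j \<in> J \<Longrightarrow> p j \<le> x"
    and "\<And>j. j \<in> J \<Longrightarrow> (\<Sum>k | k \<in> J \<and> k \<le> j \<and> p j / 2 \<le> p k. p k) \<le> K * p j"
  shows "(\<Sum>j\<in>J. p j) \<le> 2 * K * x"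
  using assms
proof (induction J arbitrary: x rule: finite_psubset_induct)
  case (psubset J)
  show ?case
  proof (cases "J = {}")
    case False
    define y where "y = Max (p ` J)"
    have "y \<in> p ` J" unfolding y_def using psubset.hyps False by (intro Max_in) auto
    then obtain j0 where j0: "j0 \<in> J" "p j0 = y" by auto
    have y: "p j \<le> y" if "j \<in> J" for j using psubset.hyps that by (simp add: y_def)
    have y0: "0 < y" "y \<le> x" using psubset.prems j0 by auto
    let ?S = "{j \<in> J. p j \<le> y / 2}" and ?B = "{j \<in> J. y / 2 < p j}"
    have J: "?S \<union> ?B = J" "?S \<inter> ?B = {}" "finite ?S" "finite ?B" using psubset.hyps by auto
    have "j0 \<in> ?B" using j0 y0 by auto
    then have mx: "Max ?B \<in> ?B" "\<And>k. k \<in> ?B \<Longrightarrow> k \<le> Max ?B"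
      using Max_in[OF J(4)] Max_ge[OF J(4)] by blast+
    let ?j = "Max ?B"
    \<comment> \<open>Half the size of the last big job is at most \<open>y/2\<close>, hence below
      every size in the group.\<close>
    have "(\<Sum>j\<in>?B. p j) \<le> (\<Sum>k | k \<in> J \<and> k \<le> ?j \<and> p ?j / 2 \<le> p k. p k)"
    proof (rule sum_mono2)
      show "?B \<subseteq> {k \<in> J. k \<le> ?j \<and> p ?j / 2 \<le> p k}"
        using mx y[of ?j] by fastforce
    qed (use psubset in \<open>auto intro: less_imp_le\<close>)
    also have "\<dots> \<le> K * p ?j" using psubset.prems(5) mx(1) by blast
    also have "\<dots> \<le> K * y" using psubset.prems(1) y mx(1) by (intro mult_left_mono) auto
    finally have B: "(\<Sum>j\<in>?B. p j) \<le> K * y" .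
    have "(\<Sum>j\<in>?S. p j) \<le> 2 * K * (y / 2)"
    proof (rule psubset.IH)
      show "?S \<subset> J"
      proof -
        have "j0 \<notin> ?S" using y0 j0 by simp
        then show ?thesis using j0(1) by blast
      qed
      show "(\<Sum>k | k \<in> ?S \<and> k \<le> j \<and> p j / 2 \<le> p k. p k) \<le> K * p j" if "j \<in> ?S" for j
      proof -
        have "(\<Sum>k | k \<in> ?S \<and> k \<le> j \<and> p j / 2 \<le> p k. p k) \<le> (\<Sum>k | k \<in> J \<and> k \<le> j \<and> p j / 2 \<le> p k. p k)"
          using psubset by (intro sum_mono2) (auto intro: less_imp_le)
        also have "\<dots> \<le> K * p j" using psubset.prems(5) that by auto
        finally show ?thesis .
      qed
    qed (use psubset.prems y0 in auto)
    then have "(\<Sum>j\<in>?S. p j) + (\<Sum>j\<in>?B. p j) \<le> 2 * K * y" using B by simp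
    then have "(\<Sum>j\<in>J. p j) \<le> 2 * K * y" using sum.union_disjoint[OF J(3,4,2), of p] J(1) by simp
    also have "\<dots> \<le> 2 * K * x" using psubset.prems(1) y0 by (intro mult_left_mono) auto
    finally show ?thesis .
  qed (use psubset.prems in simp)
qed

text \<open>Jobs are grouped by \<open>w\<close> in dyadic intervals. Each group contributes at most
  \<open>2 * c\<close> times the power \<open>-r\<close> of its left end, and these bounds decay
  geometrically with ratio \<open>2 powr (-r)\<close>.\<close>

lemma doubling_sum:
  fixes p w :: "'b \<Rightarrow> real"
  assumes J: "finite J" "\<And>j. j \<in> J \<Longrightarrow> 0 \<le> p j" and r: "0 < r" "r < 1" and c: "0 \<le> c"
    and small: "\<And>v. 0 < v \<Longrightarrow> (\<Sum>j | j \<in> J \<and> w j < v. p j) \<le> c * v powr (1 - r)" and v: "0 < v"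
  shows "(\<Sum>j | j \<in> J \<and> v \<le> w j. p j / w j) \<le> 2 * c / (1 - 2 powr (-r)) * v powr (-r)"
proof -
  let ?K = "2 * c / (1 - 2 powr (-r))"
  let ?G = "\<lambda>v. \<Sum>j | j \<in> J \<and> v \<le> w j. p j / w j"
  have r2: "2 powr (-r) < (1::real)" using powr_less_mono[of "-r" 0 "2 :: real"] r by simp
  then have K0: "0 \<le> ?K" using c by simp
  have *: "?G v \<le> ?K * v powr (-r)" if "0 < v" "\<And>j. j \<in> J \<Longrightarrow> w j < v * 2 ^ n" for n v
    using that
  proof (induction n arbitrary: v)
    case 0
    then have "{j \<in> J. v \<le> w j} = {}" by force
    then show ?case by (simp only: sum.empty) (rule mult_nonneg_nonneg[OF K0 powr_ge_zero])
  next
    case (Suc n)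
    let ?A = "{j \<in> J. v \<le> w j \<and> w j < 2 * v}" and ?B = "{j \<in> J. 2 * v \<le> w j}"
    have AB: "{j \<in> J. v \<le> w j} = ?A \<union> ?B" "?A \<inter> ?B = {}" "finite ?A" "finite ?B"
      using J Suc.prems(1) by auto
    have "(\<Sum>j\<in>?A. p j / w j) \<le> (\<Sum>j\<in>?A. p j / v)"
      using J Suc.prems(1) by (intro sum_mono divide_left_mono) auto
    also have "\<dots> = (\<Sum>j\<in>?A. p j) / v" by (simp add: sum_divide_distrib)
    also have "\<dots> \<le> (\<Sum>j | j \<in> J \<and> w j < 2 * v. p j) / v"
      using J Suc.prems(1) by (intro divide_right_mono sum_mono2) auto
    also have "\<dots> \<le> c * (2 * v) powr (1 - r) / v"
      using small[of "2 * v"] Suc.prems(1) by (intro divide_right_mono) auto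
    also have "\<dots> = c * 2 powr (1 - r) * v powr (-r)"
      using Suc.prems(1) by (simp add: powr_mult powr_diff powr_minus field_simps)
    also have "\<dots> \<le> 2 * c * v powr (-r)"
    proof -
      have "2 powr (1 - r) \<le> 2 powr (1 :: real)" using r by (intro powr_mono) auto
      then have "c * 2 powr (1 - r) \<le> c * 2" using c by (intro mult_left_mono) auto
      then show ?thesis by (intro mult_right_mono) (auto simp: mult.commute)
    qed
    finally have A: "(\<Sum>j\<in>?A. p j / w j) \<le> 2 * c * v powr (-r)" .
    have "?G (2 * v) \<le> ?K * (2 * v) powr (-r)"
      using Suc.prems by (intro Suc.IH) (auto simp: algebra_simps)
    also have "\<dots> = ?K * 2 powr (-r) * v powr (-r)" using Suc.prems(1) by (simp add: powr_mult)
    finally have "?G v \<le> 2 * c * v powr (-r) + ?K * 2 powr (-r) * v powr (-r)"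
      unfolding AB(1) using A sum.union_disjoint[OF AB(3,4,2), of "\<lambda>j. p j / w j"] by simp
    also have "\<dots> = (2 * c + ?K * 2 powr (-r)) * v powr (-r)" by (simp add: algebra_simps)
    \<comment> \<open>The constant is the fixed point of the recursion, that is, the sum of the
      geometric series.\<close>
    also have "2 * c + ?K * 2 powr (-r) = ?K" using r2 r by (simp add: divide_simps) (simp add: algebra_simps)
    finally show ?case .
  qed
  have "finite (w ` J)" using J by simp
  then obtain B where B: "\<And>j. j \<in> J \<Longrightarrow> w j \<le> B" by (meson bdd_above_finite bdd_above.E imageI)
  obtain n where "B / v < 2 ^ n" using real_arch_pow[of 2 "B / v"] by auto
  then have "w j < v * 2 ^ n" if "j \<in> J" for j
    using B[OF that] v by (simp add: divide_less_eq mult.commute)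
  then show ?thesis using *[OF v] by blast
qed

lemma harm_le: "0 < n \<Longrightarrow> harm n \<le> 1 + ln (real n)"
  using euler_mascheroni_sequence_decreasing[of 1 n] by (simp add: harm_expand)

text \<open>With distinct values the cardinalities are the ranks and the sum is exactly harmonic;
  ties only enlarge cardinalities. Removing a minimal element splits off the term
  \<open>1 / card A\<close>.\<close>

lemma sum_inverse_rank_le:
  fixes f :: "'a \<Rightarrow> real"
  assumes "finite A"
  shows "(\<Sum>i\<in>A. 1 / real (card {l \<in> A. f i \<le> f l})) \<le> harm (card A)"
  using assms
proof (induction "card A" arbitrary: A)
  case (Suc n)
  then have "A \<noteq> {}" by auto
  then obtain i where i: "i \<in> A" "\<And>l. l \<in> A \<Longrightarrow> f i \<le> f l"
    using Suc.prems arg_min_if_finite[of A f] by (metis not_less)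
  let ?B = "A - {i}"
  have card: "card ?B = n" using Suc i by simp
  have "(\<Sum>k\<in>?B. 1 / real (card {l \<in> A. f k \<le> f l})) \<le> (\<Sum>k\<in>?B. 1 / real (card {l \<in> ?B. f k \<le> f l}))"
  proof (intro sum_mono divide_left_mono)
    fix k assume k: "k \<in> ?B"
    then have "0 < card {l \<in> ?B. f k \<le> f l}" "0 < card {l \<in> A. f k \<le> f l}"
      using Suc.prems by (auto simp: card_gt_0_iff)
    then show "0 < real (card {l \<in> A. f k \<le> f l}) * real (card {l \<in> ?B. f k \<le> f l})" by simp
    show "real (card {l \<in> ?B. f k \<le> f l}) \<le> real (card {l \<in> A. f k \<le> f l})"
      using Suc.prems by (auto intro!: card_mono)
  qed simp
  also have "\<dots> \<le> harm n" using Suc.hyps(1)[of ?B] card Suc.prems by simp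
  finally have *: "(\<Sum>k\<in>?B. 1 / real (card {l \<in> A. f k \<le> f l})) \<le> harm n" .
  have "{l \<in> A. f i \<le> f l} = A" using i by auto
  then have "(\<Sum>k\<in>A. 1 / real (card {l \<in> A. f k \<le> f l})) =
      1 / real (card A) + (\<Sum>k\<in>?B. 1 / real (card {l \<in> A. f k \<le> f l}))"
    by (subst sum.remove[OF Suc.prems i(1)]) simp
  also have "\<dots> \<le> 1 / real (Suc n) + harm n" using * Suc.hyps(2) by simp
  also have "\<dots> = harm (Suc n)" by (simp add: harm_Suc divide_inverse)
  finally show ?case using Suc.hyps(2) by simp
qed (simp add: harm_def)

section \<open>Mean completion times\<close>

text \<open>Here \<open>a\<close> is the exponent conjugate to \<open>q\<close>, and having at least
  one job makes the optimum positive, so that it can be divided by.\<close>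

locale scheduling_instance =
  fixes q a :: real and s ps :: "real list"
  assumes speeds: "valid_speeds s" and sizes: "valid_sizes ps" and jobs: "ps \<noteq> []"
    and q: "1 < q" and a: "1 < a" and conj: "1 / q + 1 / a = 1"
begin

abbreviation m :: nat where "m \<equiv> length s"
abbreviation n :: nat where "n \<equiv> length ps"

definition optimum :: real where "optimum = opt q s ps"

definition assigned_share :: "nat \<Rightarrow> nat \<Rightarrow> real" where
  "assigned_share j i = share a 1 ((!) s) m (take j ps) (ps ! j) i"

definition eligible :: "nat \<Rightarrow> nat \<Rightarrow> bool" where
  "eligible j i \<longleftrightarrow>
     faster_weight a ((!) s) m i \<le> (mass (take j ps) (ps ! j) * s ! i / (ps ! j)) powr a"

definition eligible_weight :: "nat \<Rightarrow> real" where
  "eligible_weight j = total_weight a 1 ((!) s) m (take j ps) (ps ! j)"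

definition mean_completion :: "nat \<Rightarrow> real" where
  "mean_completion i = (\<Sum>j<n. assigned_share j i * (ps ! j / s ! i))"

lemma m_pos: "0 < m"
  using speeds by (simp add: valid_speeds_def)

lemma sp: "l < m \<Longrightarrow> 0 < s ! l"
  using speeds by (auto simp: valid_speeds_def)

lemma pp: "j < n \<Longrightarrow> 0 < ps ! j"
  using sizes by (auto simp: valid_sizes_def)

lemma weight_eligible:
  assumes "i < m"
  shows "weight a 1 ((!) s) m (take j ps) (ps ! j) i = (if eligible j i then s ! i powr a else 0)"
  by (simp add: weight_def eligible_def not_less)

lemma eligible_weight_eq: "eligible_weight j = (\<Sum>i | i < m \<and> eligible j i. s ! i powr a)"
proof -
  have "eligible_weight j = (\<Sum>i<m. if eligible j i then s ! i powr a else 0)"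
    unfolding eligible_weight_def total_weight_def by (intro sum.cong) (auto simp: weight_eligible)
  also have "\<dots> = (\<Sum>i\<in>{i \<in> {..<m}. eligible j i}. s ! i powr a)"
    by (subst sum.inter_filter) auto
  finally show ?thesis by (simp add: lessThan_def)
qed

lemma assigned_share_eq:
  "i < m \<Longrightarrow> assigned_share j i = (if eligible j i then s ! i powr a / eligible_weight j else 0)"
  by (simp add: assigned_share_def share_def weight_eligible eligible_weight_def)

lemma eligible_weight_pos: "0 < eligible_weight j"
  unfolding eligible_weight_def using m_pos sp by (intro total_weight_pos) auto

section \<open>Volume bounds derived from an optimal schedule\<close>

lemma optimum_pos: "0 < optimum"
proof -
  obtain \<kappa> where "\<And>j. j < n \<Longrightarrow> \<kappa> j < m" "\<And>j. j < n \<Longrightarrow> ps ! j \<le> optimum * s ! \<kappa> j"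
    using opt_bounds[OF speeds sizes q a conj] unfolding optimum_def by metis
  moreover have "0 < n" using jobs by simp
  ultimately have "0 < optimum * s ! \<kappa> 0" "0 < s ! \<kappa> 0" using pp sp by (fastforce, blast)
  then show ?thesis by (simp add: zero_less_mult_iff)
qed

text \<open>In an optimal schedule a job larger than \<open>optimum * \<theta>\<close> needs a
  machine of speed above \<open>\<theta>\<close>, and these machines can complete only so much work
  within the optimum.\<close>

lemma large_jobs_fit:
  assumes J: "J \<subseteq> {..<n}" and big: "\<And>j. j \<in> J \<Longrightarrow> optimum * \<theta> < ps ! j"
  shows "(\<Sum>j\<in>J. ps ! j) \<le> optimum * (\<Sum>l | l < m \<and> \<theta> < s ! l. s ! l powr a) powr (1 / a)"
proof -
  obtain \<kappa> where k: "\<And>j. j < n \<Longrightarrow> \<kappa> j < m" "\<And>j. j < n \<Longrightarrow> ps ! j \<le> optimum * s ! \<kappa> j"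
    "\<And>J A. J \<subseteq> {..<n} \<Longrightarrow> A \<subseteq> {..<m} \<Longrightarrow> \<kappa> ` J \<subseteq> A \<Longrightarrow>
       (\<Sum>j\<in>J. ps ! j) \<le> optimum * (\<Sum>l\<in>A. s ! l powr a) powr (1 / a)"
    using opt_bounds[OF speeds sizes q a conj] unfolding optimum_def by metis
  show ?thesis
  proof (rule k(3)[OF J])
    show "\<kappa> ` J \<subseteq> {l. l < m \<and> \<theta> < s ! l}"
    proof (intro image_subsetI CollectI conjI)
      fix j assume j: "j \<in> J"
      then have "j < n" using J by auto
      then have "optimum * \<theta> < optimum * s ! \<kappa> j" using k(2) big[OF j] by fastforce
      then show "\<theta> < s ! \<kappa> j" using optimum_pos by simp
      show "\<kappa> j < m" using k(1) \<open>j < n\<close> .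
    qed
  qed auto
qed

lemma faster_weight_eq:
  "faster_weight a ((!) s) m i = (\<Sum>l | l < m \<and> s ! i < s ! l. s ! l powr a)"
proof -
  have "faster_weight a ((!) s) m i = (\<Sum>l\<in>{l \<in> {..<m}. s ! i < s ! l}. s ! l powr a)"
    unfolding faster_weight_def by (subst sum.inter_filter) auto
  then show ?thesis by (simp add: lessThan_def)
qed

lemma mass_prefix:
  assumes "j < n"
  shows "mass (take j ps) (ps ! j) = (\<Sum>k | k \<le> j \<and> ps ! j / 2 \<le> ps ! k. ps ! k)"
proof -
  have "(\<Sum>k | k \<le> j \<and> ps ! j / 2 \<le> ps ! k. ps ! k) = (\<Sum>k\<in>{k \<in> {..j}. ps ! j / 2 \<le> ps ! k}. ps ! k)"
    by (rule sum.cong) auto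
  also have "\<dots> = (\<Sum>k\<le>j. if ps ! j / 2 \<le> ps ! k then ps ! k else 0)"
    by (subst sum.inter_filter) auto
  also have "\<dots> = ps ! j + (\<Sum>k<j. if ps ! j / 2 \<le> ps ! k then ps ! k else 0)"
    using pp[OF assms] by (simp add: lessThan_Suc_atMost[symmetric])
  also have "\<dots> = mass (take j ps) (ps ! j)"
    unfolding mass_def using assms by (auto intro!: sum.cong simp: not_less)
  finally show ?thesis ..
qed

lemma mass_prefix_pos: "j < n \<Longrightarrow> 0 < mass (take j ps) (ps ! j)"
  using mass_ge[of "take j ps" "ps ! j"] pp[of j] pp by (force intro: less_imp_le)

text \<open>If the job were larger, every job counted in its mass would exceed
  \<open>optimum * s ! i\<close>, so the whole mass would fit on faster machines. Eligibility bounds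
  their norm by the mass times \<open>s ! i / ps ! j\<close>, and the mass would be smaller than
  itself.\<close>

lemma eligible_size:
  assumes j: "j < n" and i: "i < m" and e: "eligible j i"
  shows "ps ! j \<le> 2 * optimum * s ! i"
proof (rule ccontr)
  assume "\<not> ?thesis"
  then have gt: "2 * optimum * s ! i < ps ! j" by simp
  let ?T = "mass (take j ps) (ps ! j)"
  have "?T \<le> optimum * faster_weight a ((!) s) m i powr (1 / a)"
    unfolding mass_prefix[OF j] faster_weight_eq
  proof (rule large_jobs_fit)
    show "{k. k \<le> j \<and> ps ! j / 2 \<le> ps ! k} \<subseteq> {..<n}" using j by auto
    show "optimum * s ! i < ps ! k" if "k \<in> {k. k \<le> j \<and> ps ! j / 2 \<le> ps ! k}" for k
      using gt that by auto
  qed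
  also have "\<dots> \<le> optimum * ((?T * s ! i / (ps ! j)) powr a) powr (1 / a)"
    using e a optimum_pos faster_weight_nonneg unfolding eligible_def
    by (intro mult_left_mono powr_mono2) auto
  also have "\<dots> = ?T * (optimum * s ! i / ps ! j)"
    using a mass_prefix_pos[OF j] sp[OF i] pp[OF j] by (simp add: powr_powr)
  also have "\<dots> < ?T * 1"
    using gt pp[OF j] mass_prefix_pos[OF j] optimum_pos sp[OF i]
    by (intro mult_strict_left_mono) (auto simp: divide_less_eq)
  finally show False by simp
qed

text \<open>Jobs above \<open>optimum * s ! l\<close> need faster machines and contribute one unit.
  For the smaller ones, ineligibility bounds the mass by a multiple of the size, which is the
  hypothesis of \<open>halving_sum\<close>; they contribute two units.\<close>

lemma ineligible_total:
  assumes l: "l < m"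
  shows "(\<Sum>j | j < n \<and> \<not> eligible j l. ps ! j) \<le> 3 * optimum * faster_weight a ((!) s) m l powr (1 / a)"
proof -
  let ?N = "faster_weight a ((!) s) m l powr (1 / a)"
  let ?B = "{j. j < n \<and> \<not> eligible j l \<and> optimum * s ! l < ps ! j}"
  let ?S = "{j. j < n \<and> \<not> eligible j l \<and> ps ! j \<le> optimum * s ! l}"
  have U: "{j. j < n \<and> \<not> eligible j l} = ?B \<union> ?S" "?B \<inter> ?S = {}" "finite ?B" "finite ?S" by auto
  have "(\<Sum>j\<in>?B. ps ! j) \<le> optimum * ?N"
    unfolding faster_weight_eq by (rule large_jobs_fit) auto
  moreover have "(\<Sum>j\<in>?S. ps ! j) \<le> 2 * (?N / s ! l) * (optimum * s ! l)"
  proof (rule halving_sum)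
    fix j assume j: "j \<in> ?S"
    let ?T = "mass (take j ps) (ps ! j)"
    have jn: "j < n" using j by simp
    have "(\<Sum>k | k \<in> ?S \<and> k \<le> j \<and> ps ! j / 2 \<le> ps ! k. ps ! k) \<le> ?T"
      unfolding mass_prefix[OF jn]
    proof (rule sum_mono2)
      show "finite {k. k \<le> j \<and> ps ! j / 2 \<le> ps ! k}" by simp
      show "0 \<le> ps ! k" if "k \<in> {k. k \<le> j \<and> ps ! j / 2 \<le> ps ! k} - {k \<in> ?S. k \<le> j \<and> ps ! j / 2 \<le> ps ! k}" for k
        using pp[of k] that jn by (simp add: less_imp_le)
    qed auto
    also have "?T = ?T * s ! l / ps ! j * (ps ! j / s ! l)" using sp[OF l] pp[OF jn] by simp
    also have "\<dots> \<le> ?N * (ps ! j / s ! l)"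
    proof (rule mult_right_mono)
      have "(?T * s ! l / ps ! j) powr a \<le> faster_weight a ((!) s) m l"
        using j by (simp add: eligible_def not_le less_imp_le)
      then have "((?T * s ! l / ps ! j) powr a) powr (1 / a) \<le> ?N"
        using a by (intro powr_mono2) auto
      then show "?T * s ! l / ps ! j \<le> ?N"
        using a mass_prefix_pos[OF jn] sp[OF l] pp[OF jn] by (simp add: powr_powr)
    qed (use sp[OF l] pp[OF jn] in simp)
    finally show "(\<Sum>k | k \<in> ?S \<and> k \<le> j \<and> ps ! j / 2 \<le> ps ! k. ps ! k) \<le> ?N / s ! l * ps ! j"
      by simp
  qed (use sp[OF l] pp optimum_pos in auto)
  ultimately show ?thesis
    unfolding U(1) using sum.union_disjoint[OF U(3,4,2), of "(!) ps"] sp[OF l]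
    by (simp add: algebra_simps)
qed

text \<open>Eligibility is upward closed in the speed. Hence a job with eligible weight below
  \<open>v\<close> is ineligible on the slowest machine \<open>l\<close> whose faster machines weigh
  less than \<open>v\<close>, and \<open>ineligible_total\<close> applies to this one
  machine.\<close>

lemma light_total:
  assumes v: "0 < v"
  shows "(\<Sum>j | j < n \<and> eligible_weight j < v. ps ! j) \<le> 3 * optimum * v powr (1 / a)"
proof -
  let ?fw = "faster_weight a ((!) s) m" and ?A = "\<Sum>l<m. s ! l powr a"
  show ?thesis
  proof (cases "?A < v")
    case True
    have "(\<Sum>j | j < n \<and> eligible_weight j < v. ps ! j) \<le>
        optimum * (\<Sum>l | l < m \<and> 0 < s ! l. s ! l powr a) powr (1 / a)"
      by (rule large_jobs_fit) (use pp in auto)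
    also have "{l. l < m \<and> 0 < s ! l} = {..<m}" using sp by auto
    also have "optimum * ?A powr (1 / a) \<le> optimum * v powr (1 / a)"
      using True a optimum_pos by (intro mult_left_mono powr_mono2 sum_nonneg) auto
    also have "\<dots> \<le> 3 * optimum * v powr (1 / a)" using optimum_pos by simp
    finally show ?thesis .
  next
    case False
    let ?L = "{l. l < m \<and> ?fw l < v}"
    have fin: "finite ?L" by simp
    have "Max ((!) s ` {..<m}) \<in> (!) s ` {..<m}" using m_pos by (intro Max_in) auto
    then obtain f where f: "f < m" "s ! f = Max ((!) s ` {..<m})" by auto
    have fmax: "s ! k \<le> s ! f" if "k < m" for k using that unfolding f(2) by (intro Max_ge) auto
    then have "?fw f = 0" unfolding faster_weight_def
      using leD[OF fmax] by (intro sum.neutral) auto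
    then have "f \<in> ?L" using f v by simp
    then have "Min ((!) s ` ?L) \<in> (!) s ` ?L" using fin by (intro Min_in) auto
    then obtain l where l: "l \<in> ?L" "s ! l = Min ((!) s ` ?L)" by auto
    have lmin: "s ! l \<le> s ! k" if "k \<in> ?L" for k
      using that fin unfolding l(2) by (intro Min_le) auto
    \<comment> \<open>With its ties, machine \<open>l\<close> brings the weight up to at least
      \<open>v\<close>: the next slower machine \<open>k\<close> fails the defining condition of
      \<open>?L\<close>, and all machines faster than \<open>k\<close> are at least as fast as
      \<open>l\<close>. If nothing is slower, the set consists of all machines.\<close>
    have top: "v \<le> (\<Sum>k | k < m \<and> s ! l \<le> s ! k. s ! k powr a)"
    proof (cases "\<exists>k<m. s ! k < s ! l")
      case True
      let ?K = "{k. k < m \<and> s ! k < s ! l}"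
      have K: "finite ?K" "?K \<noteq> {}" using True by auto
      then have "Max ((!) s ` ?K) \<in> (!) s ` ?K" by (intro Max_in) auto
      then obtain k where k: "k \<in> ?K" "s ! k = Max ((!) s ` ?K)" by auto
      have "k \<notin> ?L" using lmin[of k] k by auto
      then have "v \<le> ?fw k" using k by auto
      also have "?fw k \<le> (\<Sum>k | k < m \<and> s ! l \<le> s ! k. s ! k powr a)"
        unfolding faster_weight_eq
      proof (rule sum_mono2)
        show "{i. i < m \<and> s ! k < s ! i} \<subseteq> {i. i < m \<and> s ! l \<le> s ! i}"
        proof (rule subsetI, rule ccontr)
          fix i assume i: "i \<in> {i. i < m \<and> s ! k < s ! i}" "i \<notin> {i. i < m \<and> s ! l \<le> s ! i}"
          then have "i \<in> ?K" by auto
          then have "s ! i \<le> s ! k" using K k(2) by simp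
          then show False using i by simp
        qed
      qed auto
      finally show ?thesis .
    next
      case no: False
      have "s ! l \<le> s ! k" if "k < m" for k using no that by (metis not_less)
      then have "{k. k < m \<and> s ! l \<le> s ! k} = {..<m}" by auto
      then show ?thesis using False by simp
    qed
    have "\<not> eligible j l" if j: "j < n" "eligible_weight j < v" for j
    proof
      assume e: "eligible j l"
      have "eligible j k" if k: "k < m" "s ! l \<le> s ! k" for k
      proof -
        have "?fw k \<le> ?fw l" unfolding faster_weight_def using k by (intro sum_mono) auto
        also have "\<dots> \<le> (mass (take j ps) (ps ! j) * s ! l / ps ! j) powr a" using e by (simp add: eligible_def)
        also have "\<dots> \<le> (mass (take j ps) (ps ! j) * s ! k / ps ! j) powr a"
          using a k l sp[of l] pp[OF j(1)] mass_prefix_pos[OF j(1)]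
          by (intro powr_mono2 divide_right_mono mult_left_mono) auto
        finally show ?thesis by (simp add: eligible_def)
      qed
      then have "(\<Sum>k | k < m \<and> s ! l \<le> s ! k. s ! k powr a) \<le> eligible_weight j"
        unfolding eligible_weight_eq by (intro sum_mono2) auto
      then show False using top j by simp
    qed
    then have "(\<Sum>j | j < n \<and> eligible_weight j < v. ps ! j) \<le> (\<Sum>j | j < n \<and> \<not> eligible j l. ps ! j)"
      using pp by (intro sum_mono2) (auto intro: less_imp_le)
    also have "\<dots> \<le> 3 * optimum * ?fw l powr (1 / a)" using l by (intro ineligible_total) auto
    also have "\<dots> \<le> 3 * optimum * v powr (1 / a)"
      using l a optimum_pos faster_weight_nonneg by (intro mult_left_mono powr_mono2) auto
    finally show ?thesis .
  qed
qed

section \<open>The vector of mean completion times\<close>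

definition mean_factor :: real where
  "mean_factor = 6 / (1 - 2 powr (- (1 / q)))"

lemma mean_factor_nonneg: "0 \<le> mean_factor"
proof -
  have "2 powr (- (1 / q)) < (1 :: real)" using powr_less_mono[of "- (1 / q)" 0 "2 :: real"] q by simp
  then show ?thesis by (simp add: mean_factor_def)
qed

lemma mean_completion_nonneg: "i < m \<Longrightarrow> 0 \<le> mean_completion i"
  unfolding mean_completion_def using pp sp[of i]
  by (intro sum_nonneg mult_nonneg_nonneg) (auto simp: assigned_share_def share_nonneg less_imp_le)

text \<open>Whenever \<open>i\<close> is eligible for a job, so are all machines at least as fast,
  and the eligible weight is at least \<open>W\<close>. The mean is thus controlled by the sum of
  size over eligible weight above the level \<open>W\<close>, which \<open>doubling_sum\<close>
  bounds by means of \<open>light_total\<close>.\<close>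

lemma mean_completion_le:
  assumes i: "i < m"
  defines "W \<equiv> \<Sum>l | l < m \<and> s ! i \<le> s ! l. s ! l powr a"
  shows "mean_completion i \<le> mean_factor * optimum * (s ! i powr (a - 1) * W powr (- (1 / q)))"
proof -
  have W: "0 < W" unfolding W_def using i sp[OF i]
    by (intro sum_pos2[where i=i]) auto
  have WE: "W \<le> eligible_weight j" if j: "j < n" "eligible j i" for j
  proof -
    have "eligible j k" if k: "k < m" "s ! i \<le> s ! k" for k
    proof -
      have "faster_weight a ((!) s) m k \<le> faster_weight a ((!) s) m i"
        unfolding faster_weight_def using k by (intro sum_mono) auto
      also have "\<dots> \<le> (mass (take j ps) (ps ! j) * s ! i / ps ! j) powr a" using j by (simp add: eligible_def)
      also have "\<dots> \<le> (mass (take j ps) (ps ! j) * s ! k / ps ! j) powr a"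
        using a k i sp[of i] pp[OF j(1)] mass_prefix_pos[OF j(1)]
        by (intro powr_mono2 divide_right_mono mult_left_mono) auto
      finally show ?thesis by (simp add: eligible_def)
    qed
    then show ?thesis unfolding W_def eligible_weight_eq by (intro sum_mono2) auto
  qed
  have r: "1 - 1 / q = 1 / a" using conj by simp
  \<comment> \<open>Applied with \<open>r = 1 / q\<close> and \<open>c = 3 * optimum\<close>; the
    product of 2 and 3 is the numerator of \<open>mean_factor\<close>.\<close>
  have "(\<Sum>j | j < n \<and> W \<le> eligible_weight j. ps ! j / eligible_weight j) \<le>
      2 * (3 * optimum) / (1 - 2 powr (- (1 / q))) * W powr (- (1 / q))"
    using doubling_sum[of "{..<n}" "(!) ps" "1 / q" "3 * optimum" eligible_weight W]
      light_total pp q optimum_pos W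
    by (simp add: r less_imp_le)
  also have "\<dots> = mean_factor * optimum * W powr (- (1 / q))" by (simp add: mean_factor_def)
  finally have D: "(\<Sum>j | j < n \<and> W \<le> eligible_weight j. ps ! j / eligible_weight j) \<le>
      mean_factor * optimum * W powr (- (1 / q))" .
  have "mean_completion i = (\<Sum>j<n. if eligible j i then s ! i powr (a - 1) * (ps ! j / eligible_weight j) else 0)"
    unfolding mean_completion_def
  proof (intro sum.cong refl)
    fix j assume "j \<in> {..<n}"
    have "s ! i powr (a - 1) = s ! i powr a / s ! i" using sp[OF i] by (simp add: powr_diff)
    then show "assigned_share j i * (ps ! j / s ! i) =
        (if eligible j i then s ! i powr (a - 1) * (ps ! j / eligible_weight j) else 0)"
      using i by (simp add: assigned_share_eq)
  qed
  also have "\<dots> = (\<Sum>j\<in>{j \<in> {..<n}. eligible j i}. s ! i powr (a - 1) * (ps ! j / eligible_weight j))"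
    by (subst sum.inter_filter) auto
  also have "\<dots> = s ! i powr (a - 1) * (\<Sum>j\<in>{j \<in> {..<n}. eligible j i}. ps ! j / eligible_weight j)"
    by (simp add: sum_distrib_left)
  also have "\<dots> \<le> s ! i powr (a - 1) * (\<Sum>j | j < n \<and> W \<le> eligible_weight j. ps ! j / eligible_weight j)"
    using WE pp eligible_weight_pos
    by (intro mult_left_mono sum_mono2) (auto intro: divide_nonneg_pos less_imp_le)
  also have "\<dots> \<le> s ! i powr (a - 1) * (mean_factor * optimum * W powr (- (1 / q)))"
    using D by (intro mult_left_mono) auto
  finally show ?thesis by (simp add: mult_ac)
qed

text \<open>Since \<open>(a - 1) * q = a\<close>, the \<open>q\<close>-th power of the bound on
  machine \<open>i\<close> is the ratio of its weight to the weight of all machines at least as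
  fast. This is at most the inverse of its rank by speed, so the sum is harmonic.\<close>

lemma mean_norm:
  "(\<Sum>i<m. mean_completion i powr q) \<le> (mean_factor * optimum) powr q * (1 + ln (real m))"
proof -
  let ?W = "\<lambda>i. \<Sum>l | l < m \<and> s ! i \<le> s ! l. s ! l powr a"
  have aq: "(a - 1) * q = a" using conj q a by (simp add: field_simps)
  have "mean_completion i powr q \<le> (mean_factor * optimum) powr q * (1 / real (card {l \<in> {..<m}. s ! i \<le> s ! l}))"
    if i: "i < m" for i
  proof -
    have W: "0 < ?W i" using i sp[OF i] by (intro sum_pos2[where i=i]) auto
    let ?c = "card {l \<in> {..<m}. s ! i \<le> s ! l}"
    have c: "0 < ?c" using i by (auto simp: card_gt_0_iff)
    have "mean_completion i powr q \<le> (mean_factor * optimum * (s ! i powr (a - 1) * ?W i powr (- (1 / q)))) powr q"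
      using i q mean_completion_nonneg mean_completion_le by (intro powr_mono2) auto
    also have "\<dots> = (mean_factor * optimum) powr q * ((s ! i powr (a - 1) * ?W i powr (- (1 / q))) powr q)"
      by (rule powr_mult)
    also have "(s ! i powr (a - 1) * ?W i powr (- (1 / q))) powr q =
        s ! i powr ((a - 1) * q) * ?W i powr (- (1 / q) * q)"
      by (simp only: powr_mult powr_powr)
    also have "- (1 / q) * q = - 1" using q by simp
    also have "s ! i powr ((a - 1) * q) * ?W i powr (- 1) = s ! i powr a / ?W i"
      using W by (simp add: aq powr_minus divide_inverse)
    also have "(mean_factor * optimum) powr q * (s ! i powr a / ?W i) \<le> (mean_factor * optimum) powr q * (1 / real ?c)"
    proof (rule mult_left_mono)
      have "real ?c * s ! i powr a = (\<Sum>l | l < m \<and> s ! i \<le> s ! l. s ! i powr a)"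
        by (simp add: lessThan_def)
      also have "\<dots> \<le> ?W i" using a sp[OF i] by (intro sum_mono powr_mono2) auto
      finally show "s ! i powr a / ?W i \<le> 1 / real ?c"
        using W c by (simp add: divide_simps mult.commute)
    qed simp
    finally show ?thesis .
  qed
  then have "(\<Sum>i<m. mean_completion i powr q) \<le>
      (\<Sum>i<m. (mean_factor * optimum) powr q * (1 / real (card {l \<in> {..<m}. s ! i \<le> s ! l})))"
    by (intro sum_mono) auto
  also have "\<dots> = (mean_factor * optimum) powr q * (\<Sum>i<m. 1 / real (card {l \<in> {..<m}. s ! i \<le> s ! l}))"
    by (simp add: sum_distrib_left)
  also have "\<dots> \<le> (mean_factor * optimum) powr q * (1 + ln (real m))"
    using sum_inverse_rank_le[of "{..<m}" "(!) s"] harm_le[OF m_pos]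
    by (intro mult_left_mono) (simp_all add: order_trans)
  finally show ?thesis .
qed

section \<open>The mean of the noise\<close>

definition mean_noise :: real where
  "mean_noise = (\<Sum>j<n. \<Sum>i<m. assigned_share j i * (ps ! j / s ! i) powr q)"

text \<open>An eligible job takes time at most \<open>2 * optimum\<close>, so all but one factor of
  each \<open>q\<close>-th power can be replaced by this bound, leaving the sum of the mean
  completion times.\<close>

lemma mean_noise_le:
  "mean_noise \<le> (2 * optimum) powr q * (mean_factor * real m powr (1 / a) * (1 + ln (real m)) powr (1 / q))"
proof -
  let ?b = "2 * optimum"
  have b: "0 < ?b" using optimum_pos by simp
  have scaled: "assigned_share j i * (ps ! j / s ! i) powr q \<le>
      ?b powr (q - 1) * (assigned_share j i * (ps ! j / s ! i))"
    if j: "j < n" and i: "i < m" for i j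
  proof (cases "eligible j i")
    case True
    let ?x = "ps ! j / s ! i"
    have x: "0 < ?x" "?x \<le> ?b"
      using eligible_size[OF j i True] sp[OF i] pp[OF j] by (auto simp: divide_le_eq)
    have "y powr q = y powr (q - 1) * y" if "0 < y" for y :: real
      using that by (simp add: powr_diff)
    from this[OF x(1)] have "?x powr q = ?x powr (q - 1) * ?x" .
    also have "\<dots> \<le> ?b powr (q - 1) * ?x" using x q by (intro mult_right_mono powr_mono2) auto
    finally show ?thesis
      using mult_left_mono[of "?x powr q" "?b powr (q - 1) * ?x" "assigned_share j i"]
      by (simp add: assigned_share_def share_nonneg mult_ac)
  next
    case False
    then show ?thesis using i by (simp add: assigned_share_eq)
  qed
  have "mean_noise \<le> (\<Sum>j<n. \<Sum>i<m. ?b powr (q - 1) * (assigned_share j i * (ps ! j / s ! i)))"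
    unfolding mean_noise_def using scaled by (intro sum_mono) auto
  also have "\<dots> = ?b powr (q - 1) * (\<Sum>i<m. mean_completion i)"
    unfolding mean_completion_def by (subst sum.swap) (simp add: sum_distrib_left)
  \<comment> \<open>Hoelder against the constant vector is the place where the power of
    \<open>m\<close> enters.\<close>
  also have "(\<Sum>i<m. mean_completion i) = (\<Sum>i<m. mean_completion i * 1)" by simp
  also have "\<dots> \<le> (\<Sum>i<m. mean_completion i powr q) powr (1 / q) * (\<Sum>i<m. 1 powr a) powr (1 / a)"
    using q a conj mean_completion_nonneg by (intro Holder_sum) auto
  also have "\<dots> = (\<Sum>i<m. mean_completion i powr q) powr (1 / q) * real m powr (1 / a)" by simp
  also have "\<dots> \<le> ((mean_factor * optimum) powr q * (1 + ln (real m))) powr (1 / q) * real m powr (1 / a)"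
    using mean_norm q by (intro mult_right_mono powr_mono2 sum_nonneg) auto
  also have "((mean_factor * optimum) powr q * (1 + ln (real m))) powr (1 / q) =
      mean_factor * optimum * (1 + ln (real m)) powr (1 / q)"
    using q mean_factor_nonneg optimum_pos m_pos by (simp add: powr_mult powr_powr)
  finally have "mean_noise \<le> ?b powr (q - 1) * (mean_factor * optimum * (1 + ln (real m)) powr (1 / q) * real m powr (1 / a))"
    by (simp add: mult_left_mono)
  also have "\<dots> \<le> ?b powr (q - 1) * (?b * (mean_factor * real m powr (1 / a) * (1 + ln (real m)) powr (1 / q)))"
    using mean_factor_nonneg optimum_pos by (intro mult_left_mono) (auto simp: mult_ac)
  also have "\<dots> = ?b powr q * (mean_factor * real m powr (1 / a) * (1 + ln (real m)) powr (1 / q))"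
    using b by (simp add: powr_diff)
  finally show ?thesis .
qed

end

section \<open>Concentration\<close>

text \<open>Valid for every real \<open>x\<close>. Consequently jobs go to eligible machines on
  every seed, and the pathwise bounds below need no exceptional null set.\<close>

lemma pick_positive:
  assumes "\<And>l. l < n \<Longrightarrow> 0 \<le> w l" "0 < (\<Sum>l<n. w l)"
  shows "0 < w (pick w x n)"
  using assms
proof (induction n)
  case (Suc n)
  show ?case
  proof (cases "0 < w n \<and> \<not> (0 < (\<Sum>l<n. w l) \<and> x < (\<Sum>l<n. w l))")
    case False
    have "0 < (\<Sum>l<n. w l)" using False Suc.prems(1)[of n] Suc.prems(2) by (cases "w n = 0") auto
    moreover have "pick w x (Suc n) = pick w x n" using False by auto
    ultimately show ?thesis using Suc by simp
  qed simp
qed simp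

text \<open>Only the first \<open>n\<close> coordinates matter; their joint law is the finite
  product measure, over which products integrate factorwise.\<close>

lemma nn_integral_run_prod:
  assumes "\<And>j. j < n \<Longrightarrow> F j \<in> borel_measurable seed_space"
  shows "(\<integral>\<^sup>+\<omega>. (\<Prod>j<n. F j (\<omega> j)) \<partial>run_space) = (\<Prod>j<n. \<integral>\<^sup>+\<xi>. F j \<xi> \<partial>seed_space)"
proof -
  interpret product_sigma_finite "\<lambda>_::nat. seed_space"
    using prob_space_seed_space prob_space_imp_sigma_finite by (simp add: product_sigma_finite_def)
  let ?P = "Pi\<^sub>M {..<n} (\<lambda>_. seed_space)"
  have d: "distr run_space ?P (\<lambda>\<omega>. \<lambda>j\<in>{..<n}. \<omega> j) = ?P"
    using distr_PiM_reindex[of UNIV "\<lambda>_. seed_space" "\<lambda>j. j" "{..<n}"] prob_space_seed_space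
    by (simp add: run_space_def)
  have m: "(\<lambda>x. \<Prod>j<n. F j (x j)) \<in> borel_measurable ?P"
  proof (intro borel_measurable_prod_ennreal)
    fix j assume j: "j \<in> {..<n}"
    then have "(\<lambda>x. x j) \<in> measurable ?P seed_space" by measurable
    from measurable_compose[OF this] assms j show "(\<lambda>x. F j (x j)) \<in> borel_measurable ?P" by auto
  qed
  have r: "(\<lambda>\<omega>. \<lambda>j\<in>{..<n}. \<omega> j) \<in> measurable run_space ?P"
    unfolding run_space_def by (rule measurable_restrict_subset) auto
  have "(\<integral>\<^sup>+\<omega>. (\<Prod>j<n. F j (\<omega> j)) \<partial>run_space) = (\<integral>\<^sup>+\<omega>. (\<Prod>j<n. F j ((\<lambda>j\<in>{..<n}. \<omega> j) j)) \<partial>run_space)"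
    by (intro nn_integral_cong prod.cong) auto
  also have "\<dots> = (\<integral>\<^sup>+x. (\<Prod>j<n. F j (x j)) \<partial>distr run_space ?P (\<lambda>\<omega>. \<lambda>j\<in>{..<n}. \<omega> j))"
    using m r by (subst nn_integral_distr) auto
  also have "\<dots> = (\<Prod>j<n. \<integral>\<^sup>+\<xi>. F j \<xi> \<partial>seed_space)"
    unfolding d using assms by (intro product_nn_integral_prod) auto
  finally show ?thesis .
qed

lemma prod_le_1_ennreal:
  fixes G :: "nat \<Rightarrow> ennreal"
  assumes "\<And>j. j < n \<Longrightarrow> G j \<le> 1"
  shows "(\<Prod>j<n. G j) \<le> 1"
  using assms
proof (induction n)
  case (Suc n)
  then show ?case using mult_mono[of "\<Prod>j<n. G j" 1 "G n" 1] by simp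
qed simp

lemma powr_add_le:
  fixes x y r :: real
  assumes "0 \<le> x" "0 \<le> y" "0 < r" "r \<le> 1"
  shows "(x + y) powr r \<le> x powr r + y powr r"
proof (cases "x + y = 0")
  case False
  then have p: "0 < x + y" using assms by auto
  have le: "z / (x + y) \<le> (z / (x + y)) powr r" if "0 \<le> z" "z \<le> x + y" for z
  proof (cases "z = 0")
    case False
    then have "(z / (x + y)) powr 1 \<le> (z / (x + y)) powr r"
      using that p assms by (intro powr_mono') auto
    then show ?thesis using that p False by simp
  qed simp
  have "1 = x / (x + y) + y / (x + y)" using p by (simp add: add_divide_distrib[symmetric])
  also have "\<dots> \<le> (x / (x + y)) powr r + (y / (x + y)) powr r"
    using le[of x] le[of y] assms by (intro add_mono) auto
  also have "\<dots> = (x powr r + y powr r) / (x + y) powr r"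
    by (simp add: powr_divide add_divide_distrib)
  finally show ?thesis using p by (simp add: le_divide_eq)
qed (use assms in auto)

lemma exp_le_linear: "0 \<le> x \<Longrightarrow> x \<le> 1 \<Longrightarrow> exp x \<le> 1 + 2 * (x :: real)"
  using exp_bound[of x] mult_left_mono[of x 1 x] by (simp add: power2_eq_square)

lemma ln_square_le:
  assumes "1 \<le> (y :: real)"
  shows "(ln y)\<^sup>2 \<le> 4 * y"
proof -
  have "ln (sqrt y) \<le> sqrt y" using ln_bound[of "sqrt y"] assms by simp
  then have "ln y \<le> 2 * sqrt y" using assms by (simp add: ln_sqrt)
  then have "(ln y)\<^sup>2 \<le> (2 * sqrt y)\<^sup>2" using assms by (intro power_mono) auto
  then show ?thesis using assms by (simp add: power_mult_distrib)
qed

section \<open>Exponential moments of the random assignment\<close>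

context scheduling_instance
begin

definition machine_of :: "(nat \<Rightarrow> seed) \<Rightarrow> nat \<Rightarrow> nat" where
  "machine_of \<omega> j = choose_machine a 1 ((!) s) m (take j ps) (ps ! j) (\<omega> j 0)"

lemma machine_of_less: "machine_of \<omega> j < m"
  unfolding machine_of_def by (rule choose_machine_less[OF m_pos])

lemma eligible_machine_of: "eligible j (machine_of \<omega> j)"
proof -
  have "0 < weight a 1 ((!) s) m (take j ps) (ps ! j) (machine_of \<omega> j)"
    unfolding machine_of_def choose_machine_def using eligible_weight_pos[of j]
    by (intro pick_positive[where w="weight a 1 ((!) s) m (take j ps) (ps ! j)" and n=m])
      (simp_all add: weight_nonneg eligible_weight_def flip: total_weight_def)
  then show ?thesis using weight_eligible[OF machine_of_less] by (simp split: if_splits)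
qed

definition completion :: "(nat \<Rightarrow> seed) \<Rightarrow> nat \<Rightarrow> real" where
  "completion \<omega> i = (\<Sum>j<n. if machine_of \<omega> j = i then ps ! j / s ! i else 0)"

lemma objective_run: "objective q s (run (mech a 1) s ps \<omega>) = (\<Sum>i<m. completion \<omega> i powr q) powr (1 / q)"
  unfolding objective_def lq_norm_def load_run_mech completion_def machine_of_def
  by (simp add: sum_divide_distrib if_distrib[of "\<lambda>x. x / _"] cong: if_cong)

lemma completion_nonneg: "i < m \<Longrightarrow> 0 \<le> completion \<omega> i"
  unfolding completion_def using pp sp[of i] by (intro sum_nonneg) (auto simp: less_imp_le)

lemma measurable_machine_of_real:
  "(\<lambda>\<omega>. (f (machine_of \<omega> j) :: real)) \<in> borel_measurable run_space"
  unfolding machine_of_def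
  by (rule measurable_run_compose[where f="\<lambda>u. f (choose_machine a 1 ((!) s) m (take j ps) (ps ! j) u)"])
    measurable

lemma measurable_objective [measurable]:
  "(\<lambda>\<omega>. objective q s (run (mech a 1) s ps \<omega>)) \<in> borel_measurable run_space"
proof -
  have [measurable]: "(\<lambda>\<omega>. if machine_of \<omega> j = i then ps ! j / s ! i else 0) \<in> borel_measurable run_space" for i j
    by (rule measurable_machine_of_real[where f="\<lambda>k. if k = i then ps ! j / s ! i else 0"])
  show ?thesis unfolding objective_run completion_def by measurable
qed

text \<open>An exponential moment normalised by twice the mean, so that its expectation is at most 1
  for statistics with values in the unit interval.\<close>

definition chernoff :: "(nat \<Rightarrow> nat \<Rightarrow> real) \<Rightarrow> (nat \<Rightarrow> seed) \<Rightarrow> real" where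
  "chernoff f \<omega> = exp ((\<Sum>j<n. f j (machine_of \<omega> j)) - 2 * (\<Sum>j<n. \<Sum>i<m. assigned_share j i * f j i))"

lemma measurable_chernoff [measurable]: "chernoff f \<in> borel_measurable run_space"
proof -
  have [measurable]: "(\<lambda>\<omega>. f j (machine_of \<omega> j)) \<in> borel_measurable run_space" for j
    by (rule measurable_machine_of_real)
  show ?thesis unfolding chernoff_def[abs_def] by measurable
qed

text \<open>On the unit interval \<open>exp x\<close> is at most \<open>1 + 2 * x\<close>, so the
  exponential moment of one job is at most the exponential of twice its mean; independence
  multiplies these bounds. Values at ineligible machines have share 0 and need no bound.\<close>

lemma nn_integral_chernoff:
  assumes f: "\<And>j i. j < n \<Longrightarrow> i < m \<Longrightarrow> eligible j i \<Longrightarrow> 0 \<le> f j i \<and> f j i \<le> 1"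
  shows "(\<integral>\<^sup>+\<omega>. ennreal (chernoff f \<omega>) \<partial>run_space) \<le> 1"
proof -
  let ?ch = "\<lambda>j. choose_machine a 1 ((!) s) m (take j ps) (ps ! j)"
  define M where "M j = (\<Sum>i<m. assigned_share j i * f j i)" for j
  let ?F = "\<lambda>j \<xi>. ennreal (exp (f j (?ch j (\<xi> 0)) - 2 * M j))"
  have meas: "?F j \<in> borel_measurable seed_space" for j
    by (rule measurable_seed_compose[where f="\<lambda>u. ennreal (exp (f j (?ch j u) - 2 * M j))"]) measurable
  have "(\<integral>\<^sup>+\<xi>. ?F j \<xi> \<partial>seed_space) \<le> 1" if j: "j < n" for j
  proof -
    let ?g = "\<lambda>i. exp (f j i - 2 * M j)"
    have int: "integrable seed_space (\<lambda>\<xi>. ?g (?ch j (\<xi> 0)))"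
      by (rule integrable_seed[where f="\<lambda>u. ?g (?ch j u)"], rule integral_choose_machine(1)[where f="?g"])
        (use m_pos sp in auto)
    have "(LINT \<xi>|seed_space. ?g (?ch j (\<xi> 0))) = (LINT u|unif. ?g (?ch j u))"
      by (rule integral_seed[where f="\<lambda>u. ?g (?ch j u)"]) measurable
    also have "\<dots> = (\<Sum>i<m. assigned_share j i * ?g i)"
      unfolding assigned_share_def
      by (rule integral_choose_machine(2)[where f="?g"]) (use m_pos sp in auto)
    also have "\<dots> = (\<Sum>i<m. assigned_share j i * exp (f j i)) * exp (- 2 * M j)"
      by (simp add: sum_distrib_left exp_diff exp_minus divide_inverse mult_ac)
    also have "\<dots> \<le> exp (2 * M j) * exp (- 2 * M j)"
    proof (rule mult_right_mono)
      have "(\<Sum>i<m. assigned_share j i * exp (f j i)) \<le> (\<Sum>i<m. assigned_share j i * (1 + 2 * f j i))"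
      proof (rule sum_mono)
        fix i assume i: "i \<in> {..<m}"
        show "assigned_share j i * exp (f j i) \<le> assigned_share j i * (1 + 2 * f j i)"
        proof (cases "eligible j i")
          case True
          then show ?thesis using f[OF j _ True] i
            by (intro mult_left_mono exp_le_linear) (auto simp: assigned_share_def share_nonneg)
        next
          case False
          then show ?thesis using i by (simp add: assigned_share_eq)
        qed
      qed
      also have "\<dots> = (\<Sum>i<m. assigned_share j i) + 2 * M j"
        by (simp add: M_def algebra_simps sum.distrib sum_distrib_left)
      also have "(\<Sum>i<m. assigned_share j i) = 1"
        unfolding assigned_share_def using m_pos sp by (intro sum_share) auto
      also have "1 + 2 * M j \<le> exp (2 * M j)" by (rule exp_ge_add_one_self)
      finally show "(\<Sum>i<m. assigned_share j i * exp (f j i)) \<le> exp (2 * M j)" .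
    qed simp
    also have "\<dots> = 1" by (simp flip: exp_add)
    finally have "(LINT \<xi>|seed_space. ?g (?ch j (\<xi> 0))) \<le> 1" .
    then show ?thesis using nn_integral_eq_integral[OF int] by simp
  qed
  then have "(\<Prod>j<n. \<integral>\<^sup>+\<xi>. ?F j \<xi> \<partial>seed_space) \<le> 1" by (rule prod_le_1_ennreal)
  moreover have "ennreal (chernoff f \<omega>) = (\<Prod>j<n. ?F j (\<omega> j))" for \<omega>
    unfolding chernoff_def machine_of_def M_def
    by (simp add: prod_ennreal flip: exp_sum) (simp add: sum_subtractf sum_distrib_left)
  ultimately show ?thesis
    by (subst (asm) nn_integral_run_prod[symmetric, OF meas]) simp
qed

text \<open>The division by \<open>2 * optimum\<close> normalises the value to at most 1 on eligible
  machines.\<close>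

definition noise_stat :: "nat \<Rightarrow> nat \<Rightarrow> real" where
  "noise_stat j i = (ps ! j / s ! i / (2 * optimum)) powr q"

text \<open>Restricted to jobs whose time on machine \<open>i\<close> is at most
  \<open>2 * optimum / 2 ^ k\<close> and measured in that unit, which keeps the values in the unit
  interval at every scale.\<close>

definition level_stat :: "nat \<Rightarrow> nat \<Rightarrow> nat \<Rightarrow> nat \<Rightarrow> real" where
  "level_stat i k j l =
     (if l = i \<and> 2 ^ k * (ps ! j / s ! i) \<le> 2 * optimum then 2 ^ k * (ps ! j / s ! i) / (2 * optimum) else 0)"

text \<open>
  The mean of the potential is polynomial in \<open>m\<close>, and its logarithm bounds all deviations at once: that
  of the noise and, for every machine and every dyadic scale up to \<open>2\<^sup>-\<^sup>m\<close>, that of the time taken by the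
  jobs below this scale.
\<close>

definition potential :: "(nat \<Rightarrow> seed) \<Rightarrow> real" where
  "potential \<omega> = 1 + chernoff noise_stat \<omega> + (\<Sum>i<m. \<Sum>k\<le>m. chernoff (level_stat i k) \<omega>)"

definition deviation :: "(nat \<Rightarrow> seed) \<Rightarrow> real" where
  "deviation \<omega> = ln (potential \<omega>)"

lemma measurable_potential [measurable]: "potential \<in> borel_measurable run_space"
  unfolding potential_def[abs_def] by measurable

lemma chernoff_nonneg [simp]: "0 \<le> chernoff f \<omega>"
  by (simp add: chernoff_def)

lemma potential_ge_1: "1 \<le> potential \<omega>"
  by (simp add: potential_def add_nonneg_nonneg sum_nonneg)

lemma potential_ge:
  "chernoff noise_stat \<omega> \<le> potential \<omega>"
  "i < m \<Longrightarrow> k \<le> m \<Longrightarrow> chernoff (level_stat i k) \<omega> \<le> potential \<omega>"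
proof -
  have nn: "0 \<le> (\<Sum>k\<le>m. chernoff (level_stat i k) \<omega>)" for i
    by (intro sum_nonneg) simp
  then have "0 \<le> (\<Sum>i<m. \<Sum>k\<le>m. chernoff (level_stat i k) \<omega>)" by (intro sum_nonneg) auto
  then show "chernoff noise_stat \<omega> \<le> potential \<omega>" by (simp add: potential_def)
  assume ik: "i < m" "k \<le> m"
  have "chernoff (level_stat i k) \<omega> \<le> (\<Sum>k\<le>m. chernoff (level_stat i k) \<omega>)"
    using ik by (intro member_le_sum) auto
  also have "\<dots> \<le> (\<Sum>i<m. \<Sum>k\<le>m. chernoff (level_stat i k) \<omega>)"
    using ik nn by (intro member_le_sum[where f="\<lambda>i. \<Sum>k\<le>m. chernoff (level_stat i k) \<omega>"]) auto
  also have "\<dots> \<le> potential \<omega>"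
    by (simp add: potential_def)
  finally show "chernoff (level_stat i k) \<omega> \<le> potential \<omega>" .
qed

text \<open>There are \<open>2 + m * (m + 1)\<close> terms, each of mean at most 1. Adding them
  takes the place of a union bound and serves the expectation and the tail alike.\<close>

lemma potential_integral:
  "integrable run_space potential" "(LINT \<omega>|run_space. potential \<omega>) \<le> 4 * (real m)\<^sup>2"
proof -
  interpret R: prob_space run_space by (rule prob_space_run_space)
  have b: "0 < 2 * optimum" using optimum_pos by simp
  have c: "integrable run_space (chernoff f) \<and> (LINT \<omega>|run_space. chernoff f \<omega>) \<le> 1"
    if "\<And>j i. j < n \<Longrightarrow> i < m \<Longrightarrow> eligible j i \<Longrightarrow> 0 \<le> f j i \<and> f j i \<le> 1" for f
  proof -
    have le: "(\<integral>\<^sup>+\<omega>. ennreal (chernoff f \<omega>) \<partial>run_space) \<le> 1" using that by (rule nn_integral_chernoff)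
    have int: "integrable run_space (chernoff f)"
      using le by (intro integrableI_nonneg) (auto intro: order_le_less_trans)
    moreover have "(LINT \<omega>|run_space. chernoff f \<omega>) \<le> 1"
      using le nn_integral_eq_integral[OF int] by simp
    ultimately show ?thesis by blast
  qed
  have N: "integrable run_space (chernoff noise_stat)" "(LINT \<omega>|run_space. chernoff noise_stat \<omega>) \<le> 1"
  proof -
    have "0 \<le> noise_stat j i \<and> noise_stat j i \<le> 1" if "j < n" "i < m" "eligible j i" for j i
    proof -
      have "ps ! j / s ! i / (2 * optimum) \<le> 1"
        using eligible_size[OF that] sp[of i] that b by (simp add: divide_simps mult_ac)
      then have "noise_stat j i \<le> 1 powr q"
        unfolding noise_stat_def using q sp[of i] pp[of j] that optimum_pos by (intro powr_mono2) auto
      then show ?thesis by (simp add: noise_stat_def)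
    qed
    then show "integrable run_space (chernoff noise_stat)" "(LINT \<omega>|run_space. chernoff noise_stat \<omega>) \<le> 1"
      using c by blast+
  qed
  have L: "integrable run_space (chernoff (level_stat i k))" "(LINT \<omega>|run_space. chernoff (level_stat i k) \<omega>) \<le> 1"
    if "i < m" for i k
  proof -
    have "0 \<le> level_stat i k j l \<and> level_stat i k j l \<le> 1" if "j < n" for j l
    proof -
      have "0 \<le> 2 ^ k * (ps ! j / s ! i)" using sp[OF \<open>i < m\<close>] pp[OF that] by simp
      moreover have "0 \<le> y / (2 * optimum) \<and> y / (2 * optimum) \<le> 1" if "0 \<le> y" "y \<le> 2 * optimum" for y
        using b that by simp
      ultimately show ?thesis by (simp add: level_stat_def del: times_divide_eq_right)
    qed
    then show "integrable run_space (chernoff (level_stat i k))" "(LINT \<omega>|run_space. chernoff (level_stat i k) \<omega>) \<le> 1"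
      using c by blast+
  qed
  have S: "integrable run_space (\<lambda>\<omega>. \<Sum>i<m. \<Sum>k\<le>m. chernoff (level_stat i k) \<omega>)"
    using L by (intro Bochner_Integration.integrable_sum) auto
  show "integrable run_space potential"
    unfolding potential_def[abs_def] using N S by (intro Bochner_Integration.integrable_add) auto
  have "(LINT \<omega>|run_space. potential \<omega>) =
      1 + (LINT \<omega>|run_space. chernoff noise_stat \<omega>) + (\<Sum>i<m. \<Sum>k\<le>m. LINT \<omega>|run_space. chernoff (level_stat i k) \<omega>)"
  proof -
    have "(LINT \<omega>|run_space. (\<Sum>i<m. \<Sum>k\<le>m. chernoff (level_stat i k) \<omega>)) =
        (\<Sum>i<m. \<Sum>k\<le>m. LINT \<omega>|run_space. chernoff (level_stat i k) \<omega>)"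
      using L by (subst Bochner_Integration.integral_sum) (auto intro!: sum.cong Bochner_Integration.integral_sum Bochner_Integration.integrable_sum)
    then show ?thesis unfolding potential_def using N S R.prob_space by simp
  qed
  also have "\<dots> \<le> 1 + 1 + (\<Sum>i<m. \<Sum>k\<le>m. 1)"
    using N L by (intro add_mono sum_mono) auto
  also have "\<dots> = 2 + real m * (1 + real m)" by simp
  also have "\<dots> \<le> 4 * (real m)\<^sup>2"
  proof -
    have "1 \<le> real m" using m_pos by (simp add: Suc_le_eq)
    then have "1 * real m \<le> real m * real m" by (intro mult_right_mono) auto
    then show ?thesis using \<open>1 \<le> real m\<close> by (simp add: power2_eq_square distrib_left)
  qed
  finally show "(LINT \<omega>|run_space. potential \<omega>) \<le> 4 * (real m)\<^sup>2" .
qed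

end

section \<open>Bounding the objective on every run by the deviation\<close>

lemma powr_add3_le:
  fixes x y z q :: real
  assumes "0 \<le> x" "0 \<le> y" "0 \<le> z" "0 < q"
  shows "(x + y + z) powr q \<le> 3 powr q * (x powr q + y powr q + z powr q)"
proof -
  let ?M = "max x (max y z)"
  have "(x + y + z) powr q \<le> (3 * ?M) powr q" using assms by (intro powr_mono2) auto
  also have "\<dots> = 3 powr q * ?M powr q" by (rule powr_mult)
  also have "?M powr q \<le> x powr q + y powr q + z powr q" by (auto simp: max_def)
  finally show ?thesis by (simp add: mult_left_mono)
qed

context scheduling_instance
begin

definition noise_at :: "(nat \<Rightarrow> seed) \<Rightarrow> nat \<Rightarrow> real" where
  "noise_at \<omega> i = (\<Sum>j<n. if machine_of \<omega> j = i then (ps ! j / s ! i) powr q else 0)"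

lemma noise_at_nonneg: "0 \<le> noise_at \<omega> i"
  unfolding noise_at_def by (intro sum_nonneg) auto

lemma deviation_nonneg: "0 \<le> deviation \<omega>"
  unfolding deviation_def using potential_ge_1 by simp

lemma chernoff_le_deviation:
  assumes "chernoff f \<omega> \<le> potential \<omega>"
  shows "(\<Sum>j<n. f j (machine_of \<omega> j)) \<le> 2 * (\<Sum>j<n. \<Sum>i<m. assigned_share j i * f j i) + deviation \<omega>"
proof -
  have "0 < potential \<omega>" using potential_ge_1[of \<omega>] by linarith
  then have "(\<Sum>j<n. f j (machine_of \<omega> j)) - 2 * (\<Sum>j<n. \<Sum>i<m. assigned_share j i * f j i) \<le> deviation \<omega>"
    using assms unfolding deviation_def chernoff_def by (simp add: ln_ge_iff)
  then show ?thesis by simp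
qed

lemma total_noise_le:
  "(\<Sum>i<m. noise_at \<omega> i) \<le> 2 * mean_noise + deviation \<omega> * (2 * optimum) powr q"
proof -
  let ?b = "(2 * optimum) powr q"
  have b: "0 < ?b" using optimum_pos by simp
  have f: "noise_stat j i = (ps ! j / s ! i) powr q / ?b" for j i
    unfolding noise_stat_def by (rule powr_divide)
  have "(\<Sum>i<m. noise_at \<omega> i) = (\<Sum>j<n. \<Sum>i<m. if machine_of \<omega> j = i then (ps ! j / s ! i) powr q else 0)"
    unfolding noise_at_def by (rule sum.swap)
  also have "\<dots> = (\<Sum>j<n. (ps ! j / s ! machine_of \<omega> j) powr q)"
    using machine_of_less by (intro sum.cong refl) simp
  also have "\<dots> = ?b * (\<Sum>j<n. noise_stat j (machine_of \<omega> j))"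
    using b by (simp add: f flip: sum_divide_distrib)
  also have "\<dots> \<le> ?b * (2 * (\<Sum>j<n. \<Sum>i<m. assigned_share j i * noise_stat j i) + deviation \<omega>)"
    using b by (intro mult_left_mono chernoff_le_deviation potential_ge) auto
  also have "(\<Sum>j<n. \<Sum>i<m. assigned_share j i * noise_stat j i) = mean_noise / ?b"
    by (simp add: f mean_noise_def sum_divide_distrib)
  also have "?b * (2 * (mean_noise / ?b) + deviation \<omega>) = 2 * mean_noise + deviation \<omega> * ?b"
    using b by (simp add: field_simps)
  finally show ?thesis .
qed

text \<open>If all jobs received by machine \<open>i\<close> lie below scale \<open>k\<close>, the
  truncation in \<open>level_stat\<close> is inactive on this run and the statistic is the rescaled
  completion time. Its mean is at most the rescaled full mean.\<close>

lemma completion_level: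
  assumes i: "i < m" and k: "k \<le> m"
    and small: "\<And>j. j < n \<Longrightarrow> machine_of \<omega> j = i \<Longrightarrow> 2 ^ k * (ps ! j / s ! i) \<le> 2 * optimum"
  shows "completion \<omega> i \<le> 2 * mean_completion i + deviation \<omega> * (2 * optimum / 2 ^ k)"
proof -
  let ?c = "2 ^ k / (2 * optimum)"
  have c: "0 < ?c" using optimum_pos by simp
  have "?c * completion \<omega> i = (\<Sum>j<n. level_stat i k j (machine_of \<omega> j))"
    unfolding completion_def sum_distrib_left
    using small by (intro sum.cong refl) (auto simp: level_stat_def)
  also have "\<dots> \<le> 2 * (\<Sum>j<n. \<Sum>l<m. assigned_share j l * level_stat i k j l) + deviation \<omega>"
    by (intro chernoff_le_deviation potential_ge i k)
  also have "(\<Sum>j<n. \<Sum>l<m. assigned_share j l * level_stat i k j l) \<le> ?c * mean_completion i"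
    unfolding mean_completion_def sum_distrib_left
  proof (rule sum_mono)
    fix j assume j: "j \<in> {..<n}"
    have "(\<Sum>l<m. assigned_share j l * level_stat i k j l) = (\<Sum>l<m. if l = i then assigned_share j i * level_stat i k j i else 0)"
      by (intro sum.cong refl) (auto simp: level_stat_def)
    also have "\<dots> = assigned_share j i * level_stat i k j i" using i by simp
    also have "\<dots> \<le> assigned_share j i * (?c * (ps ! j / s ! i))"
    proof (rule mult_left_mono)
      have "0 \<le> ?c * (ps ! j / s ! i)" using optimum_pos sp[OF i] pp[of j] j by simp
      moreover have "?c * (ps ! j / s ! i) = 2 ^ k * (ps ! j / s ! i) / (2 * optimum)" by simp
      ultimately show "level_stat i k j i \<le> ?c * (ps ! j / s ! i)"
        by (simp only: level_stat_def) (simp split: if_split)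
    qed (simp add: assigned_share_def share_nonneg)
    finally show "(\<Sum>l<m. assigned_share j l * level_stat i k j l) \<le> ?c * (assigned_share j i * (ps ! j / s ! i))"
      by (simp only: mult_ac)
  qed
  finally have "?c * completion \<omega> i \<le> 2 * (?c * mean_completion i) + deviation \<omega>" by simp
  then have "2 * optimum / 2 ^ k * (?c * completion \<omega> i) \<le>
      2 * optimum / 2 ^ k * (2 * (?c * mean_completion i) + deviation \<omega>)"
    using optimum_pos by (intro mult_left_mono) auto
  moreover have "2 * optimum / 2 ^ k * (?c * y) = y" for y using optimum_pos by simp
  ultimately show ?thesis by (simp only: distrib_left mult.left_commute[of _ 2]) (simp only: mult.commute)
qed

text \<open>
  A machine exceeds twice its mean by at most the deviation times the scale of its largest job:
  this self-normalisation is what keeps the sum over all machines small.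
\<close>

lemma completion_le:
  assumes i: "i < m"
  shows "completion \<omega> i \<le> 2 * mean_completion i + 2 * deviation \<omega> * noise_at \<omega> i powr (1 / q)
    + deviation \<omega> * (2 * optimum / 2 ^ m)"
proof -
  let ?D = "deviation \<omega>" and ?b = "2 * optimum"
  let ?P = "\<lambda>k. \<forall>j<n. machine_of \<omega> j = i \<longrightarrow> 2 ^ k * (ps ! j / s ! i) \<le> ?b"
  have nn: "0 \<le> 2 * ?D * noise_at \<omega> i powr (1 / q)" "0 \<le> ?D * (?b / 2 ^ m)"
    using deviation_nonneg optimum_pos by simp_all
  show ?thesis
  proof (cases "?P m")
    case True
    then have "completion \<omega> i \<le> 2 * mean_completion i + ?D * (?b / 2 ^ m)"
      using i by (intro completion_level) auto
    then show ?thesis using nn by linarith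
  next
    case False
    \<comment> \<open>Scale 0 always holds, as jobs sit on eligible machines on every seed.\<close>
    have P0: "?P 0"
      using eligible_size[OF _ i] eligible_machine_of sp[OF i] by (auto simp: divide_le_eq)
    \<comment> \<open>The scale of the largest job on the machine: scale \<open>k\<close> holds and
      scale \<open>k + 1\<close> fails, so some job there has time above
      \<open>optimum / 2 ^ k\<close>.\<close>
    obtain k where k: "k < m" "?P k" "\<not> ?P (Suc k)"
      using ex_least_nat_less[of "\<lambda>k. \<not> ?P k" m] P0 False by auto
    then obtain j where j: "j < n" "machine_of \<omega> j = i" "?b < 2 ^ Suc k * (ps ! j / s ! i)"
      by (auto simp: not_le)
    let ?x = "ps ! j / s ! i"
    have x: "0 < ?x" using sp[OF i] pp[OF j(1)] by simp
    have "?x powr q \<le> noise_at \<omega> i" unfolding noise_at_def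
      using j member_le_sum[of j "{..<n}" "\<lambda>j. if machine_of \<omega> j = i then (ps ! j / s ! i) powr q else 0"]
      by simp
    then have "(?x powr q) powr (1 / q) \<le> noise_at \<omega> i powr (1 / q)" using q by (intro powr_mono2) auto
    moreover have "(y powr q) powr (1 / q) = y" if "0 < y" for y
      using that q by (simp add: powr_powr)
    note this[OF x]
    ultimately have "?x \<le> noise_at \<omega> i powr (1 / q)" by simp
    moreover have "?b / 2 ^ k \<le> 2 * ?x" using j(3) by (simp add: divide_le_eq mult_ac)
    ultimately have "?b / 2 ^ k \<le> 2 * noise_at \<omega> i powr (1 / q)" by linarith
    then have "?D * (?b / 2 ^ k) \<le> ?D * (2 * noise_at \<omega> i powr (1 / q))"
      using deviation_nonneg by (rule mult_left_mono)
    moreover have "completion \<omega> i \<le> 2 * mean_completion i + ?D * (?b / 2 ^ k)"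
      using i k by (intro completion_level) auto
    ultimately show ?thesis using nn by (simp add: mult_ac)
  qed
qed

text \<open>The three parts of \<open>completion_le\<close> are summed in \<open>q\<close>-th
  powers. Taking the power \<open>q\<close> of the root of the noise makes it additive over the
  machines.\<close>

lemma objective_le_norms:
  "objective q s (run (mech a 1) s ps \<omega>) \<le>
     3 * (2 * (\<Sum>i<m. mean_completion i powr q) powr (1 / q)
       + 2 * deviation \<omega> * (\<Sum>i<m. noise_at \<omega> i) powr (1 / q) + deviation \<omega> * (2 * optimum))"
proof -
  let ?D = "deviation \<omega>" and ?b = "2 * optimum"
  let ?A = "\<Sum>i<m. mean_completion i powr q" and ?Y = "\<Sum>i<m. noise_at \<omega> i"
  have D: "0 \<le> ?D" by (rule deviation_nonneg)
  have b: "0 < ?b" using optimum_pos by simp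
  have Y0: "0 \<le> ?Y" by (intro sum_nonneg noise_at_nonneg)
  have A0: "0 \<le> ?A" by (intro sum_nonneg) auto
  have root: "(x powr q * y) powr (1 / q) = x * y powr (1 / q)" if "0 \<le> x" for x y :: real
    using q that by (simp only: powr_mult powr_powr) simp
  have "(\<Sum>i<m. completion \<omega> i powr q) \<le>
      (\<Sum>i<m. 3 powr q * (2 powr q * mean_completion i powr q + (2 * ?D) powr q * noise_at \<omega> i + (?D * (?b / 2 ^ m)) powr q))"
  proof (rule sum_mono)
    fix i assume "i \<in> {..<m}"
    then have i: "i < m" by simp
    have M: "0 \<le> mean_completion i" by (rule mean_completion_nonneg[OF i])
    have "completion \<omega> i powr q \<le> (2 * mean_completion i + 2 * ?D * noise_at \<omega> i powr (1 / q) + ?D * (?b / 2 ^ m)) powr q"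
      using completion_nonneg[OF i] completion_le[OF i] q by (intro powr_mono2) auto
    also have "\<dots> \<le> 3 powr q * ((2 * mean_completion i) powr q + (2 * ?D * noise_at \<omega> i powr (1 / q)) powr q + (?D * (?b / 2 ^ m)) powr q)"
      using M D b q by (intro powr_add3_le) auto
    also have "(2 * mean_completion i) powr q = 2 powr q * mean_completion i powr q" by (rule powr_mult)
    also have "(2 * ?D * noise_at \<omega> i powr (1 / q)) powr q = (2 * ?D) powr q * noise_at \<omega> i"
      using q noise_at_nonneg by (simp only: powr_mult powr_powr) simp
    finally show "completion \<omega> i powr q \<le> 3 powr q * (2 powr q * mean_completion i powr q + (2 * ?D) powr q * noise_at \<omega> i + (?D * (?b / 2 ^ m)) powr q)" .
  qed
  also have "\<dots> = 3 powr q * (2 powr q * ?A + (2 * ?D) powr q * ?Y + real m * (?D * (?b / 2 ^ m)) powr q)"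
    by (simp add: sum.distrib sum_distrib_left[symmetric])
  also have "\<dots> \<le> 3 powr q * (2 powr q * ?A + (2 * ?D) powr q * ?Y + (?D * ?b) powr q)"
  proof -
    \<comment> \<open>This fixes the finest scale: the \<open>m\<close> leftover errors at scale
      \<open>2 ^ m\<close> together count no more than one error at scale 1.\<close>
    have "real m \<le> 2 ^ m" using less_exp[of m] by (metis less_imp_le of_nat_le_iff of_nat_numeral of_nat_power)
    also have "(2 :: real) ^ m = (2 ^ m) powr 1" by simp
    also have "\<dots> \<le> (2 ^ m) powr q" using q by (intro powr_mono) auto
    finally have "real m * (?D * (?b / 2 ^ m)) powr q \<le> (2 ^ m) powr q * (?D * (?b / 2 ^ m)) powr q"
      by (intro mult_right_mono) auto
    also have "\<dots> = (?D * ?b) powr q" by (simp flip: powr_mult)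
    finally show ?thesis by (intro mult_left_mono add_left_mono) auto
  qed
  finally have "(\<Sum>i<m. completion \<omega> i powr q) powr (1 / q) \<le>
      (3 powr q * (2 powr q * ?A + (2 * ?D) powr q * ?Y + (?D * ?b) powr q)) powr (1 / q)"
    using q by (intro powr_mono2 sum_nonneg) auto
  also have "\<dots> = 3 * (2 powr q * ?A + (2 * ?D) powr q * ?Y + (?D * ?b) powr q) powr (1 / q)"
    by (rule root) simp
  also have "\<dots> \<le> 3 * ((2 powr q * ?A) powr (1 / q) + ((2 * ?D) powr q * ?Y) powr (1 / q) + ((?D * ?b) powr q) powr (1 / q))"
  proof -
    have "(2 powr q * ?A + (2 * ?D) powr q * ?Y + (?D * ?b) powr q) powr (1 / q) \<le>
        (2 powr q * ?A + (2 * ?D) powr q * ?Y) powr (1 / q) + ((?D * ?b) powr q) powr (1 / q)"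
      using A0 Y0 q by (intro powr_add_le) auto
    also have "(2 powr q * ?A + (2 * ?D) powr q * ?Y) powr (1 / q) \<le>
        (2 powr q * ?A) powr (1 / q) + ((2 * ?D) powr q * ?Y) powr (1 / q)"
      using A0 Y0 q by (intro powr_add_le) auto
    finally show ?thesis by simp
  qed
  also have "\<dots> = 3 * (2 * ?A powr (1 / q) + 2 * ?D * ?Y powr (1 / q) + ?D * ?b)"
    using root[of 2 ?A] root[of "2 * ?D" ?Y] root[of "?D * ?b" 1] D b by simp
  finally show ?thesis by (simp add: objective_run)
qed

definition noise_factor :: real where
  "noise_factor = (2 * mean_factor) powr (1 / q)"

lemma objective_le:
  defines "L \<equiv> 1 + ln (real m)"
  shows "objective q s (run (mech a 1) s ps \<omega>) \<le> optimum *
    (6 * mean_factor * L powr (1 / q)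
     + (12 * noise_factor * (real m powr (1 / q * (1 - 1 / q)) * L powr (1 / q\<^sup>2)) + 18) * deviation \<omega>
     + 12 * (deviation \<omega>)\<^sup>2)"
proof -
  let ?D = "deviation \<omega>" and ?b = "2 * optimum" and ?K = mean_factor
  let ?A = "\<Sum>i<m. mean_completion i powr q" and ?Y = "\<Sum>i<m. noise_at \<omega> i"
  let ?N = "noise_factor * (real m powr (1 / q * (1 - 1 / q)) * L powr (1 / q\<^sup>2))"
  have D: "0 \<le> ?D" by (rule deviation_nonneg)
  have b: "0 < ?b" using optimum_pos by simp
  have L: "1 \<le> L" using m_pos by (simp add: L_def Suc_le_eq)
  have ar: "1 / a = 1 - 1 / q" using conj by simp
  have "?A powr (1 / q) \<le> ((?K * optimum) powr q * L) powr (1 / q)"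
    using mean_norm q unfolding L_def by (intro powr_mono2 sum_nonneg) auto
  also have "\<dots> = ?K * optimum * L powr (1 / q)"
    using q mean_factor_nonneg optimum_pos by (simp only: powr_mult powr_powr) simp
  finally have A: "?A powr (1 / q) \<le> ?K * optimum * L powr (1 / q)" .
  have N0: "0 \<le> mean_noise" unfolding mean_noise_def
    by (intro sum_nonneg mult_nonneg_nonneg) (auto simp: assigned_share_def share_nonneg)
  have "?Y powr (1 / q) \<le> (2 * mean_noise + ?D * ?b powr q) powr (1 / q)"
    using total_noise_le q by (intro powr_mono2 sum_nonneg noise_at_nonneg) auto
  also have "\<dots> \<le> (2 * mean_noise) powr (1 / q) + (?D * ?b powr q) powr (1 / q)"
    using N0 D q by (intro powr_add_le) auto
  also have "(2 * mean_noise) powr (1 / q) \<le>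
      (?b powr q * (2 * ?K * (real m powr (1 / a) * L powr (1 / q)))) powr (1 / q)"
    using mean_noise_le N0 q unfolding L_def by (intro powr_mono2) (auto simp: mult_ac)
  also have "\<dots> = ?b * ?N"
    using q b by (simp only: powr_mult powr_powr ar noise_factor_def) (simp add: power2_eq_square mult_ac)
  also have "(?D * ?b powr q) powr (1 / q) = ?D powr (1 / q) * ?b"
    using q b by (simp only: powr_mult powr_powr) simp
  \<comment> \<open>The fractional power is relaxed so that the final bound is quadratic in the
    deviation, whose first and second moments are available.\<close>
  also have "?D powr (1 / q) * ?b \<le> (1 + ?D) * ?b"
  proof -
    have "?D powr (1 / q) \<le> (1 + ?D) powr (1 / q)" using D q by (intro powr_mono2) auto
    also have "\<dots> \<le> (1 + ?D) powr 1" using D q by (intro powr_mono) auto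
    finally show ?thesis using b D by (intro mult_right_mono) auto
  qed
  finally have Y: "?Y powr (1 / q) \<le> ?b * (?N + 1 + ?D)" by (simp add: algebra_simps)
  have "objective q s (run (mech a 1) s ps \<omega>) \<le>
      3 * (2 * ?A powr (1 / q) + 2 * ?D * ?Y powr (1 / q) + ?D * ?b)"
    by (rule objective_le_norms)
  also have "\<dots> \<le> 3 * (2 * (?K * optimum * L powr (1 / q)) + 2 * ?D * (?b * (?N + 1 + ?D)) + ?D * ?b)"
    using A Y D by (intro mult_left_mono add_mono) auto
  also have "\<dots> = optimum * (6 * ?K * L powr (1 / q) + (12 * ?N + 18) * ?D + 12 * ?D\<^sup>2)"
    by (simp add: algebra_simps power2_eq_square)
  finally show ?thesis by (simp add: mult_ac)
qed

end

section \<open>Competitive ratio\<close>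

text \<open>The summand 1 keeps the logarithmic factor positive at \<open>m = 1\<close>. The
  separate square comes from the quadratic term in the deviation.\<close>

definition ratio_bound :: "real \<Rightarrow> nat \<Rightarrow> real" where
  "ratio_bound q m = real m powr (1 / q * (1 - 1 / q)) * (1 + ln (real m)) powr (1 + 1 / q\<^sup>2) + (1 + ln (real m))\<^sup>2"

text \<open>For \<open>q > 1\<close> the exponent of \<open>m\<close> is positive, so the surplus
  logarithm in the square is absorbed by the power of \<open>m\<close>. From \<open>m = 3\<close> on
  the logarithm is at least 1.\<close>

lemma ratio_bound_bigo:
  assumes q: "1 < q"
  shows "(\<lambda>m. C * ratio_bound q m) \<in>
    O(\<lambda>m. real m powr ((1 / q) * (1 - 1 / q)) * ln (real m) powr (1 + 1 / q\<^sup>2))"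
proof -
  define e where "e = 1 / q * (1 - 1 / q)"
  define r where "r = 1 + 1 / q\<^sup>2"
  have e: "0 < e" using q by (simp add: e_def)
  have "1 / q\<^sup>2 \<le> 1" using q by (simp add: divide_le_eq power2_eq_square) (simp add: mult_ge1_I)
  then have r: "1 \<le> r" "r \<le> 2" by (auto simp: r_def)
  have "ratio_bound q \<in> O(\<lambda>m. real m powr e * ln (real m) powr r)"
  proof (rule bigoI)
    show "\<forall>\<^sub>F m in sequentially. norm (ratio_bound q m) \<le>
        (2 powr r + 4 / e) * norm (real m powr e * ln (real m) powr r)"
    proof (rule eventually_sequentiallyI[of 3])
      fix m :: nat assume m: "3 \<le> m"
      have "exp 1 \<le> (3 :: real)" by (rule exp_le)
      then have "exp 1 \<le> real m" using m by linarith
      then have l: "1 \<le> ln (real m)" using m by (simp add: ln_ge_iff)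
      let ?l = "ln (real m)" and ?M = "real m powr e"
      have M: "1 \<le> ?M" using m e by (intro ge_one_powr_ge_zero) auto
      have "(1 + ?l) powr r \<le> (2 * ?l) powr r" using l r by (intro powr_mono2) auto
      also have "\<dots> = 2 powr r * ?l powr r" by (rule powr_mult)
      finally have "?M * (1 + ?l) powr r \<le> ?M * (2 powr r * ?l powr r)"
        using M by (intro mult_left_mono) auto
      then have 1: "?M * (1 + ?l) powr r \<le> 2 powr r * (?M * ?l powr r)"
        by (simp only: mult.left_commute)
      have "(1 + ?l)\<^sup>2 \<le> (2 * ?l)\<^sup>2" using l by (intro power_mono) auto
      also have "\<dots> = 4 * (?l powr r * ?l powr (2 - r))"
        using l by (simp add: power_mult_distrib flip: powr_add)
      also have "\<dots> \<le> 4 * (?l powr r * ?l powr 1)"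
        using l r by (intro mult_left_mono powr_mono) auto
      also have "\<dots> \<le> 4 * (?l powr r * (?M / e))"
        using l m e ln_powr_bound[of "real m" e] by (intro mult_left_mono) auto
      finally have 2: "(1 + ?l)\<^sup>2 \<le> 4 / e * (?M * ?l powr r)" by (simp add: field_simps)
      have "ratio_bound q m = ?M * (1 + ?l) powr r + (1 + ?l)\<^sup>2"
        by (simp add: ratio_bound_def e_def r_def)
      also have "\<dots> \<le> (2 powr r + 4 / e) * (?M * ?l powr r)"
        using 1 2 by (simp add: distrib_right)
      finally show "norm (ratio_bound q m) \<le> (2 powr r + 4 / e) * norm (?M * ?l powr r)"
        using l by (simp add: ratio_bound_def add_nonneg_nonneg)
    qed
  qed
  then show ?thesis unfolding e_def r_def by simp
qed

lemma objective_Nil: "objective q s [] = 0"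
  by (simp add: objective_def lq_norm_def load_def)

lemma run_Nil: "run M s [] \<omega> = []"
  by (simp add: run_def)

lemma opt_Nil: "s \<noteq> [] \<Longrightarrow> opt q s [] = 0"
  by (erule opt_attained[of s "[]" q]) (simp add: objective_Nil)

context scheduling_instance
begin

definition whp_factor :: "real \<Rightarrow> real" where
  "whp_factor t = 6 * mean_factor + 12 * noise_factor * t + 18 * t + 12 * t\<^sup>2"

lemma noise_factor_nonneg: "0 \<le> noise_factor"
  by (simp add: noise_factor_def)

lemma log_terms:
  defines "L \<equiv> 1 + ln (real m)" and "M \<equiv> real m powr (1 / q * (1 - 1 / q))"
  shows "1 \<le> L" "1 \<le> M" "L powr (1 / q) \<le> ratio_bound q m" "M * L powr (1 / q\<^sup>2) * L \<le> ratio_bound q m"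
    "L \<le> ratio_bound q m" "L\<^sup>2 \<le> ratio_bound q m"
proof -
  show L: "1 \<le> L" using m_pos by (simp add: L_def Suc_le_eq)
  show M: "1 \<le> M" unfolding M_def using m_pos q by (intro ge_one_powr_ge_zero) (auto simp: Suc_le_eq)
  have R: "ratio_bound q m = M * L powr (1 + 1 / q\<^sup>2) + L\<^sup>2" by (simp add: ratio_bound_def L_def M_def)
  have "0 \<le> M * L powr (1 + 1 / q\<^sup>2)" using M by simp
  then show sq: "L\<^sup>2 \<le> ratio_bound q m" unfolding R by simp
  have "L * 1 \<le> L * L" using L by (intro mult_left_mono) auto
  then show LR: "L \<le> ratio_bound q m" using sq by (simp add: power2_eq_square)
  have "L powr (1 / q) \<le> L powr 1" using L q by (intro powr_mono) auto
  then show "L powr (1 / q) \<le> ratio_bound q m" using LR L by simp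
  have eq: "M * L powr (1 / q\<^sup>2) * L = M * L powr (1 + 1 / q\<^sup>2)" using L by (simp add: powr_add)
  show "M * L powr (1 / q\<^sup>2) * L \<le> ratio_bound q m" unfolding R eq by simp
qed

text \<open>\<open>D\<close> and \<open>E\<close> stand for bounds on the deviation and on its
  square, or for their averages; the same arithmetic then serves expectation and
  probability.\<close>

lemma objective_le_averages:
  assumes D: "0 \<le> D" "D \<le> t * (1 + ln (real m))" "E \<le> (t * (1 + ln (real m)))\<^sup>2"
  shows "6 * mean_factor * (1 + ln (real m)) powr (1 / q)
     + (12 * noise_factor * (real m powr (1 / q * (1 - 1 / q)) * (1 + ln (real m)) powr (1 / q\<^sup>2)) + 18) * D
     + 12 * E \<le> whp_factor t * ratio_bound q m"
proof -
  let ?L = "1 + ln (real m)" and ?M = "real m powr (1 / q * (1 - 1 / q))" and ?B = "ratio_bound q m"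
  note lt = log_terms
  have t: "0 \<le> t" using D(1,2) lt(1) by (smt (verit) mult_neg_pos)
  have "6 * mean_factor * ?L powr (1 / q) \<le> 6 * mean_factor * ?B"
    using lt(3) mean_factor_nonneg by (intro mult_left_mono) auto
  moreover have "(12 * noise_factor * (?M * ?L powr (1 / q\<^sup>2)) + 18) * D \<le> 12 * noise_factor * t * ?B + 18 * t * ?B"
  proof -
    have "(12 * noise_factor * (?M * ?L powr (1 / q\<^sup>2)) + 18) * D \<le>
        (12 * noise_factor * (?M * ?L powr (1 / q\<^sup>2)) + 18) * (t * ?L)"
      using D noise_factor_nonneg by (intro mult_left_mono) auto
    also have "\<dots> = 12 * noise_factor * t * (?M * ?L powr (1 / q\<^sup>2) * ?L) + 18 * t * ?L"
      by (simp add: algebra_simps)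
    also have "\<dots> \<le> 12 * noise_factor * t * ?B + 18 * t * ?B"
      using lt(4,5) t noise_factor_nonneg by (intro add_mono mult_left_mono) auto
    finally show ?thesis .
  qed
  moreover have "12 * E \<le> 12 * t\<^sup>2 * ?B"
  proof -
    have "E \<le> t\<^sup>2 * ?L\<^sup>2" using D(3) by (simp add: power_mult_distrib)
    also have "\<dots> \<le> t\<^sup>2 * ?B" using lt(6) by (intro mult_left_mono) auto
    finally show ?thesis by simp
  qed
  ultimately show ?thesis by (simp add: whp_factor_def algebra_simps)
qed

text \<open>With \<open>K\<close> bounding the mean of the potential, the deviation and its square
  are bounded pointwise by affine functions of \<open>potential \<omega> / K\<close>, a variable of
  mean at most 1. The squared logarithm is not concave throughout, so Jensen's inequality does not
  apply to it directly.\<close>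

lemma expected_objective_le:
  "(LINT \<omega>|run_space. objective q s (run (mech a 1) s ps \<omega>)) \<le> whp_factor 4 * ratio_bound q m * opt q s ps"
proof -
  interpret R: prob_space run_space by (rule prob_space_run_space)
  let ?L = "1 + ln (real m)" and ?M = "real m powr (1 / q * (1 - 1 / q))"
  define c0 where "c0 = 6 * mean_factor * ?L powr (1 / q)"
  define c1 where "c1 = 12 * noise_factor * (?M * ?L powr (1 / q\<^sup>2)) + 18"
  define K where "K = 4 * (real m)\<^sup>2"
  define t where "t = ln K"
  have m1: "1 \<le> real m" using m_pos by (simp add: Suc_le_eq)
  have "1 \<le> (real m)\<^sup>2" using m1 by simp
  then have K: "1 \<le> K" by (simp add: K_def)
  have c: "0 \<le> c0" "0 \<le> c1" using mean_factor_nonneg noise_factor_nonneg by (auto simp: c0_def c1_def)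
  have t0: "0 \<le> t" using K by (simp add: t_def)
  have "ln (4 :: real) = 2 * ln 2" using ln_realpow[of "2 :: real" 2] by simp
  then have t2: "t \<le> 2 * ?L"
    using m1 ln_2_less_1 by (simp add: t_def K_def ln_mult ln_realpow)
  let ?D = deviation
  have D1: "?D \<omega> \<le> t + potential \<omega> / K" and D2: "(?D \<omega>)\<^sup>2 \<le> 2 * t\<^sup>2 + 8 * (potential \<omega> / K)" for \<omega>
  proof -
    let ?y = "potential \<omega> / K"
    have y: "0 < ?y" using potential_ge_1[of \<omega>] K by simp
    have Dy: "?D \<omega> = t + ln ?y"
      using potential_ge_1[of \<omega>] K by (simp add: deviation_def t_def ln_div)
    then show "?D \<omega> \<le> t + ?y" using ln_bound[of ?y] y by simp
    show "(?D \<omega>)\<^sup>2 \<le> 2 * t\<^sup>2 + 8 * ?y"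
    proof (cases "1 \<le> ?y")
      case True
      have "(t + ln ?y)\<^sup>2 \<le> 2 * t\<^sup>2 + 2 * (ln ?y)\<^sup>2"
        using sum_squares_bound[of t "ln ?y"] by (simp add: power2_sum)
      then show ?thesis using Dy ln_square_le[OF True] by simp
    next
      \<comment> \<open>Here \<open>ln ?y\<close> is negative, so the nonnegative deviation lies
        below \<open>t\<close>.\<close>
      case False
      then have "?D \<omega> \<le> t" using Dy y by simp
      then have "(?D \<omega>)\<^sup>2 \<le> t\<^sup>2" using deviation_nonneg by (intro power_mono) auto
      then show ?thesis using y zero_le_power2[of t] by linarith
    qed
  qed
  let ?f = "\<lambda>\<omega>. optimum * (c0 + c1 * (t + potential \<omega> / K) + 12 * (2 * t\<^sup>2 + 8 * (potential \<omega> / K)))"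
  have le: "objective q s (run (mech a 1) s ps \<omega>) \<le> ?f \<omega>" for \<omega>
  proof -
    have "objective q s (run (mech a 1) s ps \<omega>) \<le> optimum * (c0 + c1 * ?D \<omega> + 12 * (?D \<omega>)\<^sup>2)"
      unfolding c0_def c1_def by (rule objective_le)
    also have "\<dots> \<le> ?f \<omega>"
      using D1 D2 c optimum_pos by (intro mult_left_mono add_mono) auto
    finally show ?thesis .
  qed
  have pos: "0 \<le> objective q s (run (mech a 1) s ps \<omega>)" for \<omega> by (simp add: objective_def lq_norm_def)
  define A where "A = optimum * (c0 + c1 * t + 24 * t\<^sup>2)"
  define B where "B = optimum * (c1 + 96) / K"
  have f: "?f \<omega> = A + B * potential \<omega>" for \<omega>
    using K by (simp add: A_def B_def divide_simps) (simp add: algebra_simps)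
  have B: "0 \<le> B" using optimum_pos c K by (simp add: B_def)
  have "(LINT \<omega>|run_space. objective q s (run (mech a 1) s ps \<omega>)) \<le> (LINT \<omega>|run_space. A + B * potential \<omega>)"
  proof (rule integral_mono')
    show "integrable run_space (\<lambda>\<omega>. A + B * potential \<omega>)" using potential_integral(1) by simp
    show "objective q s (run (mech a 1) s ps \<omega>) \<le> A + B * potential \<omega>" for \<omega>
      using le[of \<omega>] by (simp only: f)
    then show "0 \<le> A + B * potential \<omega>" for \<omega> using pos[of \<omega>] order_trans by blast
  qed
  also have "\<dots> = A + B * (LINT \<omega>|run_space. potential \<omega>)"
    using potential_integral(1) R.prob_space by simp
  also have "\<dots> \<le> A + B * K" using potential_integral(2) B by (intro add_left_mono mult_left_mono) (auto simp: K_def)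
  also have "\<dots> = optimum * (c0 + c1 * (t + 1) + 12 * (2 * t\<^sup>2 + 8 * 1))"
  proof -
    have "B * K = optimum * (c1 + 96)" using K by (simp add: B_def)
    then show ?thesis by (simp add: A_def algebra_simps)
  qed
  also have "\<dots> \<le> optimum * (whp_factor 4 * ratio_bound q m)"
  proof (rule mult_left_mono)
    have L: "1 \<le> ?L" by (rule log_terms)
    have "t\<^sup>2 \<le> (2 * ?L)\<^sup>2" using t0 t2 by (intro power_mono) auto
    moreover have "1 \<le> ?L\<^sup>2" using L by simp
    \<comment> \<open>The argument 4 of \<open>whp_factor\<close>: from
      \<open>t \<le> 2 * ?L\<close> one gets \<open>t + 1 \<le> 4 * ?L\<close>, and
      \<open>2 * t\<^sup>2 + 8\<close> is at most \<open>16 * ?L\<^sup>2\<close>.\<close>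
    ultimately have "2 * t\<^sup>2 + 8 * 1 \<le> (4 * ?L)\<^sup>2" by (simp only: power_mult_distrib) simp
    then show "c0 + c1 * (t + 1) + 12 * (2 * t\<^sup>2 + 8 * 1) \<le> whp_factor 4 * ratio_bound q m"
      unfolding c0_def c1_def using t0 t2 L by (intro objective_le_averages) auto
  qed (use optimum_pos in simp)
  finally show ?thesis by (simp add: optimum_def mult_ac)
qed

text \<open>Markov's inequality for the potential at \<open>m powr c\<close> times the bound on its
  mean. Taking logarithms, the deviation is at most \<open>(c + 2) * ?L\<close> off the exceptional
  event, and there the bound on the objective holds pathwise.\<close>

lemma prob_objective_le:
  assumes c: "0 < c"
  shows "1 - real m powr (- c) \<le>
    \<P>(\<omega> in run_space. objective q s (run (mech a 1) s ps \<omega>) \<le> whp_factor (c + 2) * ratio_bound q m * opt q s ps)"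
proof -
  interpret R: prob_space run_space by (rule prob_space_run_space)
  let ?L = "1 + ln (real m)"
  let ?T = "4 * (real m)\<^sup>2 * real m powr c"
  have m1: "1 \<le> real m" using m_pos by (simp add: Suc_le_eq)
  then have m0: "0 < real m" by linarith
  then have T: "0 < ?T" by simp
  have "ln (4 :: real) = 2 * ln 2" using ln_realpow[of "2 :: real" 2] by simp
  then have lnT: "ln ?T \<le> (c + 2) * ?L"
    using m1 c ln_2_less_1 by (simp add: ln_mult ln_realpow ln_powr algebra_simps)
  let ?good = "\<lambda>\<omega>. objective q s (run (mech a 1) s ps \<omega>) \<le> whp_factor (c + 2) * ratio_bound q m * opt q s ps"
  have good: "?good \<omega>" if "potential \<omega> < ?T" for \<omega>
  proof -
    have "deviation \<omega> \<le> ln ?T" unfolding deviation_def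
      using that potential_ge_1[of \<omega>] T by (subst ln_le_cancel_iff) auto
    then have D: "deviation \<omega> \<le> (c + 2) * ?L" using lnT by simp
    have "objective q s (run (mech a 1) s ps \<omega>) \<le> optimum * (whp_factor (c + 2) * ratio_bound q m)"
      by (rule order_trans[OF objective_le], rule mult_left_mono, rule objective_le_averages)
        (use D deviation_nonneg optimum_pos in \<open>auto intro: power_mono\<close>)
    then show ?thesis by (simp add: optimum_def mult_ac)
  qed
  have "R.prob {\<omega> \<in> space run_space. ?T \<le> potential \<omega>} \<le> (LINT \<omega>|run_space. potential \<omega>) / ?T"
    using T potential_integral(1) potential_ge_1
    by (intro integral_Markov_inequality_measure[where A="space run_space"])
      (auto intro!: AE_I2 order_trans[OF zero_le_one])
  also have "\<dots> \<le> 4 * (real m)\<^sup>2 / ?T" using potential_integral(2) T by (intro divide_right_mono) auto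
  also have "\<dots> = real m powr (- c)"
  proof -
    have "x / (x * y) = inverse y" if "x \<noteq> 0" for x y :: real
      using that by (simp add: divide_inverse)
    from this[of "4 * (real m)\<^sup>2"] show ?thesis using m0 by (simp add: powr_minus)
  qed
  finally have "1 - real m powr (- c) \<le> 1 - R.prob {\<omega> \<in> space run_space. ?T \<le> potential \<omega>}" by simp
  also have "\<dots> = R.prob {\<omega> \<in> space run_space. \<not> ?T \<le> potential \<omega>}"
    by (subst R.prob_neg) auto
  also have "\<dots> \<le> R.prob {\<omega> \<in> space run_space. ?good \<omega>}"
    using good by (intro R.finite_measure_mono) (auto simp: not_le)
  finally show ?thesis .
qed

end

section \<open>The case of exponent 1\<close>

lemma objective_1:
  assumes "\<And>x. x \<in> set h \<Longrightarrow> 0 \<le> fst x \<and> snd x < length s" and s: "valid_speeds s"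
  shows "objective 1 s h = (\<Sum>x\<leftarrow>h. fst x / s ! snd x)"
proof -
  have "(\<Sum>i<length s. load h i / s ! i) = (\<Sum>x\<leftarrow>h. fst x / s ! snd x)"
    using assms(1)
  proof (induction h)
    case (Cons x h)
    have "(\<Sum>i<length s. load (x # h) i / s ! i) =
        (\<Sum>i<length s. (if snd x = i then fst x / s ! i else 0)) + (\<Sum>i<length s. load h i / s ! i)"
      unfolding sum.distrib[symmetric]
      by (intro sum.cong) (auto simp: load_def case_prod_unfold add_divide_distrib)
    then show ?case using Cons by simp
  qed (simp add: load_def)
  moreover have "0 \<le> load h i" for i
    using assms(1) unfolding load_def by (intro sum_list_nonneg) auto
  moreover have "0 < s ! i" if "i < length s" for i using valid_speedsD[OF s] that by blast
  ultimately have "(\<Sum>i<length s. (load h i / s ! i) powr 1) = (\<Sum>x\<leftarrow>h. fst x / s ! snd x)"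
    by (subst sum.cong[OF refl, of _ _ "\<lambda>i. load h i / s ! i"]) (auto simp: less_imp_le)
  moreover have "0 \<le> (\<Sum>x\<leftarrow>h. fst x / s ! snd x)"
    using assms(1) valid_speedsD[OF s] by (intro sum_list_nonneg) (auto intro!: divide_nonneg_pos)
  ultimately show ?thesis by (simp add: objective_def lq_norm_def)
qed

text \<open>With \<open>c = 0\<close> a positive weight means that nothing is faster;
  \<open>pick_positive\<close> guarantees such a choice on every seed.\<close>

lemma choose_machine_fastest:
  assumes s: "valid_speeds s" and k: "k < length s"
  shows "s ! k \<le> s ! choose_machine a 0 ((!) s) (length s) qs p u"
proof -
  note sp = valid_speedsD[OF s]
  let ?w = "weight a 0 ((!) s) (length s) qs p"
  let ?i = "choose_machine a 0 ((!) s) (length s) qs p u"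
  have i: "?i < length s" by (rule choose_machine_less[OF sp(1)])
  have "0 < total_weight a 0 ((!) s) (length s) qs p" using sp by (intro total_weight_pos) auto
  then have "0 < ?w ?i" unfolding choose_machine_def
    by (intro pick_positive[where w="?w" and n="length s"]) (simp_all add: weight_nonneg flip: total_weight_def)
  then have "faster_weight a ((!) s) (length s) ?i \<le> 0" by (simp add: weight_def not_less split: if_splits)
  show ?thesis
  proof (rule ccontr)
    assume "\<not> s ! k \<le> s ! ?i"
    then have "s ! k powr a \<le> faster_weight a ((!) s) (length s) ?i"
      unfolding faster_weight_def using k
        member_le_sum[of k "{..<length s}" "\<lambda>l. if s ! ?i < s ! l then s ! l powr a else 0"] by simp
    then show False using \<open>faster_weight a ((!) s) (length s) ?i \<le> 0\<close> sp(2)[OF k]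
      by (smt (verit) powr_gt_zero)
  qed
qed

text \<open>For exponent 1 the objective is the sum of the separate processing times, so placing
  each job on a fastest machine is optimal.\<close>

lemma objective_1_optimal:
  assumes s: "valid_speeds s" and ps: "valid_sizes ps"
  shows "objective 1 s (run (mech a 0) s ps \<omega>) \<le> opt 1 s ps"
proof -
  note sp = valid_speedsD[OF s] and pp = valid_sizesD[OF ps]
  let ?ch = "\<lambda>j. choose_machine a 0 ((!) s) (length s) (take j ps) (ps ! j) (\<omega> j 0)"
  obtain ks where ks: "length ks = length ps" "set ks \<subseteq> {..<length s}"
    and opt: "opt 1 s ps = objective 1 s (zip ps ks)"
    using opt_attained[of s ps 1] sp(1) by auto
  have km: "ks ! j < length s" if "j < length ps" for j
    using ks that nth_mem[of j ks] by (metis lessThan_iff subsetD)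
  have "objective 1 s (run (mech a 0) s ps \<omega>) = (\<Sum>j<length ps. ps ! j / s ! ?ch j)"
    using pp choose_machine_less[OF sp(1)]
    by (subst objective_1[OF _ s]) (auto simp: run_mech sum_list_sum_nth atLeast0LessThan less_imp_le)
  also have "\<dots> \<le> (\<Sum>j<length ps. ps ! j / s ! (ks ! j))"
    using pp sp km choose_machine_fastest[OF s] choose_machine_less[OF sp(1)]
    by (intro sum_mono divide_left_mono mult_pos_pos) (auto simp: less_imp_le)
  also have "\<dots> = objective 1 s (zip ps ks)"
    using pp km ks
    by (subst objective_1[OF _ s]) (auto simp: sum_list_sum_nth atLeast0LessThan less_imp_le set_zip)
  finally show ?thesis using opt by simp
qed

lemma opt_nonneg: "s \<noteq> [] \<Longrightarrow> 0 \<le> opt q s ps"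
  by (erule opt_attained[of s ps q]) (simp add: objective_def lq_norm_def)

theorem theorem2:
  fixes q :: real
  assumes "q \<ge> 1"
  defines "g \<equiv> \<lambda>m::nat. real m powr ((1 / q) * (1 - 1 / q)) * ln (real m) powr (1 + 1 / q\<^sup>2)"
  shows "\<exists>M. wf_mechanism M \<and> polynomial_time M \<and> two_sided_truthful M \<and>
             ratio_in_expectation q M g \<and> ratio_whp q M g"
proof (cases "q = 1")
  case True
  \<comment> \<open>The conjugate exponent would be infinite. With \<open>c = 0\<close> only fastest
    machines keep weight, and any positive \<open>a\<close> will do; the ratio is 1 on every
    run.\<close>
  let ?M = "mech 1 0"
  have g: "g = (\<lambda>m. real m powr 0 * ln (real m) powr 2)" by (simp add: g_def True)
  have one: "(\<lambda>_. 1) \<in> O(g)"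
  proof (rule bigoI)
    show "\<forall>\<^sub>F m in sequentially. norm (1 :: real) \<le> 1 * norm (g m)"
    proof (rule eventually_sequentiallyI[of 3])
      fix m :: nat assume m: "3 \<le> m"
      have "exp 1 \<le> real m" using exp_le m by linarith
      then have "1 \<le> ln (real m)" using m by (simp add: ln_ge_iff)
      then show "norm (1 :: real) \<le> 1 * norm (g m)" using m by (simp add: g ge_one_powr_ge_zero)
    qed
  qed
  have opt: "objective q s (run ?M s ps \<omega>) \<le> 1 * opt q s ps"
    if "valid_speeds s \<and> length s = m \<and> valid_sizes ps" for s ps m \<omega>
    using objective_1_optimal[of s ps 1 \<omega>] that by (simp add: True)
  interpret R: prob_space run_space by (rule prob_space_run_space)
  have "(LINT \<omega>|run_space. objective q s (run ?M s ps \<omega>)) \<le> 1 * opt q s ps"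
    if "valid_speeds s \<and> length s = m \<and> valid_sizes ps" for s ps m
  proof -
    have "(LINT \<omega>|run_space. objective q s (run ?M s ps \<omega>)) \<le> (LINT \<omega>|run_space. 1 * opt q s ps)"
      using opt[OF that] opt_nonneg[of s q ps] that by (intro integral_mono') (auto simp: valid_speeds_def)
    then show ?thesis using R.prob_space by simp
  qed
  then have "competitive_in_expectation q ?M m 1" for m
    unfolding competitive_in_expectation_def by blast
  then have "ratio_in_expectation q ?M g"
    using one unfolding ratio_in_expectation_def by (intro bexI[of _ "\<lambda>_. 1"]) auto
  moreover have "competitive_with_prob q ?M m 1 (1 - real m powr (- c))" for m c
    unfolding competitive_with_prob_def using opt R.prob_space by simp
  then have "ratio_whp q ?M g"
    using one unfolding ratio_whp_def by (intro allI impI bexI[of _ "\<lambda>_. 1"]) auto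
  ultimately show ?thesis
    using wf_mechanism_mech polynomial_time_mech machine_truthful_mech job_truthful_mech
    by (intro exI[of _ ?M]) (simp add: two_sided_truthful_def)
next
  case False
  then have q: "1 < q" using assms(1) by simp
  define a where "a = q / (q - 1)"
  have a: "1 < a" "1 / q + 1 / a = 1" using q by (auto simp: a_def field_simps)
  let ?M = "mech a 1"
  have inst: "scheduling_instance q a s ps" if "valid_speeds s" "valid_sizes ps" "ps \<noteq> []" for s ps
    using that q a by unfold_locales auto
  \<comment> \<open>The constants of the locale depend on \<open>q\<close> only, which makes the
    bound uniform over all instances.\<close>
  define C where "C t = 6 * scheduling_instance.mean_factor q + 12 * scheduling_instance.noise_factor q * t + 18 * t + 12 * t\<^sup>2" for t
  have C: "(\<lambda>m. C t * ratio_bound q m) \<in> O(g)" for t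
    unfolding g_def by (rule ratio_bound_bigo[OF q])
  interpret R: prob_space run_space by (rule prob_space_run_space)
  have "competitive_in_expectation q ?M m (C 4 * ratio_bound q m)" for m
    unfolding competitive_in_expectation_def
  proof (intro allI impI)
    fix s ps assume *: "valid_speeds s \<and> length s = m \<and> valid_sizes ps"
    show "(LINT \<omega>|run_space. objective q s (run ?M s ps \<omega>)) \<le> C 4 * ratio_bound q m * opt q s ps"
    \<comment> \<open>The locale requires a job; without jobs objective and optimum both
      vanish.\<close>
    proof (cases "ps = []")
      case True
      then show ?thesis using * by (simp add: run_Nil objective_Nil opt_Nil valid_speeds_def)
    next
      case False
      then interpret scheduling_instance q a s ps using * inst by blast
      show ?thesis using expected_objective_le * by (simp add: C_def whp_factor_def)
    qed
  qed
  then have "ratio_in_expectation q ?M g"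
    using C[of 4] unfolding ratio_in_expectation_def
    by (intro bexI[of _ "\<lambda>m. C 4 * ratio_bound q m"]) auto
  moreover have "competitive_with_prob q ?M m (C (c + 2) * ratio_bound q m) (1 - real m powr (- c))"
    if c: "0 < c" for m c
    unfolding competitive_with_prob_def
  proof (intro allI impI)
    fix s ps assume *: "valid_speeds s \<and> length s = m \<and> valid_sizes ps"
    show "1 - real m powr (- c) \<le>
        \<P>(\<omega> in run_space. objective q s (run ?M s ps \<omega>) \<le> C (c + 2) * ratio_bound q m * opt q s ps)"
    proof (cases "ps = []")
      case True
      then show ?thesis using * R.prob_space by (simp add: run_Nil objective_Nil opt_Nil valid_speeds_def)
    next
      case False
      then interpret scheduling_instance q a s ps using * inst by blast
      show ?thesis using prob_objective_le[OF c] * by (simp add: C_def whp_factor_def)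
    qed
  qed
  then have "\<exists>\<rho>\<in>O(g). \<forall>m\<ge>1. competitive_with_prob q ?M m (\<rho> m) (1 - real m powr (- c))"
    if "0 < c" for c
    using C[of "c + 2"] that by (intro bexI[of _ "\<lambda>m. C (c + 2) * ratio_bound q m"]) auto
  then have "ratio_whp q ?M g" unfolding ratio_whp_def by blast
  ultimately show ?thesis
    using a wf_mechanism_mech polynomial_time_mech machine_truthful_mech job_truthful_mech
    by (intro exI[of _ ?M]) (simp add: two_sided_truthful_def)
qed

end
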